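(* Let $\mathcal{A}$ be an arrangement in $V$ and $H\in\mathcal{A}$. Then: (1) $\mathrm{Min}(\overline S/J_{\mathcal{A}}^H)=\{P_X\mid X\in\Xi^{\max}(\mathcal{A},H)\}$. (2) $\mathrm{Ass}(\overline S/J_{\mathcal{A}}^H)\subset\{P_X\mid X\in\Xi(\mathcal{A},H)\}$. (3) If $X\in\Xi^{\max}(\mathcal{A},H)$ and $\mathcal{A}_X$ is free, then $J_{\mathcal{A}_X}^H$ is a complete intersection.
   Context: Let $\mathbb{K}$ be a field, $V$ an $\ell$-dimensional $\mathbb{K}$-vector space, $x_1,\dots,x_\ell$ a basis of $V^*$ and $S=\mathrm{Sym}(V^* )=\mathbb{K}[x_1,\dots,x_\ell]$. An arrangement in $V$ is a finite set $\mathcal{A}$ of linear hyperplanes (through the origin) of $V$. For a hyperplane $H$, $\alpha_H\in V^*$ denotes a fixed defining linear form, and $Q(\mathcal{A})=\prod_{H\in\mathcal{A}}\alpha_H$. Let $\Omega_V^1=\bigoplus_i S\,dx_i$, $\Omega_V^2=\bigwedge^2\Omega_V^1$, and for $\alpha=\sum c_ix_i$ let $d\alpha=\sum c_i\,dx_i$. Define $$\Omega^1(\mathcal{A})=\{\omega\in \tfrac{1}{Q(\mathcal{A})}\Omega^1_V \mid Q(\mathcal{A})\,\omega\wedge d\alpha_L\in\alpha_L\Omega_V^2\ \text{for all } L\in\mathcal{A}\}.$$ $\mathcal{A}$ is free if $\Omega^1(\mathcal{A})$ is a free $S$-module (equivalently, if $D(\mathcal{A})=\{\theta\in\bigoplus_i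 S\,\partial_{x_i}\mid \theta(\alpha_L)\in(\alpha_L)\ \forall L\in\mathcal{A}\}$ is free). For $H\in\mathcal{A}$, the restriction is $\mathcal{A}^H=\{H\cap L\mid L\in\mathcal{A},L\ne H\}$, an arrangement in $H$ with coordinate ring $\overline S=S/(\alpha_H)=\mathrm{Sym}(H^* )$; $\overline g$ is the image in $\overline S$ of $g\in S$. The residue map $\mathrm{res}^H_{\mathcal{A}}:\Omega^1(\mathcal{A})\to\overline S$ is $$\mathrm{res}^H_{\mathcal{A}}\big(f\,d\alpha_H+f_2\,d\alpha_2+\cdots+f_\ell\,d\alpha_\ell\big)=\frac{1}{Q(\mathcal{A}^H)}\,\overline{Q(\mathcal{A})f},$$ where $\alpha_H,\alpha_2,\dots,\alpha_\ell$ is any basis of $V^*$ (well defined, independent of the choice of $\alpha_2,\dots,\alpha_\ell$, with values in $\overline S$). The residue ideal $J_{\mathcal{A}}^H\subset\overline S$ is the image of $\mathrm{res}^H_{\mathcal{A}}$. $L(\mathcal{A}^H)$ is the set of all subspaces of $H$ that are intersections of hyperplanes of $\mathcal{A}^H$ (including $H$ as the empty intersection). For a subspace $X$, $\mathcal{A}_X=\{L\in\mathcal{A}\mid X\subseteq L\}$. Define $\Xi(\mathcal{A},H)=\{X\in L(\mathcal{A}^H)\mid J_{\mathcal{A}_X}^H\ne\overline S\}$, and let $\Xi^{\max}(\mathcal{A},H)$ be the set of its maximal elements with respect to inclusion of subspaces. $P_X\subset\overline S$ is the defining ideal of a subspace $X\subset H$. $\mathrm{Ass}(\overline S/J)$ is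 the set of associated primes and $\mathrm{Min}(\overline S/J)$ the set of minimal primes containing $J$. An ideal $J\subset\overline S$ is a complete intersection if, for some $k$, it is generated by $k$ elements and $\overline S/J$ has Krull dimension $\ell-1-k$. *)

theory Defs
  imports
    "HOL-Analysis.Cartesian_Space"
    "HOL-Algebra.Algebraic_Closure_Type"
    "HOL-Algebra.QuotRing"
    "HOL-Library.Poly_Mapping"
    "HOL-Library.Extended_Real"
    "HOL-Computational_Algebra.Fraction_Field"
begin

section \<open>Commutative algebra\<close>

definition min_primes :: "('a, 'b) ring_scheme \<Rightarrow> 'a set \<Rightarrow> 'a set set" where
  "min_primes R J = {P. primeideal P R \<and> J \<subseteq> P \<and>
     (\<forall>P'. primeideal P' R \<and> J \<subseteq> P' \<and> P' \<subseteq> P \<longrightarrow> P' = P)}"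

text \<open>The associated primes of the \<open>R\<close>-module \<open>R/J\<close>: primes that are the annihilator of an element \<open>m\<close>.\<close>

definition ass_primes :: "('a, 'b) ring_scheme \<Rightarrow> 'a set \<Rightarrow> 'a set set" where
  "ass_primes R J = {P. primeideal P R \<and>
     (\<exists>m \<in> carrier (R Quot J).
        P = {r \<in> carrier R. (J +>\<^bsub>R\<^esub> r) \<otimes>\<^bsub>R Quot J\<^esub> m = \<zero>\<^bsub>R Quot J\<^esub>})}"

text \<open>The Krull dimension of the zero ring is \<open>-\<infinity>\<close>, the supremum of the empty set.\<close>

definition krull_dim :: "('a, 'b) ring_scheme \<Rightarrow> ereal" where
  "krull_dim R = Sup {ereal (real n) | n.
     \<exists>P. (\<forall>i\<le>n. primeideal (P i) R) \<and> (\<forall>i<n. P i \<subset> P (Suc i))}"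

text \<open>Here \<open>d\<close> stands for the dimension of \<open>R\<close>; it is \<open>l - 1\<close> for the coordinate ring of \<open>H\<close>.\<close>

definition complete_intersection :: "('a, 'b) ring_scheme \<Rightarrow> nat \<Rightarrow> 'a set \<Rightarrow> bool" where
  "complete_intersection R d J \<longleftrightarrow> (\<exists>(k::nat) (g :: nat \<Rightarrow> 'a).
     g ` {..<k} \<subseteq> carrier R \<and> J = Idl\<^bsub>R\<^esub> (g ` {..<k}) \<and>
     krull_dim (R Quot J) = ereal (real d - real k))"


section \<open>Polynomials and differential forms on \<open>V = K\<^sup>l\<close>\<close>

text \<open>The vector space \<open>V\<close> is \<open>'k ^ 'n\<close> with \<open>l = CARD('n)\<close>, and \<open>S = K[x\<^sub>1, \<dots>, x\<^sub>l]\<close> is the ring of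
  polynomials in variables indexed by \<open>'n\<close>.  A linear form \<open>\<Sum> c\<^sub>i x\<^sub>i\<close> in the dual \<open>V\<^sup>*\<close> is given by its
  coefficient vector \<open>c\<close>.  The linear order on \<open>'n\<close> only serves to obtain from the library that
  \<open>S\<close> is an integral domain.\<close>

type_synonym ('k, 'n) mpol = "('n \<Rightarrow>\<^sub>0 nat) \<Rightarrow>\<^sub>0 'k"

definition lin_eval :: "'k::field ^ 'n::finite \<Rightarrow> 'k ^ 'n \<Rightarrow> 'k" where
  "lin_eval c v = (\<Sum>i\<in>UNIV. c $ i * v $ i)"

definition lin_form :: "'k::field ^ 'n::finite \<Rightarrow> ('k, 'n) mpol" where
  "lin_form c = (\<Sum>i\<in>UNIV. Poly_Mapping.single (Poly_Mapping.single i 1) (c $ i))"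

text \<open>A 1-form \<open>\<Sum> \<eta>\<^sub>i dx\<^sub>i\<close> (polynomial or rational) is the vector of its coefficients.\<close>

definition dform :: "'k::field ^ 'n::finite \<Rightarrow> ('k, 'n) mpol ^ 'n" where
  "dform c = (\<chi> i. Poly_Mapping.single 0 (c $ i))"

text \<open>The exterior square of the free module \<open>S\<^sup>l\<close> is identified with the alternating \<open>l\<times>l\<close> matrices over
  \<open>S\<close>, \<open>dx\<^sub>i \<and> dx\<^sub>j\<close> (\<open>i \<noteq> j\<close>) corresponding to \<open>E\<^sub>i\<^sub>j - E\<^sub>j\<^sub>i\<close>.\<close>

definition two_forms :: "('a::comm_ring_1 ^ 'n ^ 'n) set" where
  "two_forms = {\<mu>. (\<forall>i. \<mu> $ i $ i = 0) \<and> (\<forall>i j. \<mu> $ i $ j = - (\<mu> $ j $ i))}"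

definition wedge :: "'a::comm_ring_1 ^ 'n \<Rightarrow> 'a ^ 'n \<Rightarrow> 'a ^ 'n ^ 'n" where
  "wedge \<eta> \<zeta> = (\<chi> i j. \<eta> $ i * \<zeta> $ j - \<eta> $ j * \<zeta> $ i)"

definition fract_vec :: "'a::idom ^ 'n \<Rightarrow> 'a fract ^ 'n" where
  "fract_vec \<eta> = (\<chi> i. Fract (\<eta> $ i) 1)"

text \<open>The action of \<open>S\<close> on rational 1-forms.\<close>

definition form_scale :: "'a::idom \<Rightarrow> 'a fract ^ 'n::finite \<Rightarrow> 'a fract ^ 'n" where
  "form_scale s \<omega> = Fract s 1 *s \<omega>"

lemma Fract_add_1: "Fract (a + b) 1 = Fract a 1 + Fract (b :: 'a::idom) 1"
  by simp

interpretation form: Modules.module "form_scale :: 'a::idom \<Rightarrow> 'a fract ^ 'n::finite \<Rightarrow> 'a fract ^ 'n"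
  by unfold_locales
    (simp_all only: form_scale_def vector_add_ldistrib vector_sadd_rdistrib vector_smult_assoc
       vector_smult_lid Fract_add_1 mult_fract mult_1_left flip: One_fract_def)


section \<open>Arrangements and logarithmic 1-forms\<close>

definition arrangement :: "('k::field ^ 'n::finite) set set \<Rightarrow> bool" where
  "arrangement A \<longleftrightarrow> finite A \<and> (\<forall>L\<in>A. vec.subspace L \<and> vec.dim L + 1 = CARD('n))"

text \<open>\<open>A\<^sup>H\<close>.\<close>

definition restriction :: "('k::field ^ 'n::finite) set set \<Rightarrow> ('k ^ 'n) set \<Rightarrow> ('k ^ 'n) set set" where
  "restriction A H = {H \<inter> L | L. L \<in> A \<and> L \<noteq> H}"

text \<open>\<open>A\<^sub>Z\<close>.\<close>

definition localization :: "('k::field ^ 'n::finite) set set \<Rightarrow> ('k ^ 'n) set \<Rightarrow> ('k ^ 'n) set set" where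
  "localization A Z = {L \<in> A. Z \<subseteq> L}"

text \<open>\<open>L(A\<^sup>H)\<close>; the empty \<open>B\<close> gives \<open>H\<close> itself.\<close>

definition flats :: "('k::field ^ 'n::finite) set set \<Rightarrow> ('k ^ 'n) set \<Rightarrow> ('k ^ 'n) set set" where
  "flats A H = {H \<inter> \<Inter>B | B. B \<subseteq> restriction A H}"

text \<open>The fixed choices of defining forms are parameters: \<open>\<alpha> L\<close> is a form on \<open>V\<close> with kernel \<open>L\<close>, and
  \<open>\<beta> Y\<close> is a form on \<open>V\<close> whose restriction to \<open>H\<close> has kernel \<open>Y\<close>, i.e. a lift to \<open>V\<^sup>*\<close> of
  the chosen defining form of \<open>Y\<close> in \<open>H\<^sup>*\<close>.\<close>

definition defining_forms ::
    "(('k::field ^ 'n::finite) set \<Rightarrow> 'k ^ 'n) \<Rightarrow> ('k ^ 'n) set set \<Rightarrow> bool" where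
  "defining_forms \<alpha> A \<longleftrightarrow> (\<forall>L\<in>A. L = {v. lin_eval (\<alpha> L) v = 0})"

definition restricted_forms ::
    "(('k::field ^ 'n::finite) set \<Rightarrow> 'k ^ 'n) \<Rightarrow> ('k ^ 'n) set set \<Rightarrow> ('k ^ 'n) set \<Rightarrow> bool" where
  "restricted_forms \<beta> A H \<longleftrightarrow> (\<forall>Y\<in>restriction A H. Y = {v\<in>H. lin_eval (\<beta> Y) v = 0})"

definition arr_poly ::
    "(('k::field, 'n::{finite,linorder}) vec set \<Rightarrow> ('k, 'n) vec) \<Rightarrow> ('k, 'n) vec set set \<Rightarrow> ('k, 'n) mpol" where
  "arr_poly \<alpha> A = (\<Prod>L\<in>A. lin_form (\<alpha> L))"

definition log_forms ::
    "(('k::field, 'n::{finite,linorder}) vec set \<Rightarrow> ('k, 'n) vec) \<Rightarrow> ('k, 'n) vec set set \<Rightarrow>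
     (('k, 'n) mpol fract, 'n) vec set" where
  "log_forms \<alpha> A = {\<omega>. \<exists>\<eta>. \<omega> = (\<chi> i. Fract (\<eta> $ i) (arr_poly \<alpha> A)) \<and>
     (\<forall>L\<in>A. \<exists>\<mu>\<in>two_forms.
        wedge \<eta> (dform (\<alpha> L)) = (\<chi> i j. lin_form (\<alpha> L) * \<mu> $ i $ j))}"

definition free_arrangement ::
    "(('k::field, 'n::{finite,linorder}) vec set \<Rightarrow> ('k, 'n) vec) \<Rightarrow> ('k, 'n) vec set set \<Rightarrow> bool" where
  "free_arrangement \<alpha> A \<longleftrightarrow>
     (\<exists>B. form.independent B \<and> form.span B = log_forms \<alpha> A)"


section \<open>The residue ideal\<close>

text \<open>The coordinate ring \<open>S/(\<alpha>\<^sub>H)\<close> of \<open>H\<close> and the quotient map onto it, for \<open>a = \<alpha>\<^sub>H\<close>.\<close>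

definition Sbar :: "'k::field ^ 'n::finite \<Rightarrow> ('k, 'n) mpol set ring" where
  "Sbar a = ring_of_type_algebra Quot (PIdl\<^bsub>ring_of_type_algebra\<^esub> (lin_form a))"

definition bar :: "'k::field ^ 'n::finite \<Rightarrow> ('k, 'n) mpol \<Rightarrow> ('k, 'n) mpol set" where
  "bar a g = PIdl\<^bsub>ring_of_type_algebra\<^esub> (lin_form a) +>\<^bsub>ring_of_type_algebra\<^esub> g"

text \<open>\<open>B\<close> is a basis of \<open>V\<^sup>*\<close> containing \<open>\<alpha>\<^sub>H\<close>, the family \<open>f\<close> holds the coefficients of \<open>\<omega>\<close> in the basis
  \<open>db\<close> (\<open>b \<in> B\<close>), and \<open>g = Q(A) f(\<alpha>\<^sub>H)\<close>.  As \<open>Sbar\<close> is a domain, the last conjunct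
  determines the quotient \<open>r\<close> of the class of \<open>g\<close> by \<open>Q(A\<^sup>H)\<close>.\<close>

definition is_residue ::
    "(('k::field, 'n::{finite,linorder}) vec set \<Rightarrow> ('k, 'n) vec) \<Rightarrow> (('k, 'n) vec set \<Rightarrow> ('k, 'n) vec) \<Rightarrow>
     ('k, 'n) vec set set \<Rightarrow> ('k, 'n) vec set \<Rightarrow> (('k, 'n) mpol fract, 'n) vec \<Rightarrow> ('k, 'n) mpol set \<Rightarrow> bool" where
  "is_residue \<alpha> \<beta> A H \<omega> r \<longleftrightarrow> r \<in> carrier (Sbar (\<alpha> H)) \<and>
     (\<exists>B f g. vec.independent B \<and> vec.span B = UNIV \<and> \<alpha> H \<in> B \<and>
        \<omega> = (\<Sum>b\<in>B. f b *s fract_vec (dform b)) \<and>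
        Fract (arr_poly \<alpha> A) 1 * f (\<alpha> H) = Fract g 1 \<and>
        bar (\<alpha> H) (arr_poly \<beta> (restriction A H)) \<otimes>\<^bsub>Sbar (\<alpha> H)\<^esub> r = bar (\<alpha> H) g)"

definition res ::
    "(('k::field, 'n::{finite,linorder}) vec set \<Rightarrow> ('k, 'n) vec) \<Rightarrow> (('k, 'n) vec set \<Rightarrow> ('k, 'n) vec) \<Rightarrow>
     ('k, 'n) vec set set \<Rightarrow> ('k, 'n) vec set \<Rightarrow> (('k, 'n) mpol fract, 'n) vec \<Rightarrow> ('k, 'n) mpol set" where
  "res \<alpha> \<beta> A H \<omega> = (THE r. is_residue \<alpha> \<beta> A H \<omega> r)"

definition residue_ideal ::
    "(('k::field, 'n::{finite,linorder}) vec set \<Rightarrow> ('k, 'n) vec) \<Rightarrow> (('k, 'n) vec set \<Rightarrow> ('k, 'n) vec) \<Rightarrow>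
     ('k, 'n) vec set set \<Rightarrow> ('k, 'n) vec set \<Rightarrow> ('k, 'n) mpol set set" where
  "residue_ideal \<alpha> \<beta> A H = res \<alpha> \<beta> A H ` log_forms \<alpha> A"

definition Xi ::
    "(('k::field, 'n::{finite,linorder}) vec set \<Rightarrow> ('k, 'n) vec) \<Rightarrow> (('k, 'n) vec set \<Rightarrow> ('k, 'n) vec) \<Rightarrow>
     ('k, 'n) vec set set \<Rightarrow> ('k, 'n) vec set \<Rightarrow> ('k, 'n) vec set set" where
  "Xi \<alpha> \<beta> A H = {Z \<in> flats A H.
     residue_ideal \<alpha> \<beta> (localization A Z) H \<noteq> carrier (Sbar (\<alpha> H))}"

definition Xi_max ::
    "(('k::field, 'n::{finite,linorder}) vec set \<Rightarrow> ('k, 'n) vec) \<Rightarrow> (('k, 'n) vec set \<Rightarrow> ('k, 'n) vec) \<Rightarrow>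
     ('k, 'n) vec set set \<Rightarrow> ('k, 'n) vec set \<Rightarrow> ('k, 'n) vec set set" where
  "Xi_max \<alpha> \<beta> A H = {Z \<in> Xi \<alpha> \<beta> A H. \<forall>Y \<in> Xi \<alpha> \<beta> A H. Z \<subseteq> Y \<longrightarrow> Y = Z}"

text \<open>The defining ideal \<open>P\<^sub>Z\<close> is generated by the linear forms vanishing on \<open>Z\<close>.  Over a finite field
  the ideal of all polynomials that vanish at the points of \<open>Z\<close> would be larger.\<close>

definition flat_ideal :: "'k::field ^ 'n::finite \<Rightarrow> ('k ^ 'n) set \<Rightarrow> ('k, 'n) mpol set set" where
  "flat_ideal a Z = Idl\<^bsub>Sbar a\<^esub> {bar a (lin_form c) | c. \<forall>v\<in>Z. lin_eval c v = 0}"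

end

theory Submission
  imports Defs "HOL-Computational_Algebra.Polynomial"
begin

text \<open>Ideals of \<open>S/(\<alpha>\<^sub>H)\<close> are handled as ideals of \<open>S\<close> containing \<open>\<alpha>\<^sub>H\<close>.

  For a prime \<open>P\<close> over \<open>J\<^sub>A\<close>, let \<open>Z\<close> be the intersection of the \<open>Y \<in> A\<^sup>H\<close> whose form lies in \<open>P\<close>.  Then
  \<open>P\<^sub>Z \<subseteq> P\<close>, and \<open>J\<^sub>A\<close> agrees with \<open>J\<^bsub>A\<^sub>Z\<^esub>\<close> up to factors outside \<open>P\<close>.  The ideal \<open>J\<^bsub>A\<^sub>Z\<^esub>\<close> is homogeneous and
  generated by polynomials in the forms vanishing on \<open>Z\<close>; hence it is either the unit ideal or contained in \<open>P\<^sub>Z\<close>,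
  and \<open>P\<^sub>Z\<close> is the only prime containing \<open>P\<^sub>Z\<close> that can be associated to it.  This gives the minimal and the associated primes.

  If \<open>A\<^sub>Z\<close> is free, \<open>J\<^bsub>A\<^sub>Z\<^esub>\<close> is the image of a module with \<open>l\<close> generators.  Its elements \<open>d\<alpha>\<^sub>L/\<alpha>\<^sub>L\<close> (\<open>L \<noteq> H\<close>) and \<open>dz\<close>, for \<open>z\<close>
  in a system of \<open>dim Z\<close> coordinates on \<open>Z\<close>, have residue \<open>0\<close> and are independent modulo the irrelevant
  ideal, so by graded Nakayama \<open>l - 1 - dim Z\<close> generators of \<open>J\<^bsub>A\<^sub>Z\<^esub>\<close> suffice.  For maximal \<open>Z\<close> the
  primes over \<open>J\<^bsub>A\<^sub>Z\<^esub>\<close> are those over \<open>P\<^sub>Z\<close>, so the quotient has dimension \<open>dim Z\<close>.\<close>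

section \<open>Substitution homomorphisms of polynomial rings\<close>

text \<open>The comparison of the ideals of \<open>A\<close> and of its localization at
  \<open>Z\<close> rests on two products of linear forms. Passing to fewer hyperplanes costs the
  factor of Q(A^H) that belongs to the \<open>Y\<close> not containing \<open>Z\<close>. Going back,
  a numerator is multiplied by all \<open>\<alpha> L\<close> with \<open>Z\<close> outside
  \<open>L\<close>; modulo the form of \<open>H\<close> this product is a multiple of the first one,
  with quotient \<open>e\<close>. The choice of \<open>Z\<close> keeps both \<open>e\<close> and the
  lost factor outside P. The field may be finite, so ideals of subspaces are treated as kernels of
  projections, and algebraic dependence is obtained by counting monomials. Freeness enters through a
  number only: a basis over S stays independent over the fraction field, so it has at most l
  elements. The form \<open>d\<alpha>_L/\<alpha>_L\<close> needs a hyperplane other than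
  \<open>H\<close>; it exists because the arrangement consisting of \<open>H\<close> alone has the
  unit ideal as residue ideal. Nakayama's argument needs homogeneous generators, while residues of
  basis elements may be inhomogeneous; their components are taken and thinned out by exchange.
  Padding with zeros then makes the number of generators exactly the codimension in H.\<close>

locale rhom =
  fixes h :: "'a::comm_ring_1 \<Rightarrow> 'b::comm_ring_1"
  assumes one [simp]: "h 1 = 1"
    and add [simp]: "h (x + y) = h x + h y"
    and mult [simp]: "h (x * y) = h x * h y"
begin

lemma zero [simp]: "h 0 = 0"
  using add[of 0 0] by simp

lemma uminus [simp]: "h (- x) = - h x"
  using add[of x "- x"] by (simp add: eq_neg_iff_add_eq_0 add.commute)

lemma diff [simp]: "h (x - y) = h x - h y"
  using add[of x "- y"] by simp

lemma sum [simp]: "h (sum f I) = (\<Sum>i\<in>I. h (f i))"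
  by (induction I rule: infinite_finite_induct) auto

lemma prod [simp]: "h (prod f I) = (\<Prod>i\<in>I. h (f i))"
  by (induction I rule: infinite_finite_induct) auto

lemma power [simp]: "h (x ^ n) = h x ^ n"
  by (induction n) auto

end

lemma rhom_id: "rhom (\<lambda>x. x)"
  by unfold_locales auto

lemma rhom_comp: "rhom g \<Longrightarrow> rhom h \<Longrightarrow> rhom (\<lambda>x. g (h x))"
  by (simp add: rhom_def)

definition Const :: "'k::comm_ring_1 \<Rightarrow> ('v \<Rightarrow>\<^sub>0 nat) \<Rightarrow>\<^sub>0 'k" where
  "Const a = Poly_Mapping.single 0 a"

definition Var :: "'v \<Rightarrow> ('v \<Rightarrow>\<^sub>0 nat) \<Rightarrow>\<^sub>0 'k::comm_ring_1" where
  "Var i = Poly_Mapping.single (Poly_Mapping.single i 1) 1"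

definition mono_eval :: "('v \<Rightarrow> 'r::comm_ring_1) \<Rightarrow> ('v \<Rightarrow>\<^sub>0 nat) \<Rightarrow> 'r" where
  "mono_eval x m = (\<Prod>i\<in>Poly_Mapping.keys m. x i ^ Poly_Mapping.lookup m i)"

text \<open>The map \<open>c\<close> on coefficients is a separate argument because the targets
  vary: the field, the polynomials themselves, polynomials over polynomials, and univariate
  polynomials.\<close>

definition subst :: "('k::comm_ring_1 \<Rightarrow> 'r::comm_ring_1) \<Rightarrow> ('v \<Rightarrow> 'r) \<Rightarrow> (('v \<Rightarrow>\<^sub>0 nat) \<Rightarrow>\<^sub>0 'k) \<Rightarrow> 'r" where
  "subst c x f = (\<Sum>m\<in>Poly_Mapping.keys f. c (Poly_Mapping.lookup f m) * mono_eval x m)"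

lemma rhom_Const: "rhom (Const :: 'k::comm_ring_1 \<Rightarrow> ('v \<Rightarrow>\<^sub>0 nat) \<Rightarrow>\<^sub>0 'k)"
  by unfold_locales (simp_all add: Const_def single_add mult_single)

interpretation Const: rhom "Const :: 'k::comm_ring_1 \<Rightarrow> ('v \<Rightarrow>\<^sub>0 nat) \<Rightarrow>\<^sub>0 'k"
  by (rule rhom_Const)

lemma Const_eq_iff [simp]: "Const a = Const b \<longleftrightarrow> a = b"
  by (metis Const_def lookup_single_eq)

lemma Const_inverse_mult: "(a::'k::field) \<noteq> 0 \<Longrightarrow> Const (inverse a) * Const a = 1"
  by (simp flip: Const.mult)

lemma mono_eval_superset:
  assumes "finite F" "Poly_Mapping.keys m \<subseteq> F"
  shows "mono_eval x m = (\<Prod>i\<in>F. x i ^ Poly_Mapping.lookup m i)"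
  unfolding mono_eval_def
  by (rule prod.mono_neutral_left) (use assms in \<open>auto simp: in_keys_iff\<close>)

lemma mono_eval_0 [simp]: "mono_eval x 0 = 1"
  by (simp add: mono_eval_def)

lemma mono_eval_single [simp]: "mono_eval x (Poly_Mapping.single i n) = x i ^ n"
  by (simp add: mono_eval_def)

lemma mono_eval_add: "mono_eval x (m + m') = mono_eval x m * mono_eval x m'"
proof -
  let ?F = "Poly_Mapping.keys m \<union> Poly_Mapping.keys m'"
  have "Poly_Mapping.keys (m + m') \<subseteq> ?F"
    by (rule keys_add)
  then show ?thesis
    by (simp add: mono_eval_superset[of ?F] lookup_add power_add prod.distrib)
qed

lemma poly_mapping_sum_single:
  "f = (\<Sum>m\<in>Poly_Mapping.keys f. Poly_Mapping.single m (Poly_Mapping.lookup f m))"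
  by (rule poly_mapping_eqI)
    (simp add: lookup_sum lookup_single when_def in_keys_iff)

lemma subst_superset:
  assumes "c 0 = 0" "finite F" "Poly_Mapping.keys f \<subseteq> F"
  shows "subst c x f = (\<Sum>m\<in>F. c (Poly_Mapping.lookup f m) * mono_eval x m)"
  unfolding subst_def
  by (rule sum.mono_neutral_left) (use assms in \<open>auto simp: in_keys_iff\<close>)

lemma subst_0 [simp]: "subst c x 0 = 0"
  by (simp add: subst_def)

lemma subst_single: "c 0 = 0 \<Longrightarrow> subst c x (Poly_Mapping.single m a) = c a * mono_eval x m"
  by (simp add: subst_def)

lemma subst_add:
  assumes "rhom c"
  shows "subst c x (f + g) = subst c x f + subst c x g"
proof -
  interpret rhom c by fact
  let ?F = "Poly_Mapping.keys f \<union> Poly_Mapping.keys g"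
  have "Poly_Mapping.keys (f + g) \<subseteq> ?F"
    by (rule keys_add)
  then show ?thesis
    by (simp add: subst_superset[of c ?F] lookup_add ring_distribs sum.distrib)
qed

lemma subst_sum:
  assumes "rhom c"
  shows "subst c x (sum f I) = (\<Sum>i\<in>I. subst c x (f i))"
  by (induction I rule: infinite_finite_induct) (auto simp: subst_add[OF assms])

lemma rhom_subst:
  assumes "rhom c"
  shows "rhom (subst c x)"
proof
  interpret rhom c by fact
  have *: "subst c x (Poly_Mapping.single m a) = c a * mono_eval x m" for m a
    by (simp add: subst_single)
  show "subst c x 1 = 1"
    using *[of 0 1] by simp
  show "subst c x (f + g) = subst c x f + subst c x g" for f g
    by (rule subst_add[OF assms])
  show "subst c x (f * g) = subst c x f * subst c x g" for f g
  proof -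
    have "f * g = (\<Sum>m\<in>Poly_Mapping.keys f. \<Sum>m'\<in>Poly_Mapping.keys g.
        Poly_Mapping.single (m + m') (Poly_Mapping.lookup f m * Poly_Mapping.lookup g m'))"
      by (subst (1) poly_mapping_sum_single[of f], subst (1) poly_mapping_sum_single[of g])
        (simp add: sum_product mult_single)
    then have "subst c x (f * g) = (\<Sum>m\<in>Poly_Mapping.keys f. \<Sum>m'\<in>Poly_Mapping.keys g.
        (c (Poly_Mapping.lookup f m) * mono_eval x m) * (c (Poly_Mapping.lookup g m') * mono_eval x m'))"
      by (simp add: subst_sum[OF assms] * mono_eval_add mult_ac)
    then show ?thesis
      by (simp add: subst_def sum_product)
  qed
qed

lemma subst_Const [simp]: "rhom c \<Longrightarrow> subst c x (Const a) = c a"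
  by (simp add: Const_def subst_single rhom.zero)

lemma subst_Var [simp]: "rhom c \<Longrightarrow> subst c x (Var i) = x i"
  by (simp add: Var_def subst_single rhom.zero rhom.one)

lemma mono_eval_Var: "mono_eval Var m = Poly_Mapping.single m (1 :: 'k::comm_ring_1)"
proof -
  have pow: "(Var i :: _ \<Rightarrow>\<^sub>0 'k) ^ n = Poly_Mapping.single (Poly_Mapping.single i n) 1" for i n
    by (induction n) (simp_all add: Var_def mult_single single_add[symmetric])
  have pr: "(\<Prod>i\<in>I. Poly_Mapping.single (p i) (1::'k)) = Poly_Mapping.single (sum p I) 1"
    for I and p :: "'a \<Rightarrow> 'a \<Rightarrow>\<^sub>0 nat"
    by (induction I rule: infinite_finite_induct) (simp_all add: mult_single)
  show ?thesis
    unfolding mono_eval_def pow pr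
    by (rule arg_cong[where f = "\<lambda>t. Poly_Mapping.single t 1", OF poly_mapping_sum_single[symmetric]])
qed

lemma single_eq_Const_mono: "Poly_Mapping.single m a = Const a * mono_eval Var m"
  by (simp add: mono_eval_Var Const_def mult_single)

lemma mpol_induct [case_names Const Var add mult]:
  fixes f :: "('v \<Rightarrow>\<^sub>0 nat) \<Rightarrow>\<^sub>0 'k::comm_ring_1"
  assumes C: "\<And>a. P (Const a)" and V: "\<And>i. P (Var i)"
    and A: "\<And>f g. P f \<Longrightarrow> P g \<Longrightarrow> P (f + g)" and M: "\<And>f g. P f \<Longrightarrow> P g \<Longrightarrow> P (f * g)"
  shows "P f"
proof -
  have one: "P 1" and zero: "P 0"
    using C[of 1] C[of 0] by auto
  have pow: "P (g ^ n)" if "P g" for g n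
    by (induction n) (use that one M in auto)
  have prod: "P (prod g I)" if "\<And>i. P (g i)" for I and g :: "'v \<Rightarrow> ('v \<Rightarrow>\<^sub>0 nat) \<Rightarrow>\<^sub>0 'k"
    by (induction I rule: infinite_finite_induct) (use that one M in auto)
  have "P (mono_eval Var m)" for m
    unfolding mono_eval_def by (rule prod) (rule pow[OF V])
  then have s: "P (Poly_Mapping.single m a)" for m a
    unfolding single_eq_Const_mono by (rule M[OF C])
  have sum: "P (sum g I)" if "\<And>i. P (g i)" for I and g :: "('v \<Rightarrow>\<^sub>0 nat) \<Rightarrow> ('v \<Rightarrow>\<^sub>0 nat) \<Rightarrow>\<^sub>0 'k"
    by (induction I rule: infinite_finite_induct) (use that zero A in auto)
  show ?thesis
    by (subst poly_mapping_sum_single) (rule sum[OF s])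
qed

lemma rhom_eqI:
  fixes f :: "('v \<Rightarrow>\<^sub>0 nat) \<Rightarrow>\<^sub>0 'k::comm_ring_1"
  assumes "rhom g" "rhom h" and "\<And>a. g (Const a) = h (Const a)" and "\<And>i. g (Var i) = h (Var i)"
  shows "g f = h f"
proof -
  interpret g: rhom g by fact
  interpret h: rhom h by fact
  show ?thesis
    by (induction f rule: mpol_induct) (use assms in auto)
qed

subsection \<open>Linear forms\<close>

lemma lin_form_altdef: "lin_form c = (\<Sum>i\<in>UNIV. Const (c $ i) * Var i)"
  by (simp add: lin_form_def Const_def Var_def mult_single)

lemma lin_form_add: "lin_form (c + d) = lin_form c + lin_form d"
  by (simp add: lin_form_altdef ring_distribs sum.distrib)

lemma lin_form_scale: "lin_form (a *s c) = Const a * lin_form c"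
  by (simp add: lin_form_altdef sum_distrib_left mult_ac)

lemma lin_form_0 [simp]: "lin_form 0 = 0"
  by (simp add: lin_form_altdef)

lemma lin_form_sum: "lin_form (sum c I) = (\<Sum>i\<in>I. lin_form (c i))"
  by (induction I rule: infinite_finite_induct) (simp_all add: lin_form_add)

lemma lin_form_diff: "lin_form (c - d) = lin_form c - lin_form d"
  using lin_form_add[of "c - d" d] by simp

lemma lin_form_axis: "lin_form (axis i 1) = Var i"
  by (simp add: lin_form_altdef axis_def if_distrib if_distribR cong: if_cong)

lemma lin_eval_add_left: "lin_eval (c + d) v = lin_eval c v + lin_eval d v"
  by (simp add: lin_eval_def ring_distribs sum.distrib)

lemma lin_eval_commute: "lin_eval c v = lin_eval v c"
  by (simp add: lin_eval_def mult.commute)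

lemma lin_eval_add_right: "lin_eval c (v + w) = lin_eval c v + lin_eval c w"
  by (simp add: lin_eval_def ring_distribs sum.distrib)

lemma lin_eval_scale_left: "lin_eval (a *s c) v = a * lin_eval c v"
  by (simp add: lin_eval_def sum_distrib_left mult_ac)

lemma lin_eval_scale_right: "lin_eval c (a *s v) = a * lin_eval c v"
  by (simp add: lin_eval_def sum_distrib_left mult_ac)

lemma lin_eval_0 [simp]: "lin_eval 0 v = 0" "lin_eval c 0 = 0"
  by (simp_all add: lin_eval_def)

lemma lin_eval_diff_left: "lin_eval (c - d) v = lin_eval c v - lin_eval d v"
  using lin_eval_add_left[of "c - d" d v] by simp

lemma lin_eval_sum_left: "lin_eval (sum c I) v = (\<Sum>i\<in>I. lin_eval (c i) v)"
  by (induction I rule: infinite_finite_induct) (simp_all add: lin_eval_add_left)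

lemma lin_eval_sum_right: "lin_eval v (sum c I) = (\<Sum>i\<in>I. lin_eval v (c i))"
  by (induction I rule: infinite_finite_induct) (simp_all add: lin_eval_add_right)

lemma lin_eval_axis [simp]: "lin_eval (axis i 1) v = v $ i" "lin_eval v (axis i 1) = v $ i"
  by (simp_all add: lin_eval_def axis_def if_distrib if_distribR cong: if_cong)

text \<open>A functional on coefficient vectors is evaluation at a vector of V: the functional that
  is 1 at \<open>c\<close> and 0 on a basis of the span of \<open>S\<close> extends linearly, and
  its values on the axes are the coordinates of \<open>v\<close>.\<close>

lemma separating_form:
  fixes S :: "('k::field ^ 'n::finite) set"
  assumes "c \<notin> vec.span S"
  obtains v where "lin_eval c v = 1" and "\<And>d. d \<in> S \<Longrightarrow> lin_eval d v = 0"
proof -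
  obtain C where C: "C \<subseteq> S" "vec.independent C" "S \<subseteq> vec.span C"
    using vec.maximal_independent_subset[of S] by blast
  have "vec.span C = vec.span S"
    using C vec.span_mono[OF C(1)] vec.span_minimal[OF C(3) vec.subspace_span] by auto
  then have "c \<notin> vec.span C"
    using assms by simp
  then have ind: "vec.independent (insert c C)" and "c \<notin> C"
    using vec.independent_insertI[OF _ C(2)] vec.span_base by blast+
  interpret p: vector_space_pair "(*s) :: 'k \<Rightarrow> 'k ^ 'n \<Rightarrow> _" "(*) :: 'k \<Rightarrow> _"
    ..
  obtain g where g: "Vector_Spaces.linear (*s) (*) g" "\<forall>x\<in>insert c C. g x = (if x = c then 1 else 0)"
    using p.linear_independent_extend[OF ind, of "\<lambda>x. if x = c then 1 else 0"] by blast
  interpret g: Vector_Spaces.linear "(*s) :: 'k \<Rightarrow> 'k ^ 'n \<Rightarrow> _" "(*) :: 'k \<Rightarrow> _" g by fact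
  define v where "v = (\<chi> i. g (axis i 1))"
  have gv: "g d = lin_eval d v" for d
  proof -
    have "g d = g (\<Sum>i\<in>UNIV. d $ i *s axis i 1)"
      by (simp add: basis_expansion)
    also have "\<dots> = lin_eval d v"
      by (simp add: g.sum g.scale lin_eval_def v_def)
    finally show ?thesis .
  qed
  have "g d = 0" if "d \<in> vec.span C" for d
    using that
  proof (induction rule: vec.span_induct_alt)
    case base then show ?case by (rule g.zero)
  next
    case (step a x y)
    then show ?case using g(2) \<open>c \<notin> C\<close> by (auto simp: g.add g.scale)
  qed
  then show ?thesis
    using that[of v] C(3) g(2) by (auto simp: gv)
qed

section \<open>Ideals of linear subspaces\<close>

definition is_ideal :: "'a::comm_ring_1 set \<Rightarrow> bool" where
  "is_ideal I \<longleftrightarrow> 0 \<in> I \<and> (\<forall>x\<in>I. \<forall>y\<in>I. x + y \<in> I) \<and> (\<forall>x\<in>I. \<forall>r. r * x \<in> I)"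

definition is_prime :: "'a::comm_ring_1 set \<Rightarrow> bool" where
  "is_prime P \<longleftrightarrow> is_ideal P \<and> 1 \<notin> P \<and> (\<forall>x y. x * y \<in> P \<longrightarrow> x \<in> P \<or> y \<in> P)"

lemma is_idealD:
  assumes "is_ideal I"
  shows "0 \<in> I" and "x \<in> I \<Longrightarrow> y \<in> I \<Longrightarrow> x + y \<in> I"
    and "x \<in> I \<Longrightarrow> r * x \<in> I" and "x \<in> I \<Longrightarrow> x * r \<in> I"
    and "x \<in> I \<Longrightarrow> - x \<in> I" and "x \<in> I \<Longrightarrow> y \<in> I \<Longrightarrow> x - y \<in> I"
proof -
  show *: "0 \<in> I" "x \<in> I \<Longrightarrow> y \<in> I \<Longrightarrow> x + y \<in> I" "x \<in> I \<Longrightarrow> r * x \<in> I" for x y r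
    using assms by (auto simp: is_ideal_def)
  show "x \<in> I \<Longrightarrow> x * r \<in> I" for x r
    using *(3)[of x r] by (simp add: mult.commute)
  show neg: "x \<in> I \<Longrightarrow> - x \<in> I" for x
    using *(3)[of x "-1"] by simp
  show "x \<in> I \<Longrightarrow> y \<in> I \<Longrightarrow> x - y \<in> I"
    using *(2)[of x "- y"] neg[of y] by simp
qed

lemma is_ideal_sum: "is_ideal I \<Longrightarrow> (\<And>i. i \<in> F \<Longrightarrow> f i \<in> I) \<Longrightarrow> sum f F \<in> I"
  by (induction F rule: infinite_finite_induct) (auto simp: is_idealD)

lemma is_ideal_eq_UNIV: "is_ideal I \<Longrightarrow> 1 \<in> I \<Longrightarrow> I = UNIV"
  using is_idealD(3)[of I 1] by fastforce

lemma is_ideal_diff_mem: "is_ideal I \<Longrightarrow> x - y \<in> I \<Longrightarrow> x \<in> I \<longleftrightarrow> y \<in> I"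
  using is_idealD(2)[of I "x - y" y] is_idealD(6)[of I x "x - y"] by auto

lemma is_prime_ideal: "is_prime P \<Longrightarrow> is_ideal P"
  by (simp add: is_prime_def)

lemma is_prime_prod:
  assumes "is_prime P" "prod f F \<in> P"
  shows "\<exists>i\<in>F. f i \<in> P"
  using assms(2)
proof (induction F rule: infinite_finite_induct)
  case (infinite F)
  then show ?case using assms(1) by (simp add: is_prime_def)
next
  case empty
  then show ?case using assms(1) by (simp add: is_prime_def)
next
  case (insert i F)
  then show ?case using assms(1) unfolding is_prime_def by (metis insertCI prod.insert)
qed

lemma is_prime_power: "is_prime P \<Longrightarrow> x ^ n \<in> P \<Longrightarrow> x \<in> P"
  by (induction n) (auto simp: is_prime_def)

lemma is_ideal_kernel: "rhom h \<Longrightarrow> is_ideal {x. h x = 0}"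
  by (simp add: is_ideal_def rhom.zero rhom.add rhom.mult)

lemma is_prime_kernel:
  fixes h :: "'a::comm_ring_1 \<Rightarrow> 'b::idom"
  shows "rhom h \<Longrightarrow> is_prime {x. h x = 0}"
  by (simp add: is_prime_def is_ideal_kernel rhom.one rhom.mult)

lemma is_ideal_dvd: "is_ideal {x. a dvd x}"
  by (simp add: is_ideal_def)

definition subspace_ideal :: "('k::field ^ 'n::finite) set \<Rightarrow> ('k, 'n) mpol set" where
  "subspace_ideal Z = \<Inter>{I. is_ideal I \<and> (\<forall>c. (\<forall>v\<in>Z. lin_eval c v = 0) \<longrightarrow> lin_form c \<in> I)}"

lemma is_ideal_subspace_ideal: "is_ideal (subspace_ideal Z)"
  unfolding subspace_ideal_def by (auto simp: is_ideal_def)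

lemma subspace_ideal_minimal:
  "is_ideal I \<Longrightarrow> (\<And>c. (\<And>v. v \<in> Z \<Longrightarrow> lin_eval c v = 0) \<Longrightarrow> lin_form c \<in> I) \<Longrightarrow> subspace_ideal Z \<subseteq> I"
  unfolding subspace_ideal_def by blast

lemma lin_form_in_subspace_ideal: "(\<And>v. v \<in> Z \<Longrightarrow> lin_eval c v = 0) \<Longrightarrow> lin_form c \<in> subspace_ideal Z"
  unfolding subspace_ideal_def by blast

lemma subspace_ideal_antimono: "Y \<subseteq> Z \<Longrightarrow> subspace_ideal Z \<subseteq> subspace_ideal Y"
  by (rule subspace_ideal_minimal[OF is_ideal_subspace_ideal]) (auto intro: lin_form_in_subspace_ideal)

lemma lookup_lin_form: "Poly_Mapping.lookup (lin_form c) (Poly_Mapping.single i 1) = c $ i"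
proof -
  have "Poly_Mapping.single j (1::nat) = Poly_Mapping.single i 1 \<longleftrightarrow> j = i" for j
    by (metis lookup_single_eq lookup_single_not_eq zero_neq_one)
  then show ?thesis
    by (simp add: lin_form_def lookup_sum lookup_single when_def)
qed

lemma lin_form_eq_0_iff [simp]: "lin_form c = 0 \<longleftrightarrow> c = 0"
  by (metis lookup_lin_form lookup_zero lin_form_0 vec_eq_iff zero_index)

lemma in_span_annihilator:
  assumes "\<And>v. (\<And>d. d \<in> F \<Longrightarrow> lin_eval d v = 0) \<Longrightarrow> lin_eval c v = 0"
  shows "c \<in> vec.span F"
  by (rule ccontr, erule separating_form) (use assms in force)

definition dual_family :: "nat \<Rightarrow> (nat \<Rightarrow> 'k::field ^ 'n::finite) \<Rightarrow> (nat \<Rightarrow> 'k ^ 'n) \<Rightarrow> bool" where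
  "dual_family s v z \<longleftrightarrow> (\<forall>i<s. \<forall>j<s. lin_eval (z i) (v j) = (if i = j then 1 else 0))"

text \<open>\<open>Z\<close> may be any set; \<open>s\<close> is the dimension of its span,
  \<open>v\<close> is a basis of that span taken from \<open>Z\<close>, and the \<open>z j\<close>
  are forms on all of V that restrict to the coordinates.\<close>

definition dual_basis :: "('k::field ^ 'n::finite) set \<Rightarrow> nat \<Rightarrow> (nat \<Rightarrow> 'k ^ 'n) \<Rightarrow> (nat \<Rightarrow> 'k ^ 'n) \<Rightarrow> bool" where
  "dual_basis Z s v z \<longleftrightarrow> dual_family s v z \<and> v ` {..<s} \<subseteq> Z \<and>
     (\<forall>x\<in>Z. x = (\<Sum>j<s. lin_eval (z j) x *s v j))"

text \<open>Each basis vector is separated from the span of the others. The roles of forms and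
  vectors are exchanged here, which the symmetry of \<open>lin_eval\<close> permits.\<close>

lemma dual_basis_exists:
  fixes Z :: "('k::field ^ 'n::finite) set"
  obtains s v z where "dual_basis Z s v z"
proof -
  obtain C where C: "C \<subseteq> Z" "vec.independent C" "Z \<subseteq> vec.span C"
    using vec.maximal_independent_subset[of Z] by blast
  have fin: "finite C" using C(2) by (rule vec.finiteI_independent)
  define s where "s = card C"
  obtain v where v: "bij_betw v {..<s} C"
    using ex_bij_betw_nat_finite[OF fin] by (auto simp: s_def atLeast0LessThan)
  have "\<exists>z. lin_eval z (v i) = 1 \<and> (\<forall>j<s. j \<noteq> i \<longrightarrow> lin_eval z (v j) = 0)" if "i < s" for i
  proof -
    have "v i \<in> C" using v that by (auto simp: bij_betw_def)
    then have "v i \<notin> vec.span (C - {v i})"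
      using C(2) vec.dependent_def by blast
    then obtain z where "lin_eval (v i) z = 1" "\<And>d. d \<in> C - {v i} \<Longrightarrow> lin_eval d z = 0"
      using separating_form by blast
    moreover have "v j \<in> C - {v i}" if "j < s" "j \<noteq> i" for j
      using v that \<open>i < s\<close> by (auto simp: bij_betw_def inj_on_def)
    ultimately show ?thesis
      by (intro exI[of _ z]) (auto simp: lin_eval_commute[of z])
  qed
  then obtain z where z: "\<And>i. i < s \<Longrightarrow> lin_eval (z i) (v i) = 1"
      "\<And>i j. i < s \<Longrightarrow> j < s \<Longrightarrow> j \<noteq> i \<Longrightarrow> lin_eval (z i) (v j) = 0"
    by metis
  have df: "dual_family s v z"
    unfolding dual_family_def using z by (metis (full_types))
  have "x = (\<Sum>j<s. lin_eval (z j) x *s v j)" if "x \<in> vec.span C" for x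
    using that
  proof (induction rule: vec.span_induct_alt)
    case base
    then show ?case by simp
  next
    case (step c x y)
    then obtain i where i: "i < s" "x = v i" using v by (auto simp: bij_betw_def)
    have "(\<Sum>j<s. lin_eval (z j) x *s v j) = (\<Sum>j<s. if j = i then v i else 0)"
      by (rule sum.cong) (use i z in \<open>auto simp: \<close>)
    also have "\<dots> = x" using i by simp
    finally have x: "(\<Sum>j<s. lin_eval (z j) x *s v j) = x" .
    have "(\<Sum>j<s. lin_eval (z j) (c *s x + y) *s v j)
        = c *s (\<Sum>j<s. lin_eval (z j) x *s v j) + (\<Sum>j<s. lin_eval (z j) y *s v j)"
      by (simp add: lin_eval_add_right lin_eval_scale_right vec.scale_left_distrib sum.distrib
          vec.scale_sum_right)
    then show ?case using step(2) x by simp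
  qed
  then have "dual_basis Z s v z"
    unfolding dual_basis_def using df v C by (auto simp: bij_betw_def)
  then show thesis by (rule that)
qed

text \<open>Pullback of polynomials along the map that sends x to the sum of z_j(x) v_j over
  \<open>J\<close>. For \<open>J = {..<s}\<close> it is a retraction of S onto the polynomials in
  the \<open>z j\<close>; smaller \<open>J\<close> give projections onto smaller subspaces and,
  through their kernels, a chain of primes.\<close>

definition rho :: "nat set \<Rightarrow> (nat \<Rightarrow> 'k::field ^ 'n::finite) \<Rightarrow> (nat \<Rightarrow> 'k ^ 'n) \<Rightarrow>
    ('k, 'n) mpol \<Rightarrow> ('k, 'n) mpol" where
  "rho J v z = subst Const (\<lambda>i. \<Sum>j\<in>J. Const (v j $ i) * lin_form (z j))"

lemma rhom_rho: "rhom (rho J v z)"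
  unfolding rho_def by (rule rhom_subst[OF rhom_Const])

lemma rho_Const [simp]: "rho J v z (Const a) = Const a"
  by (simp add: rho_def rhom_Const)

lemma rho_Var: "rho J v z (Var i) = (\<Sum>j\<in>J. Const (v j $ i) * lin_form (z j))"
  by (simp add: rho_def rhom_Const)

lemma rhom_lin_form:
  "rhom h \<Longrightarrow> h (lin_form c) = (\<Sum>i\<in>UNIV. h (Const (c $ i)) * h (Var i))"
  by (simp add: lin_form_altdef rhom.sum rhom.mult)

lemma rho_lin_form: "rho J v z (lin_form c) = (\<Sum>j\<in>J. Const (lin_eval c (v j)) * lin_form (z j))"
  by (simp add: rhom_lin_form[OF rhom_rho] rho_Var sum_distrib_left sum_distrib_right lin_eval_def
      mult.assoc sum.swap[of _ J])

lemma rho_dual: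
  assumes "dual_family s v z" "J \<subseteq> {..<s}" "i < s"
  shows "rho J v z (lin_form (z i)) = (if i \<in> J then lin_form (z i) else 0)"
proof -
  have "finite J" using assms(2) finite_subset by blast
  have "rho J v z (lin_form (z i)) = (\<Sum>j\<in>J. if j = i then lin_form (z i) else 0)"
    unfolding rho_lin_form
    by (rule sum.cong) (use assms in \<open>auto simp: dual_family_def subset_iff\<close>)
  then show ?thesis
    using \<open>finite J\<close> by simp
qed

lemma rho_rho:
  assumes "dual_family s v z" "J' \<subseteq> J" "J \<subseteq> {..<s}"
  shows "rho J' v z (rho J v z f) = rho J' v z f"
proof (rule rhom_eqI[OF rhom_comp[OF rhom_rho rhom_rho] rhom_rho])
  interpret r: rhom "rho J' v z" by (rule rhom_rho)
  have fin: "finite J" using assms(3) finite_subset by blast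
  have z: "rho J' v z (lin_form (z j)) = (if j \<in> J' then lin_form (z j) else 0)" if "j \<in> J" for j
    using assms that by (intro rho_dual[OF assms(1)]) auto
  show "rho J' v z (rho J v z (Var i)) = rho J' v z (Var i)" for i
  proof -
    have "rho J' v z (rho J v z (Var i)) = (\<Sum>j\<in>J. Const (v j $ i) * (if j \<in> J' then lin_form (z j) else 0))"
      by (simp add: rho_Var z)
    also have "\<dots> = (\<Sum>j\<in>J'. Const (v j $ i) * lin_form (z j))"
      using fin assms(2) by (intro sum.mono_neutral_cong_right) auto
    finally show ?thesis by (simp add: rho_Var)
  qed
qed simp

text \<open>For a variable the difference is a linear form vanishing on \<open>Z\<close>; congruence
  modulo \<open>I\<close> to the image under a homomorphism then passes to sums and
  products.\<close>

lemma diff_rho_mem: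
  assumes D: "dual_basis Z s v z" and I: "is_ideal I"
    and L: "\<And>c. (\<And>v. v \<in> Z \<Longrightarrow> lin_eval c v = 0) \<Longrightarrow> lin_form c \<in> I"
  shows "f - rho {..<s} v z f \<in> I"
proof (induction f rule: mpol_induct)
  interpret r: rhom "rho {..<s} v z" by (rule rhom_rho)
  case (Const a)
  then show ?case using I by (simp add: is_idealD)
next
  case (Var i)
  have "lin_form (axis i 1 - (\<Sum>j<s. (v j $ i) *s z j)) \<in> I"
  proof (rule L)
    fix x assume "x \<in> Z"
    then have "x = (\<Sum>j<s. lin_eval (z j) x *s v j)" using D by (auto simp: dual_basis_def)
    then have "x $ i = (\<Sum>j<s. lin_eval (z j) x *s v j) $ i" by simp
    then show "lin_eval (axis i 1 - (\<Sum>j<s. (v j $ i) *s z j)) x = 0"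
      by (simp add: lin_eval_diff_left lin_eval_sum_left lin_eval_scale_left mult.commute)
  qed
  then show ?case
    by (simp add: lin_form_diff lin_form_axis lin_form_sum lin_form_scale rho_Var)
next
  case (add f g)
  interpret r: rhom "rho {..<s} v z" by (rule rhom_rho)
  have "f + g - rho {..<s} v z (f + g) = (f - rho {..<s} v z f) + (g - rho {..<s} v z g)" by simp
  then show ?case using is_idealD(2)[OF I add] by metis
next
  case (mult f g)
  interpret r: rhom "rho {..<s} v z" by (rule rhom_rho)
  have "f * g - rho {..<s} v z (f * g)
      = f * (g - rho {..<s} v z g) + (f - rho {..<s} v z f) * rho {..<s} v z g"
    by (simp add: algebra_simps)
  then show ?case using mult I by (metis is_idealD(2,3,4))
qed

lemma rho_annihilator:
  assumes "v ` {..<s} \<subseteq> Z" "\<And>v. v \<in> Z \<Longrightarrow> lin_eval c v = 0"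
  shows "rho {..<s} v z (lin_form c) = 0"
  unfolding rho_lin_form by (rule sum.neutral) (use assms in auto)

text \<open>\<open>rho\<close> kills the generators, and every \<open>f\<close> is congruent to
  \<open>rho f\<close>. As the kernel of a homomorphism into a domain the ideal is prime, and
  membership becomes an equation.\<close>

lemma subspace_ideal_eq_kernel:
  assumes D: "dual_basis Z s v z"
  shows "subspace_ideal Z = {f. rho {..<s} v z f = 0}"
proof
  have "v ` {..<s} \<subseteq> Z" using D by (simp add: dual_basis_def)
  then show "subspace_ideal Z \<subseteq> {f. rho {..<s} v z f = 0}"
    by (intro subspace_ideal_minimal[OF is_ideal_kernel[OF rhom_rho]]) (simp add: rho_annihilator)
  have "f - rho {..<s} v z f \<in> subspace_ideal Z" for f
    by (rule diff_rho_mem[OF D is_ideal_subspace_ideal]) (rule lin_form_in_subspace_ideal)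
  then have "f \<in> subspace_ideal Z" if "rho {..<s} v z f = 0" for f
    using that by (metis diff_zero)
  then show "{f. rho {..<s} v z f = 0} \<subseteq> subspace_ideal Z" by blast
qed

text \<open>The ideal acquires no linear forms beyond its generators: the image under
  \<open>rho\<close> is a combination of the \<open>z j\<close> with coefficients
  \<open>lin_eval c (v j)\<close>, and duality forces these to vanish.\<close>

lemma lin_form_in_subspace_ideal_iff: "lin_form c \<in> subspace_ideal Z \<longleftrightarrow> (\<forall>v\<in>Z. lin_eval c v = 0)"
proof
  assume c: "lin_form c \<in> subspace_ideal Z"
  obtain s v z where D: "dual_basis Z s v z" by (rule dual_basis_exists)
  have "lin_form (\<Sum>j<s. lin_eval c (v j) *s z j) = 0"
    using c by (simp add: subspace_ideal_eq_kernel[OF D] rho_lin_form lin_form_sum lin_form_scale)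
  then have e: "(\<Sum>j<s. lin_eval c (v j) *s z j) = 0"
    by (simp only: lin_form_eq_0_iff)
  have "lin_eval c (v i) = 0" if "i < s" for i
  proof -
    have "lin_eval (\<Sum>j<s. lin_eval c (v j) *s z j) (v i) = (\<Sum>j<s. if j = i then lin_eval c (v i) else 0)"
      unfolding lin_eval_sum_left lin_eval_scale_left
      by (rule sum.cong) (use D that in \<open>auto simp: dual_basis_def dual_family_def\<close>)
    then show ?thesis using e that by simp
  qed
  moreover have "x = (\<Sum>j<s. lin_eval (z j) x *s v j)" if "x \<in> Z" for x
    using D that by (auto simp: dual_basis_def)
  ultimately show "\<forall>x\<in>Z. lin_eval c x = 0"
    by (metis (no_types, lifting) lessThan_iff lin_eval_scale_right lin_eval_sum_right mult_zero_right sum.neutral)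
qed (rule lin_form_in_subspace_ideal, blast)

lemma is_prime_subspace_ideal: "is_prime (subspace_ideal (Z :: ('k::field ^ 'n::{finite,linorder}) set))"
proof -
  obtain s v z where D: "dual_basis Z s v z" by (rule dual_basis_exists)
  show ?thesis
    unfolding subspace_ideal_eq_kernel[OF D] by (rule is_prime_kernel[OF rhom_rho])
qed

lemma subspace_ideal_two_forms:
  "f \<in> subspace_ideal {v. lin_eval c v = 0 \<and> lin_eval d v = 0} \<longleftrightarrow> (\<exists>u w. f = lin_form c * u + lin_form d * w)"
proof
  let ?Y = "{v. lin_eval c v = 0 \<and> lin_eval d v = 0}"
  let ?I = "{f. \<exists>u w. f = lin_form c * u + lin_form d * w}"
  have I: "is_ideal ?I"
    unfolding is_ideal_def
  proof (intro conjI ballI allI)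
    show "0 \<in> ?I" by (auto intro!: exI[of _ 0])
    fix x y assume "x \<in> ?I" "y \<in> ?I"
    then obtain u w u' w' where "x = lin_form c * u + lin_form d * w" "y = lin_form c * u' + lin_form d * w'"
      by auto
    then have "x + y = lin_form c * (u + u') + lin_form d * (w + w')" by (simp add: algebra_simps)
    then show "x + y \<in> ?I" by blast
  next
    fix x r assume "x \<in> ?I"
    then obtain u w where "x = lin_form c * u + lin_form d * w" by auto
    then have "r * x = lin_form c * (r * u) + lin_form d * (r * w)" by (simp add: algebra_simps)
    then show "r * x \<in> ?I" by blast
  qed
  have "subspace_ideal ?Y \<subseteq> ?I"
  proof (rule subspace_ideal_minimal[OF I])
    fix e assume e: "\<And>v. v \<in> ?Y \<Longrightarrow> lin_eval e v = 0"
    have "e \<in> vec.span {c, d}"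
      by (rule in_span_annihilator) (use e in auto)
    then obtain a b where "e = a *s c + b *s d"
      by (auto simp: vec.span_breakdown_eq algebra_simps)
    then have "lin_form e = lin_form c * Const a + lin_form d * Const b"
      by (simp add: lin_form_add lin_form_scale mult.commute)
    then show "lin_form e \<in> ?I" by blast
  qed
  then show "f \<in> subspace_ideal ?Y \<Longrightarrow> \<exists>u w. f = lin_form c * u + lin_form d * w" by blast
  show "\<exists>u w. f = lin_form c * u + lin_form d * w \<Longrightarrow> f \<in> subspace_ideal ?Y"
    by (auto intro!: is_idealD(2,4)[OF is_ideal_subspace_ideal] lin_form_in_subspace_ideal)
qed

lemma subspace_ideal_hyperplane: "f \<in> subspace_ideal {v. lin_eval c v = 0} \<longleftrightarrow> lin_form c dvd f"
  using subspace_ideal_two_forms[of f c 0] by (simp add: dvd_def)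

section \<open>Coefficients along and transversal to a subspace\<close>

lemma lookup_Const_mult: "Poly_Mapping.lookup (Const a * p) m = a * Poly_Mapping.lookup p m"
proof -
  have "Const a * p = Poly_Mapping.map ((*) a) p"
    by (simp add: Const_def mult_map_scale_conv_mult)
  then show ?thesis
    by (simp add: Poly_Mapping.map.rep_eq when_def)
qed

text \<open>With \<open>z\<^sub>j\<close> the coordinates of a projection of \<open>V\<close> onto \<open>Z\<close>, the homomorphism \<open>Theta\<close> renames \<open>z\<^sub>j\<close> into a new
  variable and fixes the forms that vanish on \<open>Z\<close>.  Its coefficients are therefore linear over the
  polynomials in these forms, without any change of coordinates.\<close>

definition Theta :: "nat \<Rightarrow> (nat \<Rightarrow> 'k::field ^ 'n::finite) \<Rightarrow> (nat \<Rightarrow> 'k ^ 'n) \<Rightarrow>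
    ('k, 'n) mpol \<Rightarrow> (nat \<Rightarrow>\<^sub>0 nat) \<Rightarrow>\<^sub>0 ('k, 'n) mpol" where
  "Theta s v z = subst (\<lambda>a. Const (Const a))
     (\<lambda>i. Const (Var i - rho {..<s} v z (Var i)) + (\<Sum>j<s. Const (Const (v j $ i)) * Var j))"

lemma rhom_Const_Const: "rhom (\<lambda>a. Const (Const a))"
  by (rule rhom_comp[OF rhom_Const rhom_Const])

lemma rhom_Theta: "rhom (Theta s v z)"
  unfolding Theta_def by (rule rhom_subst[OF rhom_Const_Const])

lemma Theta_Const [simp]: "Theta s v z (Const a) = Const (Const a)"
  by (simp add: Theta_def rhom_Const_Const)

lemma Theta_Var:
  "Theta s v z (Var i) = Const (Var i - rho {..<s} v z (Var i)) + (\<Sum>j<s. Const (Const (v j $ i)) * Var j)"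
  by (simp add: Theta_def rhom_Const_Const)

lemma Theta_lin_form:
  fixes c :: "'k::field ^ 'n::finite"
  shows "Theta s v z (lin_form c) = Const (lin_form c - rho {..<s} v z (lin_form c))
     + (\<Sum>j<s. Const (Const (lin_eval c (v j))) * Var j)"
proof -
  interpret r: rhom "rho {..<s} v z" by (rule rhom_rho)
  have "(\<Sum>i\<in>UNIV. Const (Const (c $ i)) * (\<Sum>j<s. Const (Const (v j $ i)) * Var j))
      = (\<Sum>j<s. Const (Const (lin_eval c (v j))) * (Var j :: (nat \<Rightarrow>\<^sub>0 nat) \<Rightarrow>\<^sub>0 ('k, 'n) mpol))"
    by (simp add: sum_distrib_left sum_distrib_right lin_eval_def mult.assoc sum.swap[of _ "{..<s}"])
  moreover have "Theta s v z (lin_form c) = (\<Sum>i\<in>UNIV. Const (Const (c $ i)) *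
      (Const (Var i - rho {..<s} v z (Var i)) + (\<Sum>j<s. Const (Const (v j $ i)) * Var j)))"
    by (simp add: rhom_lin_form[OF rhom_Theta] Theta_Var)
  ultimately show ?thesis
    by (simp add: ring_distribs sum.distrib lin_form_altdef sum_subtractf)
qed

lemma Theta_annihilator:
  assumes "v ` {..<s} \<subseteq> Z" "\<And>v. v \<in> Z \<Longrightarrow> lin_eval c v = 0"
  shows "Theta s v z (lin_form c) = Const (lin_form c)"
  using assms by (simp add: Theta_lin_form rho_annihilator[OF assms]) (rule sum.neutral, auto)

lemma subst_Theta:
  assumes "rhom c"
  shows "subst c y (Theta s v z f) = subst (\<lambda>a. c (Const a))
    (\<lambda>i. c (Var i - rho {..<s} v z (Var i)) + (\<Sum>j<s. c (Const (v j $ i)) * y j)) f"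
proof -
  interpret r: rhom "subst c y" by (rule rhom_subst[OF assms])
  interpret c: rhom c by fact
  have c': "rhom (\<lambda>a. c (Const a))" by (rule rhom_comp[OF assms rhom_Const])
  show ?thesis
    by (rule rhom_eqI[OF rhom_comp[OF rhom_subst[OF assms] rhom_Theta] rhom_subst[OF c']])
      (simp_all add: Theta_Var assms c')
qed

text \<open>Putting \<open>z j\<close> back for the new variables restores
  \<open>rho (Var i)\<close>, the part that was split off from each variable.\<close>

lemma Theta_recover: "subst (\<lambda>a. a) (\<lambda>j. lin_form (z j)) (Theta s v z f) = f"
  unfolding subst_Theta[OF rhom_id]
  by (rule rhom_eqI[OF rhom_subst[OF rhom_Const] rhom_id]) (simp_all add: rhom_Const rho_Var)

lemma subst_in_ideal:
  assumes "is_ideal I" "\<And>m. c (Poly_Mapping.lookup F m) \<in> I"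
  shows "subst c y F \<in> I"
  unfolding subst_def using assms by (intro is_ideal_sum) (auto intro: is_idealD)

lemma Theta_coeffs_in_ideal:
  assumes "is_ideal I" "\<And>m. Poly_Mapping.lookup (Theta s v z f) m \<in> I"
  shows "f \<in> I"
  using subst_in_ideal[OF assms(1), of "\<lambda>a. a" "Theta s v z f" "\<lambda>j. lin_form (z j)"] assms(2)
  by (simp add: Theta_recover)

definition const_term :: "('k::field, 'n::finite) mpol \<Rightarrow> 'k" where
  "const_term = subst (\<lambda>a. a) (\<lambda>_. 0)"

lemma rhom_const_term: "rhom const_term"
  unfolding const_term_def by (rule rhom_subst[OF rhom_id])

lemma const_term_Const [simp]: "const_term (Const a) = a"
  and const_term_Var [simp]: "const_term (Var i) = 0"
  by (simp_all add: const_term_def rhom_id)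

lemma const_term_lin_form [simp]: "const_term (lin_form c) = 0"
  by (simp add: rhom_lin_form[OF rhom_const_term])

text \<open>Taking constant terms of the coefficients kills the transversal parts
  \<open>Var i - rho (Var i)\<close>, so restoring the \<open>z j\<close> afterwards yields
  \<open>rho f\<close>. Thus \<open>rho f\<close> is 0 if all these constant terms vanish.\<close>

lemma Theta_const_terms:
  fixes f :: "('k::field, 'n::finite) mpol"
  assumes D: "dual_basis Z s v z" and "\<And>m. const_term (Poly_Mapping.lookup (Theta s v z f) m) = 0"
  shows "f \<in> subspace_ideal Z"
proof -
  interpret c: rhom "const_term :: ('k, 'n) mpol \<Rightarrow> 'k" by (rule rhom_const_term)
  interpret r: rhom "rho {..<s} v z" by (rule rhom_rho)
  have *: "rhom (\<lambda>a. Const (const_term a))"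
    by (rule rhom_comp[OF rhom_Const rhom_const_term])
  have "subst (\<lambda>a. Const (const_term a)) (\<lambda>j. lin_form (z j)) (Theta s v z f) \<in> {0}"
    by (rule subst_in_ideal) (simp_all add: is_ideal_def assms(2))
  also have "subst (\<lambda>a. Const (const_term a)) (\<lambda>j. lin_form (z j)) (Theta s v z f) = rho {..<s} v z f"
    unfolding subst_Theta[OF *] by (simp add: rho_def[symmetric] rho_Var)
  finally show ?thesis
    by (simp add: subspace_ideal_eq_kernel[OF D])
qed

definition lift_Const :: "((nat \<Rightarrow>\<^sub>0 nat) \<Rightarrow>\<^sub>0 'k::field) \<Rightarrow> (nat \<Rightarrow>\<^sub>0 nat) \<Rightarrow>\<^sub>0 ('k, 'n::finite) mpol" where
  "lift_Const = subst (\<lambda>a. Const (Const a)) Var"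

lemma lookup_lift_Const:
  "Poly_Mapping.lookup (lift_Const A :: _ \<Rightarrow>\<^sub>0 ('k::field, 'n::finite) mpol) m = Const (Poly_Mapping.lookup A m)"
proof -
  have "(lift_Const A :: _ \<Rightarrow>\<^sub>0 ('k, 'n) mpol) = (\<Sum>m\<in>Poly_Mapping.keys A. Poly_Mapping.single m (Const (Poly_Mapping.lookup A m)))"
    by (simp add: lift_Const_def subst_def mono_eval_Var Const_def[of "Const _"] mult_single)
  then show ?thesis
    by (simp add: lookup_sum lookup_single when_def in_keys_iff)
qed

text \<open>\<open>rho f\<close> is a polynomial in the \<open>z j\<close> alone, and
  \<open>Theta\<close> turns each of them into a bare variable; hence all coefficients are constants
  of the field.\<close>

lemma Theta_rho:
  fixes f :: "('k::field, 'n::finite) mpol"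
  assumes D: "dual_family s v z"
  shows "Theta s v z (rho {..<s} v z f) = lift_Const (subst Const (\<lambda>i. \<Sum>j<s. Const (v j $ i) * Var j) f)"
proof -
  interpret t: rhom "Theta s v z" by (rule rhom_Theta)
  have L: "rhom (lift_Const :: _ \<Rightarrow> (nat \<Rightarrow>\<^sub>0 nat) \<Rightarrow>\<^sub>0 ('k, 'n) mpol)"
    unfolding lift_Const_def by (rule rhom_subst[OF rhom_Const_Const])
  interpret l: rhom "lift_Const :: _ \<Rightarrow> (nat \<Rightarrow>\<^sub>0 nat) \<Rightarrow>\<^sub>0 ('k, 'n) mpol" by (rule L)
  have [simp]: "lift_Const (Const a) = Const (Const a)" "lift_Const (Var j) = Var j" for a j
    by (simp_all add: lift_Const_def rhom_Const_Const)
  have z: "Theta s v z (lin_form (z i)) = Var i" if "i < s" for i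
  proof -
    have "(\<Sum>j<s. Const (Const (lin_eval (z i) (v j))) * Var j) = (\<Sum>j<s. if j = i then Var i else 0)"
      by (rule sum.cong) (use D that in \<open>auto simp: dual_family_def\<close>)
    then show ?thesis
      using that rho_dual[OF D subset_refl that] by (simp add: Theta_lin_form)
  qed
  show ?thesis
  proof (rule rhom_eqI[OF rhom_comp[OF rhom_Theta rhom_rho] rhom_comp[OF L rhom_subst[OF rhom_Const]]])
    show "Theta s v z (rho {..<s} v z (Var i))
        = lift_Const (subst Const (\<lambda>i. \<Sum>j<s. Const (v j $ i) * Var j) (Var i))" for i
      by (simp add: rho_Var rhom_Const z)
  qed (simp add: rhom_Const)
qed

text \<open>A leading term argument modulo \<open>I\<close>. Let \<open>l\<close> be the largest
  exponent of \<open>A\<close> and \<open>k\<close> the largest one whose coefficient in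
  \<open>B\<close> is outside \<open>I\<close>. At \<open>l + k\<close> every other contribution has
  its \<open>B\<close>-coefficient in \<open>I\<close>, because the order of exponents is compatible
  with addition, and the leading coefficient of \<open>A\<close> is a unit.\<close>

lemma lift_Const_mult_coeffs:
  fixes B :: "(nat \<Rightarrow>\<^sub>0 nat) \<Rightarrow>\<^sub>0 ('k::field, 'n::finite) mpol"
  assumes I: "is_ideal I" and "A \<noteq> 0" and AB: "\<And>m. Poly_Mapping.lookup (lift_Const A * B) m \<in> I"
  shows "Poly_Mapping.lookup B m \<in> I"
proof (rule ccontr)
  let ?A = "Poly_Mapping.lookup A" and ?B = "Poly_Mapping.lookup B"
  let ?KA = "Poly_Mapping.keys A" and ?KB = "Poly_Mapping.keys B"
  assume m: "?B m \<notin> I"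
  define bad where "bad = {j\<in>?KB. ?B j \<notin> I}"
  have "m \<in> bad"
    using m is_idealD(1)[OF I] by (auto simp: bad_def in_keys_iff)
  moreover have "finite bad" by (simp add: bad_def)
  ultimately have k: "Max bad \<in> bad" "\<And>j. j \<in> bad \<Longrightarrow> j \<le> Max bad"
    using Max_in[OF \<open>finite bad\<close>] Max_ge[OF \<open>finite bad\<close>] by blast+
  define k where "k = Max bad"
  define l where "l = Max ?KA"
  have l: "l \<in> ?KA" "\<And>j. j \<in> ?KA \<Longrightarrow> j \<le> l"
    using \<open>A \<noteq> 0\<close> Max_in[of ?KA] by (auto simp: l_def)
  have "lift_Const A * B = (\<Sum>i\<in>?KA. \<Sum>j\<in>?KB. Poly_Mapping.single (i + j) (Const (?A i) * ?B j))"
  proof -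
    have A: "lift_Const A = (\<Sum>i\<in>?KA. Poly_Mapping.single i (Const (?A i)) :: (nat \<Rightarrow>\<^sub>0 nat) \<Rightarrow>\<^sub>0 ('k, 'n) mpol)"
      by (rule poly_mapping_eqI) (simp add: lookup_lift_Const lookup_sum lookup_single when_def in_keys_iff)
    show ?thesis
      unfolding A by (subst (1) poly_mapping_sum_single[of B]) (simp add: sum_product mult_single)
  qed
  then have "Poly_Mapping.lookup (lift_Const A * B) (l + k)
      = (\<Sum>(i, j)\<in>?KA \<times> ?KB. if i + j = l + k then Const (?A i) * ?B j else 0)"
    by (simp add: lookup_sum lookup_single when_def flip: sum.cartesian_product)
  also have "\<dots> = Const (?A l) * ?B k
      + (\<Sum>(i, j)\<in>?KA \<times> ?KB - {(l, k)}. if i + j = l + k then Const (?A i) * ?B j else 0)"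
    using l k by (subst sum.remove[of _ "(l, k)"]) (auto simp: k_def bad_def)
  finally have e: "Const (?A l) * ?B k = Poly_Mapping.lookup (lift_Const A * B) (l + k)
      - (\<Sum>(i, j)\<in>?KA \<times> ?KB - {(l, k)}. if i + j = l + k then Const (?A i) * ?B j else 0)"
    by simp
  have "(\<Sum>(i, j)\<in>?KA \<times> ?KB - {(l, k)}. if i + j = l + k then Const (?A i) * ?B j else 0) \<in> I"
  proof (rule is_ideal_sum[OF I])
    fix x assume x: "x \<in> ?KA \<times> ?KB - {(l, k)}"
    obtain i j where ij_eq: "x = (i, j)" by force
    with x have ij: "i \<in> ?KA" "j \<in> ?KB" "(i, j) \<noteq> (l, k)" by auto
    have "(if i + j = l + k then Const (?A i) * ?B j else 0) \<in> I"
    proof (cases "i + j = l + k")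
      case True
      have "?B j \<in> I"
      proof (rule ccontr)
        assume "?B j \<notin> I"
        then have "j \<le> k" using k(2) ij(2) by (simp add: k_def bad_def)
        moreover have "i \<le> l" using l(2) ij(1) .
        moreover have "j \<noteq> k" using True ij(3) by auto
        ultimately have "i + j < l + k" by (simp add: add_le_less_mono)
        then show False using True by simp
      qed
      then show ?thesis using I by (simp add: is_idealD)
    qed (use I in \<open>simp add: is_idealD\<close>)
    then show "(case x of (i, j) \<Rightarrow> if i + j = l + k then Const (?A i) * ?B j else 0) \<in> I"
      by (simp add: ij_eq)
  qed
  then have "Const (?A l) * ?B k \<in> I"
    unfolding e using AB I by (intro is_idealD(6)) auto
  then have "Const (inverse (?A l)) * (Const (?A l) * ?B k) \<in> I"
    by (rule is_idealD(3)[OF I])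
  moreover have "?A l \<noteq> 0" using l(1) by (simp add: in_keys_iff)
  ultimately have "?B k \<in> I"
    by (simp add: Const_inverse_mult flip: mult.assoc)
  then show False using k(1) by (simp add: k_def bad_def)
qed

text \<open>Since the ideal of \<open>Z\<close> multiplies \<open>g\<close> into \<open>I\<close>,
  \<open>p\<close> may be replaced by \<open>rho p\<close>. Its image under \<open>Theta\<close> is
  nonzero with constant coefficients, so it can be cancelled from the coefficients of the product
  modulo \<open>I\<close>.\<close>

lemma Theta_stable_colon:
  assumes D: "dual_basis Z s v z" and I: "is_ideal I"
    and stable: "\<And>f m. f \<in> I \<Longrightarrow> Poly_Mapping.lookup (Theta s v z f) m \<in> I"
    and Pg: "\<And>q. q \<in> subspace_ideal Z \<Longrightarrow> q * g \<in> I" and p: "p * g \<in> I" "p \<notin> subspace_ideal Z"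
  shows "g \<in> I"
proof -
  interpret t: rhom "Theta s v z" by (rule rhom_Theta)
  let ?p = "rho {..<s} v z p"
  define A where "A = subst Const (\<lambda>i. \<Sum>j<s. Const (v j $ i) * Var j) p"
  have df: "dual_family s v z" using D by (simp add: dual_basis_def)
  have "p - ?p \<in> subspace_ideal Z"
    by (rule diff_rho_mem[OF D is_ideal_subspace_ideal]) (rule lin_form_in_subspace_ideal)
  then have "p * g - (p - ?p) * g \<in> I"
    using I Pg p(1) by (intro is_idealD(6)) auto
  then have "?p * g \<in> I" by (simp add: algebra_simps)
  have A: "Theta s v z ?p = lift_Const A"
    unfolding A_def by (rule Theta_rho[OF df])
  have "A \<noteq> 0"
  proof
    assume "A = 0"
    then have "Theta s v z ?p = 0" by (simp add: A lift_Const_def)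
    then have "?p = 0" using Theta_recover[of z s v ?p] by simp
    then show False using p(2) by (simp add: subspace_ideal_eq_kernel[OF D])
  qed
  have "Poly_Mapping.lookup (lift_Const A * Theta s v z g) m \<in> I" for m
    using stable[OF \<open>?p * g \<in> I\<close>, of m] by (simp add: A)
  then show ?thesis
    by (rule Theta_coeffs_in_ideal[OF I lift_Const_mult_coeffs[OF I \<open>A \<noteq> 0\<close>]])
qed

section \<open>Homogeneous components, read off after substituting t x_i for x_i\<close>

definition graded :: "('k::field, 'n::finite) mpol \<Rightarrow> ('k, 'n) mpol poly" where
  "graded = subst (\<lambda>a. [:Const a:]) (\<lambda>i. Polynomial.monom (Var i) 1)"

definition hcomp :: "nat \<Rightarrow> ('k::field, 'n::finite) mpol \<Rightarrow> ('k, 'n) mpol" where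
  "hcomp d f = Polynomial.coeff (graded f) d"

lemma rhom_pConst: "rhom (\<lambda>a. [:Const a:])"
  by unfold_locales (simp_all add: one_pCons)

lemma rhom_graded: "rhom graded"
  unfolding graded_def by (rule rhom_subst[OF rhom_pConst])

lemma graded_Const [simp]: "graded (Const a) = [:Const a:]"
  and graded_Var [simp]: "graded (Var i) = Polynomial.monom (Var i) 1"
  by (simp_all add: graded_def rhom_pConst)

lemma graded_lin_form:
  fixes c :: "'k::field ^ 'n::finite"
  shows "graded (lin_form c) = Polynomial.monom (lin_form c) 1"
proof -
  have "(\<Sum>i\<in>UNIV. Polynomial.monom (f i) 1) = Polynomial.monom (\<Sum>i\<in>UNIV. f i) 1" for f :: "'n \<Rightarrow> ('k, 'n) mpol"
    by (rule poly_eqI) (simp add: coeff_sum)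
  then show ?thesis
    unfolding rhom_lin_form[OF rhom_graded] by (simp add: smult_monom lin_form_altdef)
qed

lemma graded_prod_lin_form:
  "graded (\<Prod>i\<in>I. lin_form (c i)) = Polynomial.monom (\<Prod>i\<in>I. lin_form (c i)) (card I)"
proof (induction I rule: infinite_finite_induct)
  case (insert i I)
  then show ?case
    by (simp add: rhom.mult[OF rhom_graded] graded_lin_form mult_monom)
qed (simp_all add: rhom.one[OF rhom_graded])

lemma poly_graded_1:
  fixes f :: "('k::field, 'n::finite) mpol"
  shows "poly (graded f) 1 = f"
proof -
  have *: "rhom (\<lambda>p :: ('k, 'n) mpol poly. poly p a)" for a by unfold_locales auto
  show ?thesis
    by (rule rhom_eqI[OF rhom_comp[OF * rhom_graded] rhom_id]) (simp_all add: poly_monom)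
qed

lemma sum_hcomp: "f = (\<Sum>d\<le>Polynomial.degree (graded f). hcomp d f)"
  using poly_altdef[of "graded f" 1] by (simp add: poly_graded_1 hcomp_def)

lemma hcomp_0:
  fixes f :: "('k::field, 'n::finite) mpol"
  shows "hcomp 0 f = Const (const_term f)"
proof -
  have *: "rhom (\<lambda>p :: ('k, 'n) mpol poly. poly p a)" for a by unfold_locales auto
  have "poly (graded f) 0 = Const (const_term f)"
    by (rule rhom_eqI[OF rhom_comp[OF * rhom_graded] rhom_comp[OF rhom_Const rhom_const_term]])
      (simp_all add: poly_monom)
  then show ?thesis
    by (simp add: hcomp_def poly_0_coeff_0)
qed

text \<open>Outside the ideal of \<open>Z\<close>, some coefficient of \<open>Theta f\<close> has a
  nonzero constant term. The coefficient lies in \<open>I\<close>, and so does its component of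
  degree 0, a unit.\<close>

lemma Theta_graded_dichotomy:
  assumes D: "dual_basis Z s v z" and I: "is_ideal I"
    and stable: "\<And>f m. f \<in> I \<Longrightarrow> Poly_Mapping.lookup (Theta s v z f) m \<in> I"
    and hom: "\<And>f. f \<in> I \<Longrightarrow> hcomp 0 f \<in> I"
    and f: "f \<in> I" "f \<notin> subspace_ideal Z"
  shows "1 \<in> I"
proof -
  obtain m where m: "const_term (Poly_Mapping.lookup (Theta s v z f) m) \<noteq> 0"
    using Theta_const_terms[OF D] f(2) by blast
  let ?c = "const_term (Poly_Mapping.lookup (Theta s v z f) m)"
  have "Const ?c \<in> I"
    using hom[OF stable[OF f(1)], of m] by (simp add: hcomp_0)
  then have "Const (inverse ?c) * Const ?c \<in> I"
    by (rule is_idealD(3)[OF I])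
  then show ?thesis using Const_inverse_mult[OF m] by metis
qed

section \<open>The residue ideal lifted to \<open>S\<close>\<close>

text \<open>The numerators Q(A)\<omega> of logarithmic forms, with divisibility of the wedge product
  stated entrywise; that the quotient matrix is alternating follows. Leaving out the denominator
  makes it easy to compare different arrangements.\<close>

definition log_numerators ::
    "(('k::field ^ 'n::finite) set \<Rightarrow> 'k ^ 'n) \<Rightarrow> ('k ^ 'n) set set \<Rightarrow> (('k, 'n) mpol ^ 'n) set" where
  "log_numerators \<alpha> A = {\<eta>. \<forall>L\<in>A. \<forall>i j.
     lin_form (\<alpha> L) dvd \<eta> $ i * Const (\<alpha> L $ j) - \<eta> $ j * Const (\<alpha> L $ i)}"

text \<open>Interior product with the constant vector field \<open>v\<close>.\<close>

definition contract :: "('k::field, 'n::finite) mpol ^ 'n \<Rightarrow> 'k ^ 'n \<Rightarrow> ('k, 'n) mpol" where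
  "contract \<eta> v = (\<Sum>i\<in>UNIV. \<eta> $ i * Const (v $ i))"

text \<open>The preimage in \<open>S\<close> of the residue ideal: the condition says that \<open>f\<close> reduces to the residue of
  \<open>\<eta> / Q(A)\<close> modulo \<open>\<alpha>\<^sub>H\<close>, expressed for all tangent vectors \<open>v\<close> at once.\<close>

definition residue_lift ::
    "(('k::field, 'n::{finite,linorder}) vec set \<Rightarrow> ('k, 'n) vec) \<Rightarrow> (('k, 'n) vec set \<Rightarrow> ('k, 'n) vec) \<Rightarrow>
     ('k, 'n) vec set set \<Rightarrow> ('k, 'n) vec set \<Rightarrow> ('k, 'n) mpol set" where
  "residue_lift \<alpha> \<beta> A H = {f. \<exists>\<eta>\<in>log_numerators \<alpha> A. \<forall>v.
     lin_form (\<alpha> H) dvd contract \<eta> v - Const (lin_eval (\<alpha> H) v) * arr_poly \<beta> (restriction A H) * f}"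

lemma contract_add: "contract (\<eta> + \<zeta>) v = contract \<eta> v + contract \<zeta> v"
  by (simp add: contract_def ring_distribs sum.distrib)

lemma contract_scale: "contract (r *s \<eta>) v = r * contract \<eta> v"
  by (simp add: contract_def sum_distrib_left mult_ac)

lemma contract_0 [simp]: "contract 0 v = 0"
  by (simp add: contract_def)

lemma contract_dform: "contract (dform c) v = Const (lin_eval c v)"
  by (simp add: contract_def dform_def lin_eval_def flip: Const_def)

lemma log_numerators_add:
  "\<eta> \<in> log_numerators \<alpha> A \<Longrightarrow> \<zeta> \<in> log_numerators \<alpha> A \<Longrightarrow> \<eta> + \<zeta> \<in> log_numerators \<alpha> A"
  unfolding log_numerators_def
proof clarify
  fix L i j
  assume *: "\<forall>L\<in>A. \<forall>i j. lin_form (\<alpha> L) dvd \<eta> $ i * Const (\<alpha> L $ j) - \<eta> $ j * Const (\<alpha> L $ i)"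
    "\<forall>L\<in>A. \<forall>i j. lin_form (\<alpha> L) dvd \<zeta> $ i * Const (\<alpha> L $ j) - \<zeta> $ j * Const (\<alpha> L $ i)" "L \<in> A"
  have "lin_form (\<alpha> L) dvd (\<eta> $ i * Const (\<alpha> L $ j) - \<eta> $ j * Const (\<alpha> L $ i))
      + (\<zeta> $ i * Const (\<alpha> L $ j) - \<zeta> $ j * Const (\<alpha> L $ i))"
    using * by (intro dvd_add) auto
  then show "lin_form (\<alpha> L) dvd (\<eta> + \<zeta>) $ i * Const (\<alpha> L $ j) - (\<eta> + \<zeta>) $ j * Const (\<alpha> L $ i)"
    by (simp add: algebra_simps)
qed

text \<open>At each hyperplane the divisibility comes either from the factor or from the form, so a
  form that is logarithmic along a part of \<open>A\<close> is repaired by multiplying it with the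
  missing linear forms.\<close>

lemma log_numerators_scale:
  assumes "\<And>L. L \<in> A \<Longrightarrow> lin_form (\<alpha> L) dvd r \<or> (\<exists>B. L \<in> B \<and> \<eta> \<in> log_numerators \<alpha> B)"
  shows "r *s \<eta> \<in> log_numerators \<alpha> A"
  unfolding log_numerators_def
proof clarify
  fix L i j assume "L \<in> A"
  then have "lin_form (\<alpha> L) dvd r * (\<eta> $ i * Const (\<alpha> L $ j) - \<eta> $ j * Const (\<alpha> L $ i))"
    using assms[of L] by (auto simp: log_numerators_def)
  then show "lin_form (\<alpha> L) dvd (r *s \<eta>) $ i * Const (\<alpha> L $ j) - (r *s \<eta>) $ j * Const (\<alpha> L $ i)"
    by (simp add: algebra_simps)
qed

lemma log_numerators_0: "0 \<in> log_numerators \<alpha> A"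
  by (simp add: log_numerators_def)

lemma log_numerators_antimono: "A \<subseteq> B \<Longrightarrow> log_numerators \<alpha> B \<subseteq> log_numerators \<alpha> A"
  by (auto simp: log_numerators_def)

text \<open>This is the wedge with \<open>d\<alpha>_L\<close> evaluated at the pair
  \<open>(v, w)\<close>, hence a combination of its entries with constant coefficients.\<close>

lemma contract_wedge:
  assumes "\<eta> \<in> log_numerators \<alpha> A" "L \<in> A"
  shows "lin_form (\<alpha> L) dvd contract \<eta> v * Const (lin_eval (\<alpha> L) w) - contract \<eta> w * Const (lin_eval (\<alpha> L) v)"
proof -
  have "contract \<eta> v * Const (lin_eval (\<alpha> L) w) = (\<Sum>i\<in>UNIV. \<Sum>j\<in>UNIV. Const (v $ i * w $ j) * (\<eta> $ i * Const (\<alpha> L $ j)))"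
    by (simp add: contract_def lin_eval_def sum_product mult_ac)
  moreover have "contract \<eta> w * Const (lin_eval (\<alpha> L) v) = (\<Sum>j\<in>UNIV. \<Sum>i\<in>UNIV. Const (v $ i * w $ j) * (\<eta> $ j * Const (\<alpha> L $ i)))"
    by (simp add: contract_def lin_eval_def sum_product mult_ac)
  ultimately have "contract \<eta> v * Const (lin_eval (\<alpha> L) w) - contract \<eta> w * Const (lin_eval (\<alpha> L) v)
      = (\<Sum>i\<in>UNIV. \<Sum>j\<in>UNIV. Const (v $ i * w $ j) * (\<eta> $ i * Const (\<alpha> L $ j) - \<eta> $ j * Const (\<alpha> L $ i)))"
    by (subst (asm) (2) sum.swap) (simp only: right_diff_distrib sum_subtractf)
  also have "lin_form (\<alpha> L) dvd \<dots>"
    using assms by (intro dvd_sum dvd_mult) (auto simp: log_numerators_def)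
  finally show ?thesis .
qed

text \<open>The primes are (a, b_i), absorbed one at a time: if x is \<open>prod b F * w\<close>
  modulo \<open>a\<close>, then \<open>w\<close> lies in the next prime because no other
  \<open>b j\<close> does. With \<open>a\<close> the form of \<open>H\<close> this is divisibility
  in the coordinate ring of \<open>H\<close>; with \<open>a = 0\<close> it is divisibility in
  S.\<close>

lemma prod_of_prime_ideals:
  fixes a x :: "'a::comm_ring_1"
  assumes "finite F" and "\<And>i. i \<in> F \<Longrightarrow> is_prime (Pr i)"
    and "\<And>i y. i \<in> F \<Longrightarrow> y \<in> Pr i \<longleftrightarrow> (\<exists>u w. y = a * u + b i * w)"
    and "\<And>i j. i \<in> F \<Longrightarrow> j \<in> F \<Longrightarrow> i \<noteq> j \<Longrightarrow> b j \<notin> Pr i" and "\<And>i. i \<in> F \<Longrightarrow> x \<in> Pr i"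
  shows "\<exists>w. a dvd x - prod b F * w"
  using assms
proof (induction F)
  case empty
  then show ?case by (auto intro!: exI[of _ x])
next
  case (insert i F)
  have "\<exists>w. a dvd x - prod b F * w"
    by (rule insert.IH) (use insert.prems in auto)
  then obtain w u where w: "x = prod b F * w + a * u"
    by (auto simp: dvd_def algebra_simps)
  have P: "is_prime (Pr i)" using insert.prems(1) by blast
  then have I: "is_ideal (Pr i)" by (rule is_prime_ideal)
  have iff: "y \<in> Pr i \<longleftrightarrow> (\<exists>u w. y = a * u + b i * w)" for y
    by (rule insert.prems(2)) simp
  have "a \<in> Pr i"
    by (subst iff) (rule exI[of _ 1], rule exI[of _ 0], simp)
  then have "x - a * u \<in> Pr i"
    using insert.prems(4)[of i] I by (intro is_idealD) auto
  then have "prod b F * w \<in> Pr i" by (simp add: w)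
  moreover have "prod b F \<notin> Pr i"
    using is_prime_prod[OF P, of b F] insert.prems(3)[of i] insert.hyps by auto
  ultimately have "w \<in> Pr i" using P by (auto simp: is_prime_def)
  then obtain u' w' where "w = a * u' + b i * w'" using iff by blast
  then have "x - prod b (insert i F) * w' = a * (u + prod b F * u')"
    using insert.hyps by (simp add: w algebra_simps)
  then show ?case by (metis dvd_triv_left)
qed

locale arr =
  fixes A :: "('k::field, 'n::{finite,linorder}) vec set set"
    and H :: "('k, 'n) vec set"
    and \<alpha> \<beta> :: "('k, 'n) vec set \<Rightarrow> ('k, 'n) vec"
  assumes arrangement: "arrangement A" and H_in: "H \<in> A"
    and def_forms: "defining_forms \<alpha> A" and res_forms: "restricted_forms \<beta> A H"
begin

abbreviation "aH \<equiv> lin_form (\<alpha> H)"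
abbreviation "Qb \<equiv> arr_poly \<beta> (restriction A H)"

lemma finite_A: "finite A"
  using arrangement by (simp add: arrangement_def)

lemma finite_restriction: "finite (restriction A H)"
proof -
  have "restriction A H \<subseteq> (\<lambda>L. H \<inter> L) ` A" by (auto simp: restriction_def)
  then show ?thesis using finite_A finite_subset by blast
qed

lemma mem_iff: "L \<in> A \<Longrightarrow> v \<in> L \<longleftrightarrow> lin_eval (\<alpha> L) v = 0"
  using def_forms unfolding defining_forms_def by (metis (mono_tags, lifting) mem_Collect_eq)

lemma hyperplane_eq: "L \<in> A \<Longrightarrow> L = {v. lin_eval (\<alpha> L) v = 0}"
  using mem_iff by auto

lemma alpha_nonzero: "L \<in> A \<Longrightarrow> \<alpha> L \<noteq> 0"
proof
  assume L: "L \<in> A" "\<alpha> L = 0"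
  then have "L = UNIV" using mem_iff by auto
  then show False
    using arrangement L(1) vec_dim_card[where 'a = 'k and 'n = 'n] by (auto simp: arrangement_def)
qed

lemma restriction_mem_iff: "Y \<in> restriction A H \<Longrightarrow> v \<in> Y \<longleftrightarrow> lin_eval (\<alpha> H) v = 0 \<and> lin_eval (\<beta> Y) v = 0"
  using res_forms mem_iff[OF H_in, of v] unfolding restricted_forms_def
  by (metis (mono_tags, lifting) mem_Collect_eq)

lemma restriction_eq: "Y \<in> restriction A H \<Longrightarrow> Y = {v. lin_eval (\<alpha> H) v = 0 \<and> lin_eval (\<beta> Y) v = 0}"
  using restriction_mem_iff by auto

lemma alpha_in_subspace_ideal_iff: "L \<in> A \<Longrightarrow> lin_form (\<alpha> L) \<in> subspace_ideal Z \<longleftrightarrow> Z \<subseteq> L"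
  using mem_iff by (auto simp: lin_form_in_subspace_ideal_iff)

lemma beta_in_subspace_ideal_iff:
  "Y \<in> restriction A H \<Longrightarrow> Z \<subseteq> H \<Longrightarrow> lin_form (\<beta> Y) \<in> subspace_ideal Z \<longleftrightarrow> Z \<subseteq> Y"
  using restriction_mem_iff mem_iff[OF H_in] by (auto simp: lin_form_in_subspace_ideal_iff)

lemma hyperplane_subset: "L \<in> A \<Longrightarrow> L' \<in> A \<Longrightarrow> L \<subseteq> L' \<Longrightarrow> L = L'"
proof -
  assume L: "L \<in> A" "L' \<in> A" "L \<subseteq> L'"
  have "\<alpha> L' \<in> vec.span {\<alpha> L}"
    by (rule in_span_annihilator) (use L mem_iff in auto)
  then obtain c where c: "\<alpha> L' = c *s \<alpha> L" by (auto simp: vec.span_singleton)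
  then have "c \<noteq> 0" using alpha_nonzero[OF L(2)] by auto
  then show "L = L'"
    using L c mem_iff by (auto simp: lin_eval_scale_left)
qed

lemma restriction_neq: "Y \<in> restriction A H \<Longrightarrow> \<not> H \<subseteq> Y"
  using hyperplane_subset[OF H_in] by (auto simp: restriction_def)

lemma restriction_subset:
  assumes Y: "Y \<in> restriction A H" "Y' \<in> restriction A H" "Y \<subseteq> Y'"
  shows "Y = Y'"
proof -
  have "\<beta> Y' \<in> vec.span {\<alpha> H, \<beta> Y}"
  proof (rule in_span_annihilator)
    fix v assume "\<And>d. d \<in> {\<alpha> H, \<beta> Y} \<Longrightarrow> lin_eval d v = 0"
    then have "v \<in> Y" using restriction_mem_iff[OF Y(1)] by simp
    then show "lin_eval (\<beta> Y') v = 0" using Y(3) restriction_mem_iff[OF Y(2)] by blast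
  qed
  then obtain a b where ab: "\<beta> Y' = a *s \<alpha> H + b *s \<beta> Y"
    by (auto simp: vec.span_breakdown_eq algebra_simps)
  have "b \<noteq> 0"
    using restriction_neq[OF Y(2)] restriction_mem_iff[OF Y(2)] mem_iff[OF H_in] ab
    by (auto simp: lin_eval_scale_left)
  then show ?thesis
    using Y(3) restriction_mem_iff[OF Y(2)] restriction_mem_iff[OF Y(1)] ab
    by (auto simp: lin_eval_scale_left lin_eval_add_left)
qed

lemma transversal_vector: obtains \<theta> where "lin_eval (\<alpha> H) \<theta> = 1"
  using separating_form[of "\<alpha> H" "{}"] alpha_nonzero[OF H_in] by auto

lemma contract_H:
  assumes "\<eta> \<in> log_numerators \<alpha> A" "lin_eval (\<alpha> H) \<theta> = 1"
  shows "aH dvd contract \<eta> v - Const (lin_eval (\<alpha> H) v) * contract \<eta> \<theta>"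
  using contract_wedge[OF assms(1) H_in, of v \<theta>] assms(2) by (simp add: mult.commute)

lemma subspace_ideal_restriction: "Y \<in> restriction A H \<Longrightarrow> f \<in> subspace_ideal Y \<longleftrightarrow> (\<exists>u w. f = aH * u + lin_form (\<beta> Y) * w)"
  using subspace_ideal_two_forms[of f "\<alpha> H" "\<beta> Y"] restriction_eq[of Y] by simp

lemma prod_beta_divides:
  assumes F: "F \<subseteq> restriction A H" and x: "\<And>Y. Y \<in> F \<Longrightarrow> x \<in> subspace_ideal Y"
  shows "\<exists>w. aH dvd x - arr_poly \<beta> F * w"
  unfolding arr_poly_def
proof (rule prod_of_prime_ideals[where Pr = subspace_ideal])
  show "finite F" using F finite_restriction finite_subset by blast
  fix Y Y' assume "Y \<in> F" "Y' \<in> F" "Y \<noteq> Y'"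
  then show "lin_form (\<beta> Y') \<notin> subspace_ideal Y"
    using F beta_in_subspace_ideal_iff[of Y' Y] restriction_subset[of Y Y'] by (auto simp: restriction_def)
next
  fix Y y assume "Y \<in> F"
  then show "y \<in> subspace_ideal Y \<longleftrightarrow> (\<exists>u w. y = aH * u + lin_form (\<beta> Y) * w)"
    using F by (intro subspace_ideal_restriction) auto
qed (use x is_prime_subspace_ideal in auto)

text \<open>For \<open>Y = H \<inter> L\<close> take \<open>u\<close> tangent to \<open>H\<close>
  with \<open>\<alpha> L\<close> equal to 1 on it. The condition at \<open>L\<close> makes
  \<open>contract \<eta> \<theta>\<close> a multiple of \<open>contract \<eta> u\<close> modulo
  \<open>\<alpha> L\<close>, and the condition at \<open>H\<close> makes
  \<open>contract \<eta> u\<close> divisible by \<open>aH\<close>. So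
  \<open>contract \<eta> \<theta>\<close> lies in the ideal of every \<open>Y\<close>, and hence is
  a multiple of \<open>Qb\<close> modulo \<open>aH\<close>.\<close>

lemma residue_exists:
  assumes \<eta>: "\<eta> \<in> log_numerators \<alpha> A"
  obtains f where "\<And>v. aH dvd contract \<eta> v - Const (lin_eval (\<alpha> H) v) * Qb * f"
proof -
  obtain \<theta> where \<theta>: "lin_eval (\<alpha> H) \<theta> = 1" by (rule transversal_vector)
  have "contract \<eta> \<theta> \<in> subspace_ideal Y" if Y: "Y \<in> restriction A H" for Y
  proof -
    obtain L where L: "L \<in> A" "L \<noteq> H" "Y = H \<inter> L" using Y by (auto simp: restriction_def)
    have "\<alpha> L \<notin> vec.span {\<alpha> H}"
    proof
      assume "\<alpha> L \<in> vec.span {\<alpha> H}"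
      then obtain c where "\<alpha> L = c *s \<alpha> H" by (auto simp: vec.span_singleton)
      then have "H \<subseteq> L" using mem_iff[OF L(1)] mem_iff[OF H_in] by (auto simp: lin_eval_scale_left)
      then show False using hyperplane_subset[OF H_in L(1)] L(2) by auto
    qed
    then obtain u where u: "lin_eval (\<alpha> L) u = 1" "lin_eval (\<alpha> H) u = 0"
      by (rule separating_form) auto
    have I: "is_ideal (subspace_ideal Y)" by (rule is_ideal_subspace_ideal)
    have a: "lin_form (\<alpha> L) \<in> subspace_ideal Y" "aH \<in> subspace_ideal Y"
      using alpha_in_subspace_ideal_iff L H_in by auto
    have "lin_form (\<alpha> L) dvd contract \<eta> \<theta> - contract \<eta> u * Const (lin_eval (\<alpha> L) \<theta>)"
      using contract_wedge[OF \<eta> L(1), of \<theta> u] u by simp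
    then have 1: "contract \<eta> \<theta> - contract \<eta> u * Const (lin_eval (\<alpha> L) \<theta>) \<in> subspace_ideal Y"
      using a(1) I by (auto simp: dvd_def is_idealD)
    have "aH dvd contract \<eta> u"
      using contract_H[OF \<eta> \<theta>, of u] u by simp
    then have "contract \<eta> u * Const (lin_eval (\<alpha> L) \<theta>) \<in> subspace_ideal Y"
      using a(2) I by (auto simp: dvd_def is_idealD)
    then show ?thesis using is_ideal_diff_mem[OF I 1] by simp
  qed
  then obtain f where f: "aH dvd contract \<eta> \<theta> - Qb * f"
    using prod_beta_divides[of "restriction A H"] by blast
  show thesis
  proof
    fix v
    have "aH dvd (contract \<eta> v - Const (lin_eval (\<alpha> H) v) * contract \<eta> \<theta>)
        + Const (lin_eval (\<alpha> H) v) * (contract \<eta> \<theta> - Qb * f)"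
      using contract_H[OF \<eta> \<theta>] f by (intro dvd_add dvd_mult)
    then show "aH dvd contract \<eta> v - Const (lin_eval (\<alpha> H) v) * Qb * f"
      by (simp add: algebra_simps)
  qed
qed

abbreviation "J \<equiv> residue_lift \<alpha> \<beta> A H"

lemma residue_liftI:
  "\<eta> \<in> log_numerators \<alpha> A \<Longrightarrow> (\<And>v. aH dvd contract \<eta> v - Const (lin_eval (\<alpha> H) v) * Qb * f) \<Longrightarrow> f \<in> J"
  by (auto simp: residue_lift_def)

lemma residue_liftE:
  assumes "f \<in> J"
  obtains \<eta> where "\<eta> \<in> log_numerators \<alpha> A" "\<And>v. aH dvd contract \<eta> v - Const (lin_eval (\<alpha> H) v) * Qb * f"
  using assms by (auto simp: residue_lift_def)

lemma is_ideal_J: "is_ideal J"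
  unfolding is_ideal_def
proof (intro conjI ballI allI)
  show "0 \<in> J" by (rule residue_liftI[OF log_numerators_0]) simp
next
  fix f g assume "f \<in> J" "g \<in> J"
  then obtain \<eta> \<zeta> where *: "\<eta> \<in> log_numerators \<alpha> A" "\<zeta> \<in> log_numerators \<alpha> A"
    "\<And>v. aH dvd contract \<eta> v - Const (lin_eval (\<alpha> H) v) * Qb * f"
    "\<And>v. aH dvd contract \<zeta> v - Const (lin_eval (\<alpha> H) v) * Qb * g"
    by (auto elim!: residue_liftE)
  show "f + g \<in> J"
  proof (rule residue_liftI[OF log_numerators_add[OF *(1,2)]])
    fix v show "aH dvd contract (\<eta> + \<zeta>) v - Const (lin_eval (\<alpha> H) v) * Qb * (f + g)"
      using dvd_add[OF *(3,4)[of v]] by (simp add: contract_add algebra_simps)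
  qed
next
  fix f r assume "f \<in> J"
  then obtain \<eta> where *: "\<eta> \<in> log_numerators \<alpha> A"
    "\<And>v. aH dvd contract \<eta> v - Const (lin_eval (\<alpha> H) v) * Qb * f"
    by (auto elim!: residue_liftE)
  have "r *s \<eta> \<in> log_numerators \<alpha> A"
    by (rule log_numerators_scale) (use * in auto)
  then show "r * f \<in> J"
  proof (rule residue_liftI)
    fix v show "aH dvd contract (r *s \<eta>) v - Const (lin_eval (\<alpha> H) v) * Qb * (r * f)"
      using dvd_mult[OF *(2)[of v], of r] by (simp add: contract_scale algebra_simps)
  qed
qed

lemma aH_in_J: "aH \<in> J"
  by (rule residue_liftI[OF log_numerators_0]) simp

text \<open>Applied to the entries of a numerator, \<open>T\<close> preserves the logarithmic
  conditions, as they involve only constants and divisibility by the forms. \<open>T'\<close> may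
  differ from \<open>T\<close>: taking a homogeneous component shifts the degree by that of
  \<open>Qb\<close>.\<close>

lemma J_stable:
  assumes add: "\<And>x y. T (x + y) = T x + T y" and scale: "\<And>x c. T (x * Const c) = T x * Const c"
    and dvd: "\<And>L x. L \<in> A \<Longrightarrow> lin_form (\<alpha> L) dvd x \<Longrightarrow> lin_form (\<alpha> L) dvd T x"
    and T': "\<And>f. T (Qb * f) = Qb * T' f" and f: "f \<in> J"
  shows "T' f \<in> J"
proof -
  have "T 0 + T 0 = T 0 + 0" using add[of 0 0] by (simp only: add_0_right)
  then have T0: "T 0 = 0" by (rule add_left_imp_eq)
  have diff: "T (x - y) = T x - T y" for x y
    using add[of "x - y" y] by (simp add: algebra_simps)
  have sum: "T (sum g I) = (\<Sum>i\<in>I. T (g i))" for g :: "'n \<Rightarrow> ('k, 'n) mpol" and I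
    by (induction I rule: infinite_finite_induct) (auto simp: T0 add)
  obtain \<eta> where \<eta>: "\<eta> \<in> log_numerators \<alpha> A"
    "\<And>v. aH dvd contract \<eta> v - Const (lin_eval (\<alpha> H) v) * Qb * f"
    using f by (rule residue_liftE) blast
  define \<zeta> where "\<zeta> = (\<chi> i. T (\<eta> $ i))"
  have "\<zeta> \<in> log_numerators \<alpha> A"
    unfolding log_numerators_def
  proof clarify
    fix L i j assume L: "L \<in> A"
    then have "lin_form (\<alpha> L) dvd T (\<eta> $ i * Const (\<alpha> L $ j) - \<eta> $ j * Const (\<alpha> L $ i))"
      using \<eta>(1) by (intro dvd) (auto simp: log_numerators_def)
    then show "lin_form (\<alpha> L) dvd \<zeta> $ i * Const (\<alpha> L $ j) - \<zeta> $ j * Const (\<alpha> L $ i)"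
      by (simp add: \<zeta>_def diff scale)
  qed
  then show ?thesis
  proof (rule residue_liftI)
    fix v
    let ?c = "Const (lin_eval (\<alpha> H) v)"
    have "T (?c * Qb * f) = T (Qb * f * ?c)" by (simp only: mult_ac)
    also have "\<dots> = Qb * T' f * ?c" by (simp only: scale T')
    also have "\<dots> = ?c * Qb * T' f" by (simp only: mult_ac)
    finally have "T (contract \<eta> v - ?c * Qb * f) = contract \<zeta> v - ?c * Qb * T' f"
      by (simp add: diff contract_def sum scale \<zeta>_def)
    then show "aH dvd contract \<zeta> v - Const (lin_eval (\<alpha> H) v) * Qb * T' f"
      using dvd[OF H_in \<eta>(2)[of v]] by simp
  qed
qed

lemma J_hcomp:
  assumes "f \<in> J" shows "hcomp d f \<in> J"
proof (rule J_stable[where T = "hcomp (d + card (restriction A H))" and T' = "hcomp d" and f = f])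
  interpret g: rhom graded by (rule rhom_graded)
  fix x y :: "('k, 'n) mpol" and c
  show "hcomp e (x + y) = hcomp e x + hcomp e y" for e by (simp add: hcomp_def)
  show "hcomp e (x * Const c) = hcomp e x * Const c" for e
    by (simp add: hcomp_def mult.commute)
  show "lin_form (\<alpha> L) dvd hcomp e x" if "lin_form (\<alpha> L) dvd x" for L e
    using that by (auto simp: dvd_def hcomp_def graded_lin_form coeff_monom_mult)
  show "hcomp (d + card (restriction A H)) (Qb * x) = Qb * hcomp d x"
    using graded_prod_lin_form[of "\<beta>" "restriction A H"]
    by (simp add: hcomp_def coeff_monom_mult flip: arr_poly_def del: g.prod)
qed fact

lemma beta_vanishes: "Y \<in> restriction A H \<Longrightarrow> Z \<subseteq> \<Inter>A \<Longrightarrow> x \<in> Z \<Longrightarrow> lin_eval (\<beta> Y) x = 0"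
  using restriction_mem_iff[of Y x] H_in by (auto simp: restriction_def)

text \<open>All \<open>\<alpha> L\<close> and \<open>\<beta> Y\<close> vanish on a subspace of the
  center, so \<open>Theta\<close> treats them as scalars and extracting a coefficient is linear over
  them.\<close>

lemma J_Theta:
  assumes D: "dual_basis Z s v z" and Z: "Z \<subseteq> \<Inter>A" and f: "f \<in> J"
  shows "Poly_Mapping.lookup (Theta s v z f) m \<in> J"
proof (rule J_stable[where T = "\<lambda>x. Poly_Mapping.lookup (Theta s v z x) m"
      and T' = "\<lambda>x. Poly_Mapping.lookup (Theta s v z x) m" and f = f])
  interpret t: rhom "Theta s v z" by (rule rhom_Theta)
  have vZ: "v ` {..<s} \<subseteq> Z" using D by (simp add: dual_basis_def)
  fix x y :: "('k, 'n) mpol" and c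
  show "Poly_Mapping.lookup (Theta s v z (x + y)) m
      = Poly_Mapping.lookup (Theta s v z x) m + Poly_Mapping.lookup (Theta s v z y) m"
    by (simp add: lookup_add)
  show "Poly_Mapping.lookup (Theta s v z (x * Const c)) m = Poly_Mapping.lookup (Theta s v z x) m * Const c"
    by (simp add: mult.commute[of _ "Const _"] lookup_Const_mult)
  show "lin_form (\<alpha> L) dvd Poly_Mapping.lookup (Theta s v z x) m" if "L \<in> A" "lin_form (\<alpha> L) dvd x" for L
  proof -
    have "Theta s v z (lin_form (\<alpha> L)) = Const (lin_form (\<alpha> L))"
      by (rule Theta_annihilator[OF vZ]) (use Z that mem_iff in auto)
    then show ?thesis using that(2) by (auto simp: dvd_def lookup_Const_mult)
  qed
  have "Theta s v z Qb = Const Qb"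
    using beta_vanishes[OF _ Z] by (simp add: arr_poly_def Theta_annihilator[OF vZ])
  then show "Poly_Mapping.lookup (Theta s v z (Qb * x)) m = Qb * Poly_Mapping.lookup (Theta s v z x) m"
    by (simp add: lookup_Const_mult)
qed fact

lemma J_dichotomy:
  assumes Z: "Z \<subseteq> \<Inter>A" and "1 \<notin> J"
  shows "J \<subseteq> subspace_ideal Z"
proof -
  obtain s v z where D: "dual_basis Z s v z" by (rule dual_basis_exists)
  show ?thesis
    using Theta_graded_dichotomy[OF D is_ideal_J J_Theta[OF D Z] J_hcomp] assms(2) by blast
qed

lemma J_colon:
  assumes Z: "Z \<subseteq> \<Inter>A" and "\<And>q. q \<in> subspace_ideal Z \<Longrightarrow> q * g \<in> J" and "p * g \<in> J" "p \<notin> subspace_ideal Z"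
  shows "g \<in> J"
proof -
  obtain s v z where D: "dual_basis Z s v z" by (rule dual_basis_exists)
  show ?thesis
    using Theta_stable_colon[OF D is_ideal_J J_Theta[OF D Z]] assms by blast
qed

subsection \<open>Localization\<close>

lemma restriction_localization:
  "Z \<subseteq> H \<Longrightarrow> restriction (localization A Z) H = {Y \<in> restriction A H. Z \<subseteq> Y}"
  by (auto simp: restriction_def localization_def)

lemma arr_localization:
  assumes "Z \<subseteq> H"
  shows "arr (localization A Z) H \<alpha> \<beta>"
proof
  show "arrangement (localization A Z)"
    using arrangement by (auto simp: arrangement_def localization_def)
  show "H \<in> localization A Z" using H_in assms by (simp add: localization_def)
  show "defining_forms \<alpha> (localization A Z)"
    using def_forms unfolding defining_forms_def localization_def by blast
  show "restricted_forms \<beta> (localization A Z) H"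
    using res_forms assms unfolding restricted_forms_def by (simp add: restriction_localization)
qed

abbreviation "Q_out Z \<equiv> arr_poly \<alpha> (A - localization A Z)"
abbreviation "Qb_out Z \<equiv> arr_poly \<beta> {Y \<in> restriction A H. \<not> Z \<subseteq> Y}"

lemma Qb_split:
  assumes "Z \<subseteq> H"
  shows "Qb = arr_poly \<beta> (restriction (localization A Z) H) * Qb_out Z"
proof -
  have "restriction A H = {Y \<in> restriction A H. Z \<subseteq> Y} \<union> {Y \<in> restriction A H. \<not> Z \<subseteq> Y}" by auto
  then show ?thesis
    unfolding arr_poly_def restriction_localization[OF assms]
    by (subst prod.union_disjoint[symmetric]) (use finite_restriction in auto)
qed

text \<open>The same form stays logarithmic for fewer hyperplanes; only the denominator of the
  residue shrinks, by the factor \<open>Qb_out Z\<close>.\<close>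

lemma J_imp_localization:
  assumes Z: "Z \<subseteq> H" and f: "f \<in> J"
  shows "Qb_out Z * f \<in> residue_lift \<alpha> \<beta> (localization A Z) H"
proof -
  interpret Z: arr "localization A Z" H \<alpha> \<beta> by (rule arr_localization[OF Z])
  obtain \<eta> where \<eta>: "\<eta> \<in> log_numerators \<alpha> A"
    "\<And>v. aH dvd contract \<eta> v - Const (lin_eval (\<alpha> H) v) * Qb * f"
    using f by (rule residue_liftE) blast
  have "\<eta> \<in> log_numerators \<alpha> (localization A Z)"
    using \<eta>(1) log_numerators_antimono[of "localization A Z" A \<alpha>] by (auto simp: localization_def)
  then show ?thesis
    by (rule Z.residue_liftI) (use \<eta>(2) in \<open>simp add: Qb_split[OF Z] mult_ac\<close>)
qed

text \<open>Every \<open>Y\<close> not containing \<open>Z\<close> is cut out by some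
  \<open>L\<close> not containing \<open>Z\<close>, so \<open>Qb_out Z\<close> divides
  \<open>Q_out Z\<close> modulo \<open>aH\<close>. Several \<open>L\<close> may cut out the same
  \<open>Y\<close>, which is why a cofactor \<open>e\<close> remains.\<close>

lemma localization_imp_J:
  assumes Z: "Z \<subseteq> H"
  obtains e where "aH dvd Q_out Z - Qb_out Z * e"
    and "\<And>f. f \<in> residue_lift \<alpha> \<beta> (localization A Z) H \<Longrightarrow> e * f \<in> J"
proof -
  interpret Z: arr "localization A Z" H \<alpha> \<beta> by (rule arr_localization[OF Z])
  have "\<exists>e. aH dvd Q_out Z - Qb_out Z * e"
  proof (rule prod_beta_divides)
    fix Y assume Y: "Y \<in> {Y \<in> restriction A H. \<not> Z \<subseteq> Y}"
    then obtain L where L: "L \<in> A" "Y = H \<inter> L" "L \<in> A - localization A Z"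
      using Z by (auto simp: restriction_def localization_def)
    have "Q_out Z = lin_form (\<alpha> L) * arr_poly \<alpha> (A - localization A Z - {L})"
      unfolding arr_poly_def using L finite_A by (subst prod.remove[of _ L]) auto
    moreover have "lin_form (\<alpha> L) \<in> subspace_ideal Y" using alpha_in_subspace_ideal_iff L by auto
    ultimately show "Q_out Z \<in> subspace_ideal Y" using is_idealD(4)[OF is_ideal_subspace_ideal] by metis
  qed auto
  then obtain e where e: "aH dvd Q_out Z - Qb_out Z * e" ..
  have "e * f \<in> J" if f: "f \<in> residue_lift \<alpha> \<beta> (localization A Z) H" for f
  proof -
    obtain \<eta> where \<eta>: "\<eta> \<in> log_numerators \<alpha> (localization A Z)"
      "\<And>v. aH dvd contract \<eta> v - Const (lin_eval (\<alpha> H) v) * Z.Qb * f"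
      using f by (rule Z.residue_liftE) blast
    have "lin_form (\<alpha> L) dvd Q_out Z" if "L \<in> A - localization A Z" for L
      unfolding arr_poly_def using that finite_A by (intro dvd_prodI) auto
    then have "Q_out Z *s \<eta> \<in> log_numerators \<alpha> A"
      by (intro log_numerators_scale) (use \<eta>(1) in blast)
    then show ?thesis
    proof (rule residue_liftI)
      fix v
      let ?c = "Const (lin_eval (\<alpha> H) v)"
      have "aH dvd Q_out Z * (contract \<eta> v - ?c * Z.Qb * f) + (Q_out Z - Qb_out Z * e) * (?c * Z.Qb * f)"
        using \<eta>(2) e by (intro dvd_add dvd_mult dvd_mult2) auto
      then show "aH dvd contract (Q_out Z *s \<eta>) v - ?c * Qb * (e * f)"
        by (simp add: Qb_split[OF Z] contract_scale algebra_simps)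
    qed
  qed
  then show thesis using that e by blast
qed

section \<open>Primes over the lifted residue ideal and the flats they determine\<close>

definition Xi' :: "('k, 'n) vec set set" where
  "Xi' = {Z \<in> flats A H. 1 \<notin> residue_lift \<alpha> \<beta> (localization A Z) H}"

lemma flats_subset: "Z \<in> flats A H \<Longrightarrow> Z \<subseteq> H"
  by (auto simp: flats_def)

text \<open>The forms vanishing on \<open>Z\<close> are combinations of \<open>\<alpha> H\<close>
  and the \<open>\<beta> Y\<close> in \<open>P\<close>. The flat also detects hyperplanes of
  \<open>A\<close>: if \<open>\<alpha> L\<close> is in \<open>P\<close>, then so is
  \<open>\<beta> (H \<inter> L)\<close>, a combination of \<open>\<alpha> H\<close> and
  \<open>\<alpha> L\<close>.\<close>

lemma prime_flat:
  assumes P: "is_prime P" and aP: "aH \<in> P"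
  obtains Z where "Z \<in> flats A H" and "subspace_ideal Z \<subseteq> P"
    and "\<And>L. L \<in> A \<Longrightarrow> lin_form (\<alpha> L) \<in> P \<longleftrightarrow> Z \<subseteq> L"
    and "\<And>Y. Y \<in> restriction A H \<Longrightarrow> lin_form (\<beta> Y) \<in> P \<longleftrightarrow> Z \<subseteq> Y"
proof -
  define B where "B = {Y \<in> restriction A H. lin_form (\<beta> Y) \<in> P}"
  define Z where "Z = H \<inter> \<Inter>B"
  have I: "is_ideal P" using P by (rule is_prime_ideal)
  have Z: "Z \<in> flats A H" by (auto simp: Z_def B_def flats_def)
  have "subspace_ideal Z \<subseteq> P"
  proof (rule subspace_ideal_minimal[OF I])
    fix c assume c: "\<And>v. v \<in> Z \<Longrightarrow> lin_eval c v = 0"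
    have "c \<in> vec.span (insert (\<alpha> H) (\<beta> ` B))"
    proof (rule in_span_annihilator)
      fix v assume "\<And>d. d \<in> insert (\<alpha> H) (\<beta> ` B) \<Longrightarrow> lin_eval d v = 0"
      then have "v \<in> Z"
        using mem_iff[OF H_in] restriction_mem_iff by (auto simp: Z_def B_def)
      then show "lin_eval c v = 0" by (rule c)
    qed
    then show "lin_form c \<in> P"
    proof (induction rule: vec.span_induct_alt)
      case base
      then show ?case using I by (simp add: is_idealD)
    next
      case (step a x y)
      then have "lin_form x \<in> P" using aP by (auto simp: B_def)
      then show ?case
        using step(2) I by (simp add: lin_form_add lin_form_scale is_idealD)
    qed
  qed
  moreover have Y: "lin_form (\<beta> Y) \<in> P \<longleftrightarrow> Z \<subseteq> Y" if Y: "Y \<in> restriction A H" for Y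
  proof
    assume "lin_form (\<beta> Y) \<in> P"
    then show "Z \<subseteq> Y" using Y by (auto simp: Z_def B_def)
  next
    assume "Z \<subseteq> Y"
    then show "lin_form (\<beta> Y) \<in> P"
      using beta_in_subspace_ideal_iff[OF Y flats_subset[OF Z]] \<open>subspace_ideal Z \<subseteq> P\<close> by auto
  qed
  moreover have "lin_form (\<alpha> L) \<in> P \<longleftrightarrow> Z \<subseteq> L" if L: "L \<in> A" for L
  proof
    assume "Z \<subseteq> L"
    then show "lin_form (\<alpha> L) \<in> P" using alpha_in_subspace_ideal_iff[OF L] \<open>subspace_ideal Z \<subseteq> P\<close> by auto
  next
    assume LP: "lin_form (\<alpha> L) \<in> P"
    show "Z \<subseteq> L"
    proof (cases "L = H")
      case True
      then show ?thesis by (simp add: Z_def)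
    next
      case False
      then have HL: "H \<inter> L \<in> restriction A H" using L by (auto simp: restriction_def)
      have "\<beta> (H \<inter> L) \<in> vec.span {\<alpha> H, \<alpha> L}"
      proof (rule in_span_annihilator)
        fix v assume "\<And>d. d \<in> {\<alpha> H, \<alpha> L} \<Longrightarrow> lin_eval d v = 0"
        then have "v \<in> H \<inter> L" using mem_iff[OF L] mem_iff[OF H_in] by simp
        then show "lin_eval (\<beta> (H \<inter> L)) v = 0" using restriction_mem_iff[OF HL] by blast
      qed
      then obtain a b where "\<beta> (H \<inter> L) = a *s \<alpha> H + b *s \<alpha> L"
        by (auto simp: vec.span_breakdown_eq algebra_simps)
      then have "lin_form (\<beta> (H \<inter> L)) \<in> P"
        using LP aP I by (simp add: lin_form_add lin_form_scale is_idealD)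
      then show ?thesis using Y[OF HL] by simp
    qed
  qed
  ultimately show thesis using that Z by blast
qed

lemma Qb_out_notin:
  assumes "is_prime P" "\<And>Y. Y \<in> restriction A H \<Longrightarrow> lin_form (\<beta> Y) \<in> P \<Longrightarrow> Z \<subseteq> Y"
  shows "Qb_out Z \<notin> P"
  using is_prime_prod[OF assms(1)] assms(2) unfolding arr_poly_def by blast

text \<open>Modulo \<open>aH\<close> the product \<open>Qb_out Z * e\<close> equals
  \<open>Q_out Z\<close>, a product of forms outside \<open>P\<close>; hence \<open>e\<close> is
  outside \<open>P\<close> too.\<close>

lemma localization_factor:
  assumes Z: "Z \<subseteq> H" and P: "is_prime P" "aH \<in> P"
    and L: "\<And>L. L \<in> A \<Longrightarrow> lin_form (\<alpha> L) \<in> P \<Longrightarrow> Z \<subseteq> L"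
  obtains e where "e \<notin> P" and "\<And>f. f \<in> residue_lift \<alpha> \<beta> (localization A Z) H \<Longrightarrow> e * f \<in> J"
proof -
  obtain e where e: "aH dvd Q_out Z - Qb_out Z * e"
    "\<And>f. f \<in> residue_lift \<alpha> \<beta> (localization A Z) H \<Longrightarrow> e * f \<in> J"
    using localization_imp_J[OF Z] by blast
  have I: "is_ideal P" using P(1) by (rule is_prime_ideal)
  have "Q_out Z - Qb_out Z * e \<in> P"
    using e(1) P(2) I by (auto simp: dvd_def is_idealD)
  moreover have "Q_out Z \<notin> P"
    using is_prime_prod[OF P(1)] L unfolding arr_poly_def localization_def by blast
  ultimately have "Qb_out Z * e \<notin> P" using is_ideal_diff_mem[OF I] by blast
  then have "e \<notin> P" using is_idealD(3)[OF I] by blast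
  then show thesis using that e(2) by blast
qed

lemma localization_subset_Inter: "Z \<subseteq> \<Inter>(localization A Z)"
  by (auto simp: localization_def)

text \<open>Left to right, take the flat of \<open>P\<close>: if the localized ideal contained 1,
  then \<open>e\<close> would lie in \<open>J\<close> and so in \<open>P\<close>. Right to left,
  \<open>Qb_out Z\<close> carries \<open>J\<close> into the localized ideal, which lies in the prime
  of \<open>Z\<close>, and \<open>Qb_out Z\<close> is outside that prime.\<close>

theorem primes_over_J:
  assumes P: "is_prime P"
  shows "J \<subseteq> P \<longleftrightarrow> (\<exists>Z\<in>Xi'. subspace_ideal Z \<subseteq> P)"
proof
  assume JP: "J \<subseteq> P"
  then have aP: "aH \<in> P" using aH_in_J by auto
  obtain Z where Z: "Z \<in> flats A H" "subspace_ideal Z \<subseteq> P"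
    "\<And>L. L \<in> A \<Longrightarrow> lin_form (\<alpha> L) \<in> P \<longleftrightarrow> Z \<subseteq> L"
    using prime_flat[OF P aP] by metis
  obtain e where e: "e \<notin> P" "\<And>f. f \<in> residue_lift \<alpha> \<beta> (localization A Z) H \<Longrightarrow> e * f \<in> J"
    using localization_factor[OF flats_subset[OF Z(1)] P aP] Z(3) by metis
  have "1 \<notin> residue_lift \<alpha> \<beta> (localization A Z) H"
    using e JP by force
  then show "\<exists>Z\<in>Xi'. subspace_ideal Z \<subseteq> P" using Z by (auto simp: Xi'_def)
next
  assume "\<exists>Z\<in>Xi'. subspace_ideal Z \<subseteq> P"
  then obtain Z where Z: "Z \<in> Xi'" "subspace_ideal Z \<subseteq> P" by blast
  then have ZH: "Z \<subseteq> H" using flats_subset by (auto simp: Xi'_def)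
  interpret Z: arr "localization A Z" H \<alpha> \<beta> by (rule arr_localization[OF ZH])
  have Zl: "Z.J \<subseteq> subspace_ideal Z"
    by (rule Z.J_dichotomy[OF localization_subset_Inter]) (use Z in \<open>auto simp: Xi'_def\<close>)
  have "Qb_out Z \<notin> subspace_ideal Z"
    by (rule Qb_out_notin[OF is_prime_subspace_ideal]) (use beta_in_subspace_ideal_iff ZH in auto)
  then have "J \<subseteq> subspace_ideal Z"
    using J_imp_localization[OF ZH] Zl is_prime_subspace_ideal[of Z] unfolding is_prime_def by blast
  then show "J \<subseteq> P" using Z(2) by blast
qed

text \<open>After localization all of \<open>P\<close> annihilates \<open>Qb_out Z * g\<close>. An
  element of \<open>P\<close> outside the ideal of \<open>Z\<close> would put
  \<open>Qb_out Z * g\<close> itself into the localized ideal; then \<open>e * Qb_out Z\<close>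
  would annihilate \<open>g\<close> modulo \<open>J\<close>, although neither factor is in
  \<open>P\<close>.\<close>

theorem associated_primes_J:
  assumes P: "is_prime P" and g: "P = {f. f * g \<in> J}"
  shows "\<exists>Z\<in>Xi'. P = subspace_ideal Z"
proof -
  have "J \<subseteq> P" using g is_ideal_J by (auto simp: is_idealD)
  then have aP: "aH \<in> P" using aH_in_J by auto
  obtain Z where Z: "Z \<in> flats A H" "subspace_ideal Z \<subseteq> P"
    "\<And>L. L \<in> A \<Longrightarrow> lin_form (\<alpha> L) \<in> P \<longleftrightarrow> Z \<subseteq> L"
    "\<And>Y. Y \<in> restriction A H \<Longrightarrow> lin_form (\<beta> Y) \<in> P \<longleftrightarrow> Z \<subseteq> Y"
    using prime_flat[OF P aP] by metis
  have ZH: "Z \<subseteq> H" using Z(1) by (rule flats_subset)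
  interpret Z: arr "localization A Z" H \<alpha> \<beta> by (rule arr_localization[OF ZH])
  obtain e where e: "e \<notin> P" "\<And>f. f \<in> Z.J \<Longrightarrow> e * f \<in> J"
    using localization_factor[OF ZH P aP] Z(3) by metis
  have B: "Qb_out Z \<notin> P" by (rule Qb_out_notin[OF P]) (use Z(4) in auto)
  have loc: "f * (Qb_out Z * g) \<in> Z.J" if "f \<in> P" for f
    using J_imp_localization[OF ZH, of "f * g"] that g by (simp add: mult_ac)
  have "1 \<notin> Z.J" using e \<open>J \<subseteq> P\<close> by force
  then have "Z \<in> Xi'" using Z(1) by (simp add: Xi'_def)
  moreover have "P \<subseteq> subspace_ideal Z"
  proof
    fix p assume p: "p \<in> P"
    show "p \<in> subspace_ideal Z"
    proof (rule ccontr)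
      assume "p \<notin> subspace_ideal Z"
      then have "Qb_out Z * g \<in> Z.J"
        using Z.J_colon[OF localization_subset_Inter, of "Qb_out Z * g" p] loc p Z(2) by blast
      then have "(e * Qb_out Z) * g \<in> J" using e(2)[of "Qb_out Z * g"] by (simp add: mult_ac)
      then have "e * Qb_out Z \<in> P" using g by blast
      then show False using e(1) B P unfolding is_prime_def by blast
    qed
  qed
  ultimately show ?thesis using Z(2) by blast
qed

end

section \<open>Generators of the residue ideal of a free arrangement\<close>

lemma (in vector_space) exchange_one:
  assumes "finite F" "e \<in> span (F \<union> W)" "e \<notin> span W"
  shows "\<exists>f\<in>F. f \<in> span (insert e (F - {f} \<union> W))"
  using assms(1,2)
proof (induction F)
  case empty
  then show ?case using assms(3) by simp
next
  case (insert f F)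
  show ?case
  proof (cases "e \<in> span (F \<union> W)")
    case True
    then obtain g where g: "g \<in> F" "g \<in> span (insert e (F - {g} \<union> W))" using insert.IH by blast
    have "insert e (F - {g} \<union> W) \<subseteq> insert e (insert f F - {g} \<union> W)" by auto
    then show ?thesis using g span_mono by blast
  next
    \<comment> \<open>Here \<open>f\<close> is indispensable for \<open>e\<close>, so the two can
      trade places.\<close>
    case False
    have f: "f \<in> span (insert e (F \<union> W))"
      by (rule in_span_insert[OF _ False]) (use insert.prems in auto)
    have eq: "insert e (F \<union> W) = insert e (insert f F - {f} \<union> W)"
      using insert.hyps by auto
    have "f \<in> span (insert e (insert f F - {f} \<union> W))"
      by (rule back_subst[of "\<lambda>S. f \<in> span S", OF f eq])
    then show ?thesis by blast
  qed
qed

text \<open>\<open>U\<close> stands for a subspace to be divided out and may be infinite; joining it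
  to every spanning set replaces the passage to a quotient space.\<close>

lemma (in vector_space) steinitz_modulo:
  assumes "finite E" "finite B" "E \<subseteq> span (B \<union> U)" "\<And>e. e \<in> E \<Longrightarrow> e \<notin> span (E - {e} \<union> U)"
  shows "\<exists>F\<subseteq>B. card F + card E \<le> card B \<and> B \<subseteq> span (E \<union> F \<union> U)"
  using assms(1,3,4)
proof (induction E)
  case empty
  then show ?case using span_superset[of "B \<union> U"] by (intro exI[of _ B]) auto
next
  case (insert e E)
  have "e' \<notin> span (E - {e'} \<union> U)" if "e' \<in> E" for e'
  proof -
    have "span (E - {e'} \<union> U) \<subseteq> span (insert e E - {e'} \<union> U)" by (rule span_mono) auto
    then show ?thesis using insert.prems(2)[of e'] that by auto
  qed
  then obtain F where F: "F \<subseteq> B" "card F + card E \<le> card B" "B \<subseteq> span (E \<union> F \<union> U)"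
    using insert by auto
  have fin: "finite F" using F(1) assms(2) finite_subset by blast
  have "span (B \<union> U) \<subseteq> span (F \<union> (E \<union> U))"
  proof (rule span_minimal)
    have "U \<subseteq> span (F \<union> (E \<union> U))" using span_superset[of "F \<union> (E \<union> U)"] by auto
    then show "B \<union> U \<subseteq> span (F \<union> (E \<union> U))" using F(3) by (auto simp: Un_ac)
  qed (rule subspace_span)
  then have "e \<in> span (F \<union> (E \<union> U))" using insert.prems(1) by auto
  moreover have "e \<notin> span (E \<union> U)"
    using insert.prems(2)[of e] insert.hyps by auto
  ultimately obtain f where f: "f \<in> F" "f \<in> span (insert e (F - {f} \<union> (E \<union> U)))"
    using exchange_one[OF fin] by blast
  let ?W = "insert e E \<union> (F - {f}) \<union> U"
  have eq: "insert e (F - {f} \<union> (E \<union> U)) = ?W" by auto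
  have "span (E \<union> F \<union> U) \<subseteq> span ?W"
  proof (rule span_minimal)
    show "E \<union> F \<union> U \<subseteq> span ?W"
      using f(2) span_superset[of ?W] unfolding eq by auto
  qed (rule subspace_span)
  moreover have "card (F - {f}) + card (insert e E) \<le> card B"
    using F(2) f(1) fin insert.hyps card_Suc_Diff1[OF fin f(1)] by simp
  ultimately show ?case using F by (intro exI[of _ "F - {f}"]) auto
qed

text \<open>A subset of least cardinality that still generates modulo \<open>U\<close> is
  independent modulo \<open>U\<close>, and exchange against \<open>F\<close> bounds its
  size.\<close>

lemma (in vector_space) select_generators:
  assumes "finite G0" "finite F" "G0 \<subseteq> span (F \<union> U)"
  shows "\<exists>G\<subseteq>G0. card G \<le> card F \<and> G0 \<subseteq> span (G \<union> U)"
proof -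
  define P where "P = (\<lambda>G. G \<subseteq> G0 \<and> G0 \<subseteq> span (G \<union> U))"
  have "P G0" using span_superset[of "G0 \<union> U"] by (auto simp: P_def)
  then obtain G where G: "P G" "\<And>G'. P G' \<Longrightarrow> card G \<le> card G'"
    using ex_has_least_nat[of P G0 card] by metis
  have fin: "finite G" using G(1) assms(1) finite_subset by (auto simp: P_def)
  have "e \<notin> span (G - {e} \<union> U)" if e: "e \<in> G" for e
  proof
    assume *: "e \<in> span (G - {e} \<union> U)"
    have "span (G \<union> U) \<subseteq> span (G - {e} \<union> U)"
      by (rule span_minimal) (use * span_superset[of "G - {e} \<union> U"] in auto)
    then have "P (G - {e})" using G(1) by (auto simp: P_def)
    then show False using G(2) card_Diff1_less[OF fin e] by fastforce
  qed
  moreover have "G \<subseteq> span (F \<union> U)" using G(1) assms(3) by (auto simp: P_def)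
  ultimately have "card G \<le> card F"
    using steinitz_modulo[OF fin assms(2), of U] by auto
  then show ?thesis using G(1) by (auto simp: P_def)
qed

interpretation mpol: vector_space "\<lambda>c (f :: ('k::field, 'n::finite) mpol). Const c * f"
  by unfold_locales (simp_all add: algebra_simps)

interpretation forms: vector_space "\<lambda>c (\<eta> :: ('k::field, 'n::finite) mpol ^ 'n). Const c *s \<eta>"
  by unfold_locales (simp_all only: vector_add_ldistrib vector_sadd_rdistrib vector_smult_assoc
    vector_smult_lid Const.add Const.mult Const.one)

lemma hcomp_Const: "hcomp d (Const a) = (if d = 0 then Const a else 0)"
  by (simp add: hcomp_def coeff_pCons split: nat.split)

lemma hcomp_Var: "hcomp d (Var i) = (if d = 1 then Var i else 0)"
  by (simp add: hcomp_def)

lemma hcomp_add: "hcomp d (f + g) = hcomp d f + hcomp d g"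
  by (simp add: hcomp_def rhom.add[OF rhom_graded])

lemma hcomp_zero [simp]: "hcomp d 0 = 0"
  by (simp add: hcomp_def rhom.zero[OF rhom_graded])

lemma hcomp_mult: "hcomp d (f * g) = (\<Sum>k\<le>d. hcomp k f * hcomp (d - k) g)"
  by (simp add: hcomp_def rhom.mult[OF rhom_graded] coeff_mult)

lemma hcomp_Const_mult: "hcomp d (Const a * f) = Const a * hcomp d f"
  by (simp add: hcomp_def rhom.mult[OF rhom_graded])

lemma hcomp_lin_form_mult: "lin_form c dvd hcomp d (lin_form c * f)"
  by (simp add: hcomp_def rhom.mult[OF rhom_graded] graded_lin_form coeff_monom_mult)

lemma sum_monom: "(\<Sum>k\<in>I. Polynomial.monom (f k) n) = Polynomial.monom (\<Sum>k\<in>I. f k) n"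
  by (rule poly_eqI) (simp add: coeff_sum)

lemma graded_hcomp: "graded (hcomp e f) = Polynomial.monom (hcomp e f) e"
proof (induction f arbitrary: e rule: mpol_induct)
  case (mult f g)
  interpret g: rhom graded by (rule rhom_graded)
  have "graded (hcomp e (f * g)) = (\<Sum>k\<le>e. Polynomial.monom (hcomp k f * hcomp (e - k) g) (k + (e - k)))"
    by (simp add: hcomp_mult mult mult_monom)
  also have "\<dots> = (\<Sum>k\<le>e. Polynomial.monom (hcomp k f * hcomp (e - k) g) e)"
    by (rule sum.cong) auto
  finally show ?case by (simp add: hcomp_mult sum_monom)
next
  case (add f g)
  then show ?case by (simp add: hcomp_add rhom.add[OF rhom_graded] add_monom)
qed (simp_all add: hcomp_Const hcomp_Var rhom.zero[OF rhom_graded] monom_0)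

lemma hcomp_hcomp: "hcomp d (hcomp e f) = (if d = e then hcomp e f else 0)"
  by (subst hcomp_def) (simp add: graded_hcomp)

text \<open>A common denominator \<open>D\<close> of the finitely many coefficients turns a relation
  over the fraction field into one over the ring.\<close>

lemma form_dependent_if_dependent:
  fixes B :: "('a::idom fract ^ 'n::finite) set"
  assumes "vec.dependent B"
  shows "form.dependent B"
proof -
  obtain t u where t: "finite t" "t \<subseteq> B" "(\<Sum>v\<in>t. u v *s v) = 0" "\<exists>v\<in>t. u v \<noteq> 0"
    using assms by (auto simp: vec.dependent_explicit)
  have "\<exists>D. D \<noteq> 0 \<and> (\<forall>v\<in>t. \<exists>c. Fract D 1 * u v = Fract c 1)"
    using t(1)
  proof (induction t)
    case empty
    then show ?case by (auto intro: exI[of _ 1])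
  next
    case (insert w t)
    then obtain D where D: "D \<noteq> 0" "\<forall>v\<in>t. \<exists>c. Fract D 1 * u v = Fract c 1" by auto
    obtain a d where ad: "u w = Fract a d" "d \<noteq> 0" by (cases "u w") auto
    have "\<exists>c. Fract (d * D) 1 * u v = Fract c 1" if v: "v \<in> t" for v
    proof -
      obtain c where c: "Fract D 1 * u v = Fract c 1" using D(2) v by auto
      have "Fract (d * D) 1 * u v = Fract d 1 * (Fract D 1 * u v)"
        by (simp flip: mult.assoc)
      also have "\<dots> = Fract (d * c) 1" unfolding c by simp
      finally show ?thesis by blast
    qed
    moreover have "Fract (d * D) 1 * u w = Fract (D * a) 1"
      using ad by (simp add: eq_fract mult_ac)
    ultimately show ?case using D(1) ad(2) by (intro exI[of _ "d * D"]) auto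
  qed
  then obtain D c where D: "D \<noteq> 0" "\<And>v. v \<in> t \<Longrightarrow> Fract D 1 * u v = Fract (c v) 1"
    by metis
  have "(\<Sum>v\<in>t. form_scale (c v) v) = Fract D 1 *s (\<Sum>v\<in>t. u v *s v)"
    by (simp add: vec.scale_sum_right form_scale_def D(2) cong: sum.cong)
  then have "(\<Sum>v\<in>t. form_scale (c v) v) = 0" using t(3) by simp
  moreover have "\<exists>v\<in>t. c v \<noteq> 0"
  proof -
    obtain v where v: "v \<in> t" "u v \<noteq> 0" using t(4) by blast
    then have "Fract (c v) 1 \<noteq> 0"
      using D(1) D(2)[OF v(1)] by (metis Zero_fract_def eq_fract(1) mult_eq_0_iff mult_1_right zero_neq_one)
    then have "c v \<noteq> 0" by (metis Zero_fract_def)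
    then show ?thesis using v(1) by blast
  qed
  ultimately show ?thesis using t(1,2) unfolding form.dependent_explicit by blast
qed

text \<open>Contraction with the Euler derivation, the sum of x_i times the i-th partial derivative;
  it sends each dc back to the linear form c.\<close>

definition euler :: "('k::field, 'n::finite) mpol ^ 'n \<Rightarrow> ('k, 'n) mpol" where
  "euler \<eta> = (\<Sum>i\<in>UNIV. \<eta> $ i * Var i)"

lemma euler_add: "euler (\<eta> + \<zeta>) = euler \<eta> + euler \<zeta>"
  by (simp add: euler_def ring_distribs sum.distrib)

lemma euler_scale: "euler (r *s \<eta>) = r * euler \<eta>"
  by (simp add: euler_def sum_distrib_left mult_ac)

lemma euler_dform: "euler (dform c) = lin_form c"
  by (simp add: euler_def dform_def lin_form_altdef flip: Const_def)

section \<open>Generators of logarithmic forms and their polynomial pairings\<close>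

context arr
begin

abbreviation "Q \<equiv> arr_poly \<alpha> A"
abbreviation "N \<equiv> log_numerators \<alpha> A"

lemma Q_nonzero: "Q \<noteq> 0"
  using finite_A alpha_nonzero by (auto simp: arr_poly_def)

text \<open>The quotient matrix is alternating because \<open>\<alpha> L\<close> is nonzero in a
  domain. Its diagonal is treated separately, since antisymmetry alone does not make it vanish in
  characteristic 2.\<close>

lemma log_forms_eq: "log_forms \<alpha> A = (\<lambda>\<eta>. \<chi> i. Fract (\<eta> $ i) Q) ` N"
proof -
  have "(\<exists>\<mu>\<in>two_forms. wedge \<eta> (dform (\<alpha> L)) = (\<chi> i j. lin_form (\<alpha> L) * \<mu> $ i $ j)) \<longleftrightarrow>
      (\<forall>i j. lin_form (\<alpha> L) dvd \<eta> $ i * Const (\<alpha> L $ j) - \<eta> $ j * Const (\<alpha> L $ i))"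
    (is "?l \<longleftrightarrow> ?r") if L: "L \<in> A" for L \<eta>
  proof
    assume ?l
    then obtain \<mu> where "wedge \<eta> (dform (\<alpha> L)) = (\<chi> i j. lin_form (\<alpha> L) * \<mu> $ i $ j)" by blast
    then have "wedge \<eta> (dform (\<alpha> L)) $ i $ j = lin_form (\<alpha> L) * \<mu> $ i $ j" for i j
      by simp
    then show ?r by (auto simp: wedge_def dform_def simp flip: Const_def)
  next
    assume ?r
    then obtain \<mu> where \<mu>: "\<And>i j. \<eta> $ i * Const (\<alpha> L $ j) - \<eta> $ j * Const (\<alpha> L $ i) = lin_form (\<alpha> L) * \<mu> i j"
      unfolding dvd_def by metis
    have nz: "lin_form (\<alpha> L) \<noteq> 0" using alpha_nonzero[OF L] by simp
    have "\<mu> i i = 0" for i using \<mu>[of i i] nz by simp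
    moreover have "\<mu> i j = - \<mu> j i" for i j
    proof -
      have "lin_form (\<alpha> L) * (\<mu> i j + \<mu> j i) = 0"
        unfolding distrib_left \<mu>[symmetric] by simp
      then have "\<mu> i j + \<mu> j i = 0" using nz mult_eq_0_iff by blast
      then show ?thesis by (rule eq_neg_iff_add_eq_0[THEN iffD2])
    qed
    ultimately have "(\<chi> i j. \<mu> i j) \<in> two_forms"
      unfolding two_forms_def vec_lambda_beta mem_Collect_eq by blast
    moreover have "wedge \<eta> (dform (\<alpha> L)) $ i $ j = lin_form (\<alpha> L) * \<mu> i j" for i j
      unfolding \<mu>[symmetric] by (simp add: wedge_def dform_def flip: Const_def)
    then have "wedge \<eta> (dform (\<alpha> L)) = (\<chi> i j. lin_form (\<alpha> L) * (\<chi> i j. \<mu> i j) $ i $ j)"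
      by (simp add: vec_eq_iff)
    ultimately show ?l by blast
  qed
  then show ?thesis
    unfolding log_forms_def log_numerators_def by auto
qed

text \<open>A basis over S is independent over the fraction field, so it has at most l elements; it
  is pulled back along the injective map dividing numerators by \<open>Q\<close>.\<close>

lemma free_generators:
  assumes "free_arrangement \<alpha> A"
  shows "\<exists>B\<subseteq>N. finite B \<and> card B \<le> CARD('n) \<and> (\<forall>\<eta>\<in>N. \<exists>r. \<eta> = (\<Sum>b\<in>B. r b *s b))"
proof -
  define \<phi> :: "(('k, 'n) mpol, 'n) vec \<Rightarrow> (('k, 'n) mpol fract, 'n) vec" where "\<phi> = (\<lambda>\<eta>. \<chi> i. Fract (\<eta> $ i) Q)"
  obtain C where C: "form.independent C" "form.span C = log_forms \<alpha> A"
    using assms by (auto simp: free_arrangement_def)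
  have "vec.independent C" using C(1) form_dependent_if_dependent by blast
  then have fin: "finite C" and "vec.dim C = card C"
    by (rule vec.finiteI_independent, rule vec.dim_eq_card_independent)
  then have card: "card C \<le> CARD('n)"
    using vec.dim_subset[OF subset_UNIV[of C]] unfolding vec_dim_card by simp
  have inj: "inj \<phi>"
    using Q_nonzero by (auto simp: inj_def \<phi>_def vec_eq_iff eq_fract)
  have \<phi>_add: "\<phi> (x + y) = \<phi> x + \<phi> y" for x y
    using Q_nonzero by (simp add: \<phi>_def vec_eq_iff eq_fract algebra_simps)
  have \<phi>_0: "\<phi> 0 = 0" using Q_nonzero by (simp add: \<phi>_def vec_eq_iff Zero_fract_def eq_fract)
  have \<phi>_scale: "\<phi> (r *s x) = form_scale r (\<phi> x)" for r x
    by (simp add: \<phi>_def vec_eq_iff form_scale_def)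
  have \<phi>_sum: "\<phi> (sum g I) = (\<Sum>i\<in>I. \<phi> (g i))" for g :: "(('k, 'n) mpol, 'n) vec \<Rightarrow> (('k, 'n) mpol, 'n) vec" and I
    by (induction I rule: infinite_finite_induct) (auto simp: \<phi>_0 \<phi>_add)
  define B where "B = {\<eta> \<in> N. \<phi> \<eta> \<in> C}"
  have lf: "log_forms \<alpha> A = \<phi> ` N" unfolding log_forms_eq \<phi>_def ..
  have CB: "C = \<phi> ` B"
    using C(2) form.span_superset[of C] lf by (auto simp: B_def)
  have injB: "inj_on \<phi> B" using inj by (rule inj_on_subset) simp
  show ?thesis
  proof (intro exI[of _ B] conjI ballI)
    show "finite B" using fin injB by (simp add: CB finite_image_iff)
    show "card B \<le> CARD('n)" using card injB by (simp add: CB card_image)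
    show "B \<subseteq> N" by (auto simp: B_def)
    fix \<eta> assume "\<eta> \<in> N"
    then have "\<phi> \<eta> \<in> form.span C" using C(2) lf by auto
    then obtain u where "\<phi> \<eta> = (\<Sum>v\<in>C. form_scale (u v) v)"
      by (auto simp: form.span_finite[OF fin])
    also have "\<dots> = (\<Sum>b\<in>B. form_scale (u (\<phi> b)) (\<phi> b))"
      unfolding CB by (simp add: sum.reindex[OF injB])
    also have "\<dots> = \<phi> (\<Sum>b\<in>B. u (\<phi> b) *s b)"
      by (simp add: \<phi>_sum \<phi>_scale)
    finally have "\<eta> = (\<Sum>b\<in>B. u (\<phi> b) *s b)" by (rule injD[OF inj])
    then show "\<exists>r. \<eta> = (\<Sum>b\<in>B. r b *s b)" by (rule exI[of _ "\<lambda>b. u (\<phi> b)"])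
  qed
qed

lemma Q_dvd:
  assumes "\<And>L. L \<in> A \<Longrightarrow> lin_form (\<alpha> L) dvd x"
  shows "Q dvd x"
proof -
  have subspace_ideal: "y \<in> subspace_ideal L \<longleftrightarrow> lin_form (\<alpha> L) dvd y" if "L \<in> A" for L y
    using subspace_ideal_hyperplane[of y "\<alpha> L"] hyperplane_eq[OF that] by simp
  have "\<exists>w. 0 dvd x - (\<Prod>L\<in>A. lin_form (\<alpha> L)) * w"
  proof (rule prod_of_prime_ideals[where Pr = subspace_ideal])
    fix L L' assume L: "L \<in> A" "L' \<in> A" "L \<noteq> L'"
    then show "lin_form (\<alpha> L') \<notin> subspace_ideal L" using alpha_in_subspace_ideal_iff hyperplane_subset by auto
  next
    fix L y assume "L \<in> A"
    then show "y \<in> subspace_ideal L \<longleftrightarrow> (\<exists>u w. y = 0 * u + lin_form (\<alpha> L) * w)" using subspace_ideal by (auto simp: dvd_def)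
  qed (use finite_A is_prime_subspace_ideal subspace_ideal assms in auto)
  then show ?thesis by (auto simp: arr_poly_def dvd_def)
qed

lemma dvd_Const_cancel: "c \<noteq> 0 \<Longrightarrow> a dvd x * Const c \<Longrightarrow> a dvd x" for a x :: "('k, 'n) mpol"
  using dvd_mult2[of a "x * Const c" "Const (inverse c)"]
  by (simp add: mult.assoc flip: Const.mult)

lemma Q_dvd_contract:
  assumes "\<eta> \<in> N" "v \<in> \<Inter>A"
  shows "Q dvd contract \<eta> v"
proof (rule Q_dvd)
  fix L assume L: "L \<in> A"
  then obtain w where w: "lin_eval (\<alpha> L) w = 1"
    using separating_form[of "\<alpha> L" "{}"] alpha_nonzero by auto
  have "lin_eval (\<alpha> L) v = 0" using assms(2) L mem_iff by auto
  then show "lin_form (\<alpha> L) dvd contract \<eta> v"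
    using contract_wedge[OF assms(1) L, of v w] w by simp
qed

text \<open>Contracting the wedge with \<open>d\<alpha>_L\<close> by the Euler derivation leaves
  \<open>euler \<eta>\<close> times \<open>d\<alpha>_L\<close>, up to a multiple of
  \<open>\<alpha> L\<close>; a nonzero entry of \<open>\<alpha> L\<close> is then cancelled.\<close>

lemma Q_dvd_euler:
  assumes "\<eta> \<in> N"
  shows "Q dvd euler \<eta>"
proof (rule Q_dvd)
  fix L assume L: "L \<in> A"
  obtain j where j: "\<alpha> L $ j \<noteq> 0" using alpha_nonzero[OF L] by (auto simp: vec_eq_iff)
  have "euler \<eta> * Const (\<alpha> L $ j) = (\<Sum>i\<in>UNIV. Var i * (\<eta> $ i * Const (\<alpha> L $ j) - \<eta> $ j * Const (\<alpha> L $ i)))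
      + lin_form (\<alpha> L) * \<eta> $ j"
    by (simp add: euler_def lin_form_altdef sum_distrib_left sum_distrib_right algebra_simps sum_subtractf)
  also have "lin_form (\<alpha> L) dvd \<dots>"
    by (rule dvd_add[OF dvd_sum dvd_triv_left], rule dvd_mult)
      (use assms L in \<open>auto simp: log_numerators_def\<close>)
  finally show "lin_form (\<alpha> L) dvd euler \<eta>" by (rule dvd_Const_cancel[OF j])
qed

text \<open>A relation, as a residue lifted to S is determined only modulo
  \<open>aH\<close>.\<close>

definition is_res :: "(('k, 'n) mpol, 'n) vec \<Rightarrow> ('k, 'n) mpol \<Rightarrow> bool" where
  "is_res \<eta> f \<longleftrightarrow> (\<forall>v. aH dvd contract \<eta> v - Const (lin_eval (\<alpha> H) v) * Qb * f)"

lemma Qb_notin: "Qb \<notin> subspace_ideal H"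
  using is_prime_prod[OF is_prime_subspace_ideal, of "\<lambda>Y. lin_form (\<beta> Y)" "restriction A H" H]
    beta_in_subspace_ideal_iff restriction_neq unfolding arr_poly_def by auto

lemma aH_prime: "f \<in> subspace_ideal H \<longleftrightarrow> aH dvd f"
  using subspace_ideal_hyperplane[of f "\<alpha> H"] hyperplane_eq[OF H_in] by simp

lemma aH_dvd_cancel: "aH dvd Qb * f \<Longrightarrow> aH dvd f"
  using is_prime_subspace_ideal[of H] Qb_notin unfolding is_prime_def aH_prime by blast

lemma is_res_unique:
  assumes "is_res \<eta> f" "is_res \<eta> g"
  shows "aH dvd f - g"
proof -
  obtain \<theta> where \<theta>: "lin_eval (\<alpha> H) \<theta> = 1" by (rule transversal_vector)
  have "aH dvd (contract \<eta> \<theta> - Const 1 * Qb * g) - (contract \<eta> \<theta> - Const 1 * Qb * f)"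
    using assms \<theta> unfolding is_res_def by (metis dvd_diff)
  then have "aH dvd Qb * (f - g)" by (simp add: algebra_simps)
  then show ?thesis by (rule aH_dvd_cancel)
qed

lemma is_res_combine: "is_res \<eta> f \<Longrightarrow> is_res \<zeta> g \<Longrightarrow> is_res (r *s \<eta> + \<zeta>) (r * f + g)"
  unfolding is_res_def
proof clarify
  fix v
  assume *: "\<forall>v. aH dvd contract \<eta> v - Const (lin_eval (\<alpha> H) v) * Qb * f"
    "\<forall>v. aH dvd contract \<zeta> v - Const (lin_eval (\<alpha> H) v) * Qb * g"
  have "aH dvd r * (contract \<eta> v - Const (lin_eval (\<alpha> H) v) * Qb * f)
      + (contract \<zeta> v - Const (lin_eval (\<alpha> H) v) * Qb * g)"
    using * by (intro dvd_add dvd_mult) auto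
  then show "aH dvd contract (r *s \<eta> + \<zeta>) v - Const (lin_eval (\<alpha> H) v) * Qb * (r * f + g)"
    by (simp add: contract_add contract_scale algebra_simps)
qed

lemma is_res_0: "is_res 0 0"
  by (simp add: is_res_def)

lemma is_res_exists: "\<eta> \<in> N \<Longrightarrow> \<exists>f. is_res \<eta> f"
  by (meson is_res_def residue_exists)

lemma J_eq: "f \<in> J \<longleftrightarrow> (\<exists>\<eta>\<in>N. is_res \<eta> f)"
  by (auto simp: residue_lift_def is_res_def)

definition mN :: "(('k, 'n) mpol, 'n) vec set" where
  "mN = {r *s \<eta> | r \<eta>. const_term r = 0 \<and> \<eta> \<in> N}"

text \<open>Products with the irrelevant ideal, without their sums, since only the span over the
  field is taken. The multiples of \<open>aH\<close> have arbitrary cofactors because they absorb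
  the ambiguity of lifted residues.\<close>

definition mJ :: "('k, 'n) mpol set" where
  "mJ = {r * f | r f. const_term r = 0 \<and> f \<in> J} \<union> {aH * u | u. True}"

text \<open>Modulo \<open>mN\<close>, the forms \<open>dz\<^sub>j\<close> (for coordinates on \<open>Z\<close>) and \<open>d\<alpha>\<^sub>L / \<alpha>\<^sub>L\<close> are dual to the derivations
  \<open>\<partial>\<^sub>v\<^sub>j\<close> and the Euler derivation, which pair \<open>\<Omega>\<^sup>1(A)\<close> with values in \<open>S\<close>; and their residues along \<open>H\<close> vanish.\<close>

lemma residue_free_forms:
  assumes D: "dual_basis Z s v z" and Z: "Z \<subseteq> \<Inter>A" and L: "L \<in> A" "L \<noteq> H"
  shows "\<exists>E\<subseteq>N. finite E \<and> card E = s + 1 \<and> (\<forall>e\<in>E. is_res e 0) \<and>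
    (\<forall>e\<in>E. e \<notin> forms.span (E - {e} \<union> mN))"
proof -
  define QL where "QL = arr_poly \<alpha> (A - {L})"
  have QL: "Q = lin_form (\<alpha> L) * QL"
    unfolding arr_poly_def QL_def using L finite_A by (subst prod.remove[of _ L]) auto
  \<comment> \<open>Numerators over \<open>Q\<close>: \<open>Q dz_j\<close> stands for dz_j, and at
    the index \<open>s\<close> the form \<open>QL d\<alpha>_L\<close> stands for
    \<open>d\<alpha>_L/\<alpha>_L\<close>.\<close>
  define e where "e j = (if j < s then Q *s dform (z j) else QL *s dform (\<alpha> L))" for j
  define \<Lambda> where "\<Lambda> j \<eta> = (if j < s then contract \<eta> (v j) else euler \<eta>)" for j \<eta>
  \<comment> \<open>The kernel of the j-th pairing followed by the constant term. It contains
    \<open>mN\<close> and every \<open>e i\<close> except \<open>e j\<close>, which gives the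
    independence.\<close>
  define W where "W j = {\<eta>. \<exists>q. \<Lambda> j \<eta> = Q * q \<and> const_term q = 0}" for j
  interpret c: rhom "const_term :: ('k, 'n) mpol \<Rightarrow> 'k" by (rule rhom_const_term)
  have \<Lambda>_add: "\<Lambda> j (\<eta> + \<zeta>) = \<Lambda> j \<eta> + \<Lambda> j \<zeta>" and \<Lambda>_scale: "\<Lambda> j (r *s \<eta>) = r * \<Lambda> j \<eta>" for j \<eta> \<zeta> r
    by (simp_all add: \<Lambda>_def contract_add euler_add contract_scale euler_scale)
  have sub: "forms.subspace (W j)" for j
    unfolding forms.subspace_def
  proof (intro conjI ballI allI)
    show "0 \<in> W j" using \<Lambda>_scale[of j 0 0] by (auto simp: W_def intro!: exI[of _ 0])
    fix x y assume "x \<in> W j" "y \<in> W j"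
    then obtain p q where "\<Lambda> j x = Q * p" "const_term p = 0" "\<Lambda> j y = Q * q" "const_term q = 0"
      by (auto simp: W_def)
    then show "x + y \<in> W j" by (auto simp: W_def \<Lambda>_add algebra_simps intro!: exI[of _ "p + q"])
  next
    fix a x assume "x \<in> W j"
    then obtain p where "\<Lambda> j x = Q * p" "const_term p = 0" by (auto simp: W_def)
    then show "Const a *s x \<in> W j" by (auto simp: W_def \<Lambda>_scale algebra_simps intro!: exI[of _ "Const a * p"])
  qed
  have vZ: "v j \<in> \<Inter>A" if "j < s" for j
    using D Z that unfolding dual_basis_def by blast
  have mN_W: "mN \<subseteq> W j" for j
  proof
    fix x assume "x \<in> mN"
    then obtain r \<eta> where x: "x = r *s \<eta>" "const_term r = 0" "\<eta> \<in> N" by (auto simp: mN_def)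
    have "Q dvd \<Lambda> j \<eta>"
      unfolding \<Lambda>_def using Q_dvd_contract[OF x(3) vZ] Q_dvd_euler[OF x(3)] by auto
    then obtain q where "\<Lambda> j \<eta> = Q * q" by (auto simp: dvd_def)
    then show "x \<in> W j" using x by (auto simp: W_def \<Lambda>_scale algebra_simps intro!: exI[of _ "r * q"])
  qed
  have aL: "lin_eval (\<alpha> L) (v j) = 0" if "j < s" for j
    using vZ[OF that] L mem_iff by auto
  \<comment> \<open>The matrix of pairings is the identity modulo the irrelevant ideal, but not
    exactly: the Euler derivation sends dz_i to z_i, whose constant term is 0.\<close>
  have val: "\<exists>q. \<Lambda> j (e i) = Q * q \<and> const_term q = (if i = j then 1 else 0)" if "i \<le> s" "j \<le> s" for i j
  proof (cases "i < s"; cases "j < s")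
    assume "i < s" "j < s"
    then show ?thesis
      using D by (auto simp: \<Lambda>_def e_def contract_scale contract_dform dual_basis_def dual_family_def
          intro!: exI[of _ "Const (lin_eval (z i) (v j))"])
  next
    assume "i < s" "\<not> j < s"
    then show ?thesis
      by (auto simp: \<Lambda>_def e_def euler_scale euler_dform intro!: exI[of _ "lin_form (z i)"])
  next
    assume "\<not> i < s" "j < s"
    then show ?thesis
      using aL[of j] by (auto simp: \<Lambda>_def e_def contract_scale contract_dform intro!: exI[of _ 0])
  next
    assume "\<not> i < s" "\<not> j < s"
    then show ?thesis
      using that by (auto simp: \<Lambda>_def e_def euler_scale euler_dform QL intro!: exI[of _ 1])
  qed
  have in_W: "e i \<in> W j" if "i \<le> s" "j \<le> s" "i \<noteq> j" for i j
    using val[OF that(1,2)] that(3) by (auto simp: W_def)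
  have notin_W: "e j \<notin> W j" if j: "j \<le> s" for j
  proof
    assume "e j \<in> W j"
    then obtain q where q: "\<Lambda> j (e j) = Q * q" "const_term q = 0" by (auto simp: W_def)
    obtain p where p: "\<Lambda> j (e j) = Q * p" "const_term p = 1" using val[OF j j] by auto
    have "Q * p = Q * q" using p(1) q(1) by metis
    then have "p = q" using Q_nonzero mult_left_cancel by blast
    then show False using p q by simp
  qed
  have inj: "inj_on e {..s}"
    by (rule inj_onI, rule ccontr) (use in_W notin_W in \<open>metis atMost_iff\<close>)
  have dvdQ: "lin_form (\<alpha> L') dvd Q" if "L' \<in> A" for L'
    unfolding arr_poly_def using that finite_A by (intro dvd_prodI) auto
  have dvdQL: "lin_form (\<alpha> L') dvd QL" if "L' \<in> A" "L' \<noteq> L" for L'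
    unfolding QL_def arr_poly_def using that finite_A by (intro dvd_prodI) auto
  have N1: "Q *s dform c \<in> N" for c
    by (rule log_numerators_scale) (use dvdQ in blast)
  have "dform (\<alpha> L) \<in> log_numerators \<alpha> {L}"
    by (simp add: log_numerators_def dform_def mult.commute flip: Const_def)
  then have N2: "QL *s dform (\<alpha> L) \<in> N"
    by (intro log_numerators_scale) (use dvdQL in blast)
  show ?thesis
  proof (intro exI[of _ "e ` {..s}"] conjI ballI)
    show "finite (e ` {..s})" by simp
    show "card (e ` {..s}) = s + 1" using inj by (simp add: card_image)
    show "e ` {..s} \<subseteq> N" using N1 N2 by (auto simp: e_def)
    show "is_res x 0" if "x \<in> e ` {..s}" for x
      using that dvdQ[OF H_in] dvdQL[OF H_in] L(2)
      by (auto simp: e_def is_res_def contract_scale)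
    show "x \<notin> forms.span (e ` {..s} - {x} \<union> mN)" if x: "x \<in> e ` {..s}" for x
    proof -
      obtain j where j: "j \<le> s" "x = e j" using x by auto
      have "e ` {..s} - {x} \<union> mN \<subseteq> W j" using in_W[OF _ j(1)] mN_W j by auto
      then have "forms.span (e ` {..s} - {x} \<union> mN) \<subseteq> W j" by (rule forms.span_minimal[OF _ sub])
      then show ?thesis using notin_W[OF j(1)] j(2) by auto
    qed
  qed
qed

lemma N_spanned:
  assumes B: "B \<subseteq> N" and gen: "\<And>\<eta>. \<eta> \<in> N \<Longrightarrow> \<exists>r. \<eta> = (\<Sum>b\<in>B. r b *s b)"
  shows "N \<subseteq> forms.span (B \<union> mN)"
proof
  fix \<eta> assume "\<eta> \<in> N"
  then obtain r where r: "\<eta> = (\<Sum>b\<in>B. r b *s b)" using gen by blast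
  interpret c: rhom "const_term :: ('k, 'n) mpol \<Rightarrow> 'k" by (rule rhom_const_term)
  have "r b *s b \<in> forms.span (B \<union> mN)" if b: "b \<in> B" for b
  proof -
    have "(r b - Const (const_term (r b))) *s b \<in> mN"
      using B b by (auto simp: mN_def intro!: exI[of _ "r b - Const (const_term (r b))"])
    then have "Const (const_term (r b)) *s b + (r b - Const (const_term (r b))) *s b \<in> forms.span (B \<union> mN)"
      using b by (intro forms.span_add forms.span_scale forms.span_base) auto
    then show ?thesis by (simp flip: vector_sadd_rdistrib)
  qed
  then show "\<eta> \<in> forms.span (B \<union> mN)" unfolding r by (rule forms.span_sum)
qed

text \<open>Residues are additive and S-linear up to multiples of \<open>aH\<close>, so
  \<open>E\<close> contributes nothing and the part in \<open>mN\<close> lands in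
  \<open>mJ\<close>.\<close>

lemma J_spanned:
  assumes N: "N \<subseteq> forms.span (E \<union> F \<union> mN)" and E: "\<And>e. e \<in> E \<Longrightarrow> is_res e 0"
    and F: "\<And>x. x \<in> F \<Longrightarrow> is_res x (rs x)"
  shows "J \<subseteq> mpol.span (rs ` F \<union> mJ)"
proof
  fix f assume "f \<in> J"
  then obtain \<eta> where \<eta>: "\<eta> \<in> N" "is_res \<eta> f" by (auto simp: J_eq)
  have "\<exists>g \<in> mpol.span (rs ` F \<union> mJ). is_res \<zeta> g" if "\<zeta> \<in> forms.span (E \<union> F \<union> mN)" for \<zeta>
    using that
  proof (induction rule: forms.span_induct_alt)
    case base
    then show ?case using is_res_0 mpol.span_zero by blast
  next
    case (step c x y)
    then obtain g where g: "g \<in> mpol.span (rs ` F \<union> mJ)" "is_res y g" by blast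
    have "\<exists>h \<in> mpol.span (rs ` F \<union> mJ). is_res x h"
    proof -
      consider "x \<in> E" | "x \<in> F" | "x \<in> mN" using step(1) by blast
      then show ?thesis
      proof cases
        case 1
        then show ?thesis using E mpol.span_zero by blast
      next
        case 2
        then have "rs x \<in> mpol.span (rs ` F \<union> mJ)" by (intro mpol.span_base) auto
        then show ?thesis using F[OF 2] by blast
      next
        case 3
        then obtain r \<eta>' where x: "x = r *s \<eta>'" "const_term r = 0" "\<eta>' \<in> N" by (auto simp: mN_def)
        then obtain h where h: "is_res \<eta>' h" using is_res_exists by blast
        then have "h \<in> J" using x(3) J_eq by blast
        then have "r * h \<in> mJ" using x(2) by (auto simp: mJ_def)
        moreover have "is_res x (r * h)" using is_res_combine[OF h is_res_0, of r] x(1) by simp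
        moreover have "r * h \<in> mpol.span (rs ` F \<union> mJ)" if "r * h \<in> mJ"
          using that by (intro mpol.span_base) auto
        ultimately show ?thesis by blast
      qed
    qed
    then obtain h where "h \<in> mpol.span (rs ` F \<union> mJ)" "is_res x h" by blast
    then show ?case
      using g is_res_combine[of x h y g "Const c"] mpol.span_add mpol.span_scale by blast
  qed
  then obtain g where g: "g \<in> mpol.span (rs ` F \<union> mJ)" "is_res \<eta> g" using N \<eta>(1) by blast
  then have "f - g \<in> mJ" using is_res_unique[OF \<eta>(2) g(2)] by (auto simp: mJ_def dvd_def)
  then have "f - g \<in> mpol.span (rs ` F \<union> mJ)"
    by (intro mpol.span_base) simp
  then have "g + (f - g) \<in> mpol.span (rs ` F \<union> mJ)"
    by (rule mpol.span_add[OF g(1)])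
  then show "f \<in> mpol.span (rs ` F \<union> mJ)" by simp
qed

text \<open>Induction on the degree: in a product \<open>r * f'\<close> without constant term in
  \<open>r\<close>, the component of degree \<open>d\<close> involves only components of
  \<open>f'\<close> of smaller degree. Homogeneity of \<open>G\<close> keeps the components of its
  elements in \<open>I\<close>.\<close>

lemma graded_nakayama:
  assumes I: "is_ideal I" and "aH \<in> I" and "G \<subseteq> I"
    and hom: "\<And>g. g \<in> G \<Longrightarrow> \<exists>e. g = hcomp e g"
    and J: "J \<subseteq> mpol.span (G \<union> mJ)"
  shows "J \<subseteq> I"
proof -
  have *: "hcomp d f \<in> I" if "f \<in> J" for d f
    using that
  proof (induction d arbitrary: f rule: less_induct)
    case (less d)
    have "hcomp d x \<in> I" if "x \<in> mpol.span (G \<union> mJ)" for x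
      using that
    proof (induction rule: mpol.span_induct_alt)
      case base
      then show ?case using I by (simp add: is_idealD)
    next
      case (step c x y)
      have "hcomp d x \<in> I"
      proof -
        consider "x \<in> G" | u where "x = aH * u" | r f' where "x = r * f'" "const_term r = 0" "f' \<in> J"
          using step(1) by (auto simp: mJ_def)
        then show ?thesis
        proof cases
          case 1
          then obtain e where "x = hcomp e x" using hom by blast
          then have "hcomp d x = (if d = e then x else 0)" using hcomp_hcomp[of d e x] by simp
          then show ?thesis using 1 assms(3) I by (auto simp: is_idealD)
        next
          case 2
          then have "aH dvd hcomp d x" using hcomp_lin_form_mult by blast
          then show ?thesis using assms(2) I by (auto simp: dvd_def is_idealD)
        next
          case 3
          have "hcomp k r * hcomp (d - k) f' \<in> I" if "k \<le> d" for k
          proof (cases "k = 0")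
            case True
            then show ?thesis using 3 I by (simp add: hcomp_0 is_idealD)
          next
            case False
            then have "hcomp (d - k) f' \<in> I" using less.IH[of "d - k"] 3 that by simp
            then show ?thesis using I by (simp add: is_idealD)
          qed
          then show ?thesis unfolding 3 hcomp_mult using I by (intro is_ideal_sum) auto
        qed
      qed
      then show ?case using step(2) I by (simp add: hcomp_add hcomp_Const_mult is_idealD)
    qed
    then show ?case using J less.prems by blast
  qed
  show ?thesis
  proof
    fix f assume "f \<in> J"
    then have "(\<Sum>d\<le>Polynomial.degree (graded f). hcomp d f) \<in> I"
      using * by (intro is_ideal_sum[OF I])
    then show "f \<in> I" by (simp flip: sum_hcomp)
  qed
qed

theorem free_residue_generators:
  assumes D: "dual_basis Z s v z" and Z: "Z \<subseteq> \<Inter>A" and L: "L \<in> A" "L \<noteq> H"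
    and free: "free_arrangement \<alpha> A"
  obtains G where "finite G" "card G + s + 1 \<le> CARD('n)" "G \<subseteq> J"
    "\<And>I. is_ideal I \<Longrightarrow> aH \<in> I \<Longrightarrow> G \<subseteq> I \<Longrightarrow> J \<subseteq> I"
proof -
  obtain B where B: "finite B" "card B \<le> CARD('n)" "B \<subseteq> N" "\<And>\<eta>. \<eta> \<in> N \<Longrightarrow> \<exists>r. \<eta> = (\<Sum>b\<in>B. r b *s b)"
    using free_generators[OF free] by blast
  obtain E where E: "finite E" "card E = s + 1" "E \<subseteq> N" "\<And>e. e \<in> E \<Longrightarrow> is_res e 0"
    "\<And>e. e \<in> E \<Longrightarrow> e \<notin> forms.span (E - {e} \<union> mN)"
    using residue_free_forms[OF D Z L] by blast
  have N: "N \<subseteq> forms.span (B \<union> mN)" by (rule N_spanned[OF B(3,4)])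
  \<comment> \<open>The \<open>s + 1\<close> elements of \<open>E\<close> replace as many of the at
    most l generators, so at most l - 1 - s others remain.\<close>
  then obtain F where F: "F \<subseteq> B" "card F + card E \<le> card B" "B \<subseteq> forms.span (E \<union> F \<union> mN)"
    using forms.steinitz_modulo[OF E(1) B(1), of mN] E(3,5) by blast
  have finF: "finite F" using F(1) B(1) finite_subset by blast
  obtain rs where rs: "\<And>x. x \<in> N \<Longrightarrow> is_res x (rs x)" using is_res_exists by metis
  have "forms.span (B \<union> mN) \<subseteq> forms.span (E \<union> F \<union> mN)"
    by (rule forms.span_minimal) (use F(3) forms.span_superset[of "E \<union> F \<union> mN"] in auto)
  then have "N \<subseteq> forms.span (E \<union> F \<union> mN)" using N by blast
  moreover have FN: "F \<subseteq> N" using F(1) B(3) by blast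
  ultimately have J: "J \<subseteq> mpol.span (rs ` F \<union> mJ)"
    using E(4) rs by (intro J_spanned[of E F]) auto
  \<comment> \<open>The remaining residues may be inhomogeneous. Their components lie in
    \<open>J\<close>, and no more of them than there are residues suffice modulo
    \<open>mJ\<close>.\<close>
  define G0 where "G0 = (\<Union>f\<in>rs ` F. (\<lambda>d. hcomp d f) ` {..Polynomial.degree (graded f)})"
  have finG0: "finite G0" using finF by (auto simp: G0_def)
  have rsJ: "rs ` F \<subseteq> J" using FN rs J_eq by blast
  then have G0J: "G0 \<subseteq> J" using J_hcomp by (auto simp: G0_def)
  then obtain G where G: "G \<subseteq> G0" "card G \<le> card (rs ` F)" "G0 \<subseteq> mpol.span (G \<union> mJ)"
    using mpol.select_generators[OF finG0, of "rs ` F" mJ] J finF by auto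
  have "f \<in> mpol.span (G \<union> mJ)" if "f \<in> rs ` F" for f
  proof -
    have "(\<Sum>d\<le>Polynomial.degree (graded f). hcomp d f) \<in> mpol.span (G \<union> mJ)"
      by (rule mpol.span_sum) (use G(3) that in \<open>auto simp: G0_def\<close>)
    then show ?thesis by (simp flip: sum_hcomp)
  qed
  then have "rs ` F \<union> mJ \<subseteq> mpol.span (G \<union> mJ)"
    using mpol.span_superset[of "G \<union> mJ"] by auto
  then have JG: "J \<subseteq> mpol.span (G \<union> mJ)"
    using J mpol.span_minimal[OF _ mpol.subspace_span] by blast
  show thesis
  proof
    show "finite G" using G(1) finG0 finite_subset by blast
    show "card G + s + 1 \<le> CARD('n)"
      using G(2) card_image_le[OF finF, of rs] F(2) E(2) B(2) by simp
    show "G \<subseteq> J" using G(1) G0J by blast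
    fix I assume I: "is_ideal I" "aH \<in> I" "G \<subseteq> I"
    show "J \<subseteq> I"
    proof (rule graded_nakayama[OF I _ JG])
      fix g assume "g \<in> G"
      then obtain d f where "g = hcomp d f" using G(1) by (auto simp: G0_def)
      then show "\<exists>e. g = hcomp e g" using hcomp_hcomp[of d d f] by metis
    qed
  qed
qed

end

section \<open>Chains of primes over the ideal of a subspace\<close>

text \<open>Factoring the lowest power of \<open>x\<^sub>i\<close> out of a relation modulo \<open>P\<^sub>i\<close> leaves, modulo \<open>x\<^sub>i \<in> P\<^sub>i\<^sub>+\<^sub>1\<close>, a relation
  between \<open>x\<^sub>i\<^sub>+\<^sub>1, x\<^sub>i\<^sub>+\<^sub>2, \<dots>\<close> modulo \<open>P\<^sub>i\<^sub>+\<^sub>1\<close>.\<close>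

lemma chain_independent:
  fixes P :: "nat \<Rightarrow> ('k::field, 'n::finite) mpol set"
  assumes prime: "\<And>i. i \<le> t \<Longrightarrow> is_prime (P i)" and sub: "\<And>i. i < t \<Longrightarrow> P i \<subseteq> P (Suc i)"
    and x: "\<And>i. i < t \<Longrightarrow> x i \<in> P (Suc i) - P i" and "i \<le> t"
    and "finite M" "M \<noteq> {}" "\<And>m. m \<in> M \<Longrightarrow> c m \<noteq> 0"
    and "\<And>m m'. m \<in> M \<Longrightarrow> m' \<in> M \<Longrightarrow> (\<And>j. i \<le> j \<Longrightarrow> j < t \<Longrightarrow> m j = m' j) \<Longrightarrow> m = m'"
  shows "(\<Sum>m\<in>M. Const (c m) * (\<Prod>j=i..<t. x j ^ m j)) \<notin> P i"
  using assms(4-8)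
proof (induction i arbitrary: M rule: inc_induct)
  case base
  then obtain m where m: "m \<in> M" by blast
  \<comment> \<open>No variable is left, so any two exponents in \<open>M\<close> agree and the sum
    is a nonzero constant.\<close>
  then have "M = {m}" using base.prems(4) by fastforce
  moreover have "Const (c m) \<notin> P t"
  proof
    assume "Const (c m) \<in> P t"
    then have "Const (inverse (c m)) * Const (c m) \<in> P t"
      using is_idealD(3)[OF is_prime_ideal[OF prime[of t]]] by blast
    then show False
      using prime[of t] base.prems(3)[OF m] by (simp add: Const_inverse_mult is_prime_def)
  qed
  ultimately show ?case by simp
next
  case (step i)
  define e where "e = Min ((\<lambda>m. m i) ` M)"
  define M0 where "M0 = {m \<in> M. m i = e}"
  define R where "R = (\<Sum>m\<in>M - M0. Const (c m) * x i ^ (m i - e - 1) * (\<Prod>j=Suc i..<t. x j ^ m j))"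
  define S0 where "S0 = (\<Sum>m\<in>M0. Const (c m) * (\<Prod>j=Suc i..<t. x j ^ m j))"
  have e_le: "e \<le> m i" if "m \<in> M" for m
    using step.prems(1) that by (simp add: e_def)
  have "e \<in> (\<lambda>m. m i) ` M"
    unfolding e_def using step.prems by (intro Min_in) auto
  then have M0: "M0 \<noteq> {}" by (auto simp: M0_def)
  have "S0 \<notin> P (Suc i)"
    unfolding S0_def
  proof (rule step.IH)
    show "finite M0" using step.prems(1) by (simp add: M0_def)
    show "M0 \<noteq> {}" by (rule M0)
    show "c m \<noteq> 0" if "m \<in> M0" for m using that step.prems(3) by (simp add: M0_def)
    fix m m' assume m: "m \<in> M0" "m' \<in> M0" and eq: "\<And>j. Suc i \<le> j \<Longrightarrow> j < t \<Longrightarrow> m j = m' j"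
    show "m = m'"
    proof (rule step.prems(4))
      show "m \<in> M" "m' \<in> M" using m by (auto simp: M0_def)
      fix j assume "i \<le> j" "j < t"
      then show "m j = m' j" using eq[of j] m by (cases "j = i") (auto simp: M0_def)
    qed
  qed
  have split: "(\<Prod>j=i..<t. x j ^ m j) = x i ^ m i * (\<Prod>j=Suc i..<t. x j ^ m j)" for m
    using step.hyps by (simp add: prod.atLeast_Suc_lessThan)
  have "(\<Sum>m\<in>M. Const (c m) * (\<Prod>j=i..<t. x j ^ m j))
      = (\<Sum>m\<in>M0. Const (c m) * (\<Prod>j=i..<t. x j ^ m j)) + (\<Sum>m\<in>M - M0. Const (c m) * (\<Prod>j=i..<t. x j ^ m j))"
    using step.prems(1) by (subst sum.subset_diff[of M0]) (auto simp: M0_def add.commute)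
  also have "(\<Sum>m\<in>M0. Const (c m) * (\<Prod>j=i..<t. x j ^ m j)) = x i ^ e * S0"
    unfolding S0_def sum_distrib_left split by (rule sum.cong) (auto simp: M0_def mult_ac)
  also have "(\<Sum>m\<in>M - M0. Const (c m) * (\<Prod>j=i..<t. x j ^ m j)) = x i ^ e * (x i * R)"
    unfolding R_def sum_distrib_left split
  proof (rule sum.cong)
    fix m assume m: "m \<in> M - M0"
    then have "m i \<noteq> e" by (auto simp: M0_def)
    then have "e < m i" using e_le[of m] m by auto
    then have "m i = e + Suc (m i - e - 1)" by simp
    then have "x i ^ m i = x i ^ e * (x i * x i ^ (m i - e - 1))"
      by (metis power_Suc power_add)
    then show "Const (c m) * (x i ^ m i * (\<Prod>j=Suc i..<t. x j ^ m j))
      = x i ^ e * (x i * (Const (c m) * x i ^ (m i - e - 1) * (\<Prod>j=Suc i..<t. x j ^ m j)))"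
      by (simp only: mult_ac)
  qed simp
  finally have eq: "(\<Sum>m\<in>M. Const (c m) * (\<Prod>j=i..<t. x j ^ m j)) = x i ^ e * (S0 + x i * R)"
    by (simp add: distrib_left)
  show ?case
  proof
    assume "(\<Sum>m\<in>M. Const (c m) * (\<Prod>j=i..<t. x j ^ m j)) \<in> P i"
    then have "x i ^ e * (S0 + x i * R) \<in> P i" by (simp only: eq)
    moreover have "is_prime (P i)" using prime step.hyps by simp
    moreover have "x i ^ e \<notin> P i" using is_prime_power[OF \<open>is_prime (P i)\<close>] x[of i] step.hyps by blast
    ultimately have "S0 + x i * R \<in> P i" unfolding is_prime_def by blast
    then have "S0 + x i * R \<in> P (Suc i)" using sub[of i] step.hyps by blast
    moreover have I: "is_ideal (P (Suc i))" using prime[of "Suc i"] step.hyps is_prime_ideal by simp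
    moreover have "x i * R \<in> P (Suc i)" using x[of i] step.hyps is_idealD(4)[OF I] by blast
    ultimately have "S0 + x i * R - x i * R \<in> P (Suc i)" using is_idealD(6)[OF I] by blast
    then show False using \<open>S0 \<notin> P (Suc i)\<close> by simp
  qed
qed

section \<open>Algebraic dependence by counting monomials\<close>

lemma (in vector_space) dependent_family:
  assumes "finite I" "finite W" "card W < card I" "u ` I \<subseteq> span W"
  shows "\<exists>c. (\<Sum>i\<in>I. scale (c i) (u i)) = 0 \<and> (\<exists>i\<in>I. c i \<noteq> 0)"
proof (cases "inj_on u I")
  case True
  have "dependent (u ` I)"
  proof (rule ccontr)
    assume "independent (u ` I)"
    then have "card (u ` I) \<le> card W"
      using independent_span_bound[OF assms(2) _ assms(4)] by blast
    then show False using assms(3) True by (simp add: card_image)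
  qed
  then obtain g where g: "(\<Sum>w\<in>u ` I. scale (g w) w) = 0" "\<exists>w\<in>u ` I. g w \<noteq> 0"
    using assms(1) by (auto simp: dependent_finite)
  then have "(\<Sum>i\<in>I. scale (g (u i)) (u i)) = 0" by (simp add: sum.reindex[OF True])
  then show ?thesis using g(2) by (intro exI[of _ "\<lambda>i. g (u i)"]) auto
next
  case False
  then obtain i j where ij: "i \<in> I" "j \<in> I" "i \<noteq> j" "u i = u j" by (auto simp: inj_on_def)
  define c where "c k = (if k = i then 1 :: 'a else if k = j then -1 else 0)" for k
  have "(\<Sum>k\<in>I. scale (c k) (u k)) = (\<Sum>k\<in>{i, j}. scale (c k) (u k))"
    by (rule sum.mono_neutral_right) (use assms(1) ij in \<open>auto simp: c_def\<close>)
  also have "\<dots> = 0" using ij by (simp add: c_def)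
  finally show ?thesis using ij(1) by (intro exI[of _ c]) (auto simp: c_def)
qed

text \<open>Each exponent is bounded separately, so the number of spanning monomials is at most the
  plain power (D + 1)^s.\<close>

definition bounded_span :: "nat \<Rightarrow> (nat \<Rightarrow> 'k::field ^ 'n::finite) \<Rightarrow> nat \<Rightarrow> ('k, 'n) mpol set" where
  "bounded_span s z D = mpol.span ((\<lambda>k. \<Prod>j<s. lin_form (z j) ^ k j) ` PiE {..<s} (\<lambda>_. {..D}))"

lemma bounded_span_mono: "D \<le> D' \<Longrightarrow> bounded_span s z D \<subseteq> bounded_span s z D'"
  unfolding bounded_span_def by (intro mpol.span_mono image_mono PiE_mono) auto

lemma bounded_span_mult:
  assumes "a \<in> bounded_span s z D" "b \<in> bounded_span s z D'"
  shows "a * b \<in> bounded_span s z (D + D')"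
proof -
  have gen: "(\<Prod>j<s. lin_form (z j) ^ k j) * (\<Prod>j<s. lin_form (z j) ^ k' j) \<in> bounded_span s z (D + D')"
    if "k \<in> PiE {..<s} (\<lambda>_. {..D})" "k' \<in> PiE {..<s} (\<lambda>_. {..D'})" for k k'
  proof -
    let ?k = "\<lambda>j\<in>{..<s}. k j + k' j"
    have "(\<Prod>j<s. lin_form (z j) ^ k j) * (\<Prod>j<s. lin_form (z j) ^ k' j) = (\<Prod>j<s. lin_form (z j) ^ ?k j)"
      by (simp add: power_add prod.distrib)
    moreover have "?k \<in> PiE {..<s} (\<lambda>_. {..D + D'})"
      using that by (auto simp: PiE_iff intro!: add_mono)
    then have "(\<Prod>j<s. lin_form (z j) ^ ?k j) \<in> bounded_span s z (D + D')"
      unfolding bounded_span_def by (intro mpol.span_base imageI)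
    ultimately show ?thesis by (simp only:)
  qed
  have right: "g * b \<in> bounded_span s z (D + D')"
    if g: "g \<in> (\<lambda>k. \<Prod>j<s. lin_form (z j) ^ k j) ` PiE {..<s} (\<lambda>_. {..D})" for g
    using assms(2) unfolding bounded_span_def[of s z D']
  proof (induction rule: mpol.span_induct_alt)
    case base
    then show ?case by (simp add: bounded_span_def mpol.span_zero)
  next
    case (step c x y)
    have eq: "g * (Const c * x + y) = Const c * (g * x) + g * y" by (simp add: algebra_simps)
    have "g * x \<in> bounded_span s z (D + D')" using g step(1) gen by blast
    then show ?case
      using step(2) unfolding eq bounded_span_def by (intro mpol.span_add mpol.span_scale)
  qed
  show ?thesis
    using assms(1) unfolding bounded_span_def[of s z D]
  proof (induction rule: mpol.span_induct_alt)
    case base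
    then show ?case by (simp add: bounded_span_def mpol.span_zero)
  next
    case (step c x y)
    have eq: "(Const c * x + y) * b = Const c * (x * b) + y * b" by (simp add: algebra_simps)
    show ?case
      using step(2) right[OF step(1)] unfolding eq bounded_span_def
      by (intro mpol.span_add mpol.span_scale)
  qed
qed

lemma one_in_bounded_span: "1 \<in> bounded_span s z 0"
proof -
  have "(\<lambda>j\<in>{..<s}. 0) \<in> PiE {..<s} (\<lambda>_. {..0::nat})" by auto
  then have "(\<Prod>j<s. lin_form (z j) ^ (\<lambda>j\<in>{..<s}. 0) j) \<in> bounded_span s z 0"
    unfolding bounded_span_def by (intro mpol.span_base imageI)
  then show ?thesis by simp
qed

lemma bounded_span_power: "a \<in> bounded_span s z d \<Longrightarrow> n \<le> N \<Longrightarrow> a ^ n \<in> bounded_span s z (N * d)"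
proof (induction n arbitrary: N)
  case 0
  then show ?case using one_in_bounded_span bounded_span_mono[of 0 "N * d" s z] by auto
next
  case (Suc n)
  then obtain N' where "N = Suc N'" "n \<le> N'" by (cases N) auto
  then show ?case using bounded_span_mult[OF Suc.prems(1) Suc.IH[OF Suc.prems(1), of N']] by simp
qed

lemma bounded_span_prod:
  assumes "\<And>j. j < t \<Longrightarrow> f j \<in> bounded_span s z d"
  shows "(\<Prod>j<t. f j) \<in> bounded_span s z (t * d)"
  using assms
proof (induction t)
  case 0
  then show ?case by (simp add: one_in_bounded_span)
next
  case (Suc t)
  then show ?case
    using bounded_span_mult[of "\<Prod>j<t. f j" s z "t * d" "f t" d] by (simp add: add.commute)
qed

lemma rho_in_bounded_span: "\<exists>D. rho {..<s} v z f \<in> bounded_span s z D"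
proof (induction f rule: mpol_induct)
  case (Const a)
  have "Const a * 1 \<in> bounded_span s z 0"
    using one_in_bounded_span unfolding bounded_span_def by (rule mpol.span_scale)
  then show ?case by auto
next
  case (Var i)
  have "lin_form (z j) \<in> bounded_span s z 1" if j: "j < s" for j
  proof -
    let ?k = "\<lambda>l\<in>{..<s}. if l = j then 1 else 0 :: nat"
    have "?k \<in> PiE {..<s} (\<lambda>_. {..1})" by auto
    then have "(\<Prod>l<s. lin_form (z l) ^ ?k l) \<in> bounded_span s z 1"
      unfolding bounded_span_def by (intro mpol.span_base imageI)
    moreover have "(\<Prod>l<s. lin_form (z l) ^ ?k l) = (\<Prod>l<s. if l = j then lin_form (z j) else 1)"
      by (rule prod.cong) auto
    ultimately show ?thesis using j by simp
  qed
  then have "rho {..<s} v z (Var i) \<in> bounded_span s z 1"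
    unfolding rho_Var bounded_span_def by (intro mpol.span_sum mpol.span_scale) auto
  then show ?case by blast
next
  case (add f g)
  interpret r: rhom "rho {..<s} v z" by (rule rhom_rho)
  obtain D D' where "rho {..<s} v z f \<in> bounded_span s z D" "rho {..<s} v z g \<in> bounded_span s z D'"
    using add by blast
  then have "rho {..<s} v z f \<in> bounded_span s z (max D D')" "rho {..<s} v z g \<in> bounded_span s z (max D D')"
    using bounded_span_mono[of D "max D D'" s z] bounded_span_mono[of D' "max D D'" s z] by auto
  then have "rho {..<s} v z (f + g) \<in> bounded_span s z (max D D')"
    unfolding r.add bounded_span_def by (rule mpol.span_add)
  then show ?case by blast
next
  case (mult f g)
  interpret r: rhom "rho {..<s} v z" by (rule rhom_rho)
  show ?case using mult bounded_span_mult unfolding r.mult by blast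
qed

text \<open>There are \<open>(N + 1)\<^sup>s\<^sup>+\<^sup>1\<close> monomials of degree at most \<open>N\<close> in each of the \<open>s + 1\<close> elements, and modulo the
  ideal of \<open>Z\<close> they lie in a space whose dimension grows like \<open>N\<^sup>s\<close>.\<close>

lemma algebraic_relation:
  assumes D: "dual_basis Z s v z"
  obtains M c where "finite M" "M \<noteq> {}" "\<And>m. m \<in> M \<Longrightarrow> c m \<noteq> 0" "M \<subseteq> extensional {..<Suc s}"
    and "(\<Sum>m\<in>M. Const (c m) * (\<Prod>j=0..<Suc s. x j ^ m j)) \<in> subspace_ideal Z"
proof -
  interpret r: rhom "rho {..<s} v z" by (rule rhom_rho)
  let ?t = "Suc s"
  have "\<exists>d0. \<forall>j. rho {..<s} v z (x j) \<in> bounded_span s z (d0 j)"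
    by (intro choice allI rho_in_bounded_span)
  then obtain d0 where d0: "\<And>j. rho {..<s} v z (x j) \<in> bounded_span s z (d0 j)" by blast
  define d where "d = Max (d0 ` {..<?t})"
  have d: "rho {..<s} v z (x j) \<in> bounded_span s z d" if "j < ?t" for j
    using d0[of j] bounded_span_mono[of "d0 j" d s z] that by (auto simp: d_def intro!: Max_ge)
  \<comment> \<open>The constants give D' + 1 \<le> T(N + 1), hence (D' + 1)^s \<le> T^s (N + 1)^s.
    The choice N = T^s turns this into N (N + 1)^s, which is below (N + 1)^(s + 1).\<close>
  define T where "T = ?t * d + 1"
  define N where "N = T ^ s"
  define D' where "D' = ?t * (N * d)"
  define I where "I = PiE {..<?t} (\<lambda>_. {..N})"
  define W where "W = (\<lambda>k. \<Prod>j<s. lin_form (z j) ^ k j) ` PiE {..<s} (\<lambda>_. {..D'})"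
  define u where "u m = rho {..<s} v z (\<Prod>j=0..<?t. x j ^ m j)" for m
  have finI: "finite I" by (auto simp: I_def intro: finite_PiE)
  have finW: "finite W" by (auto simp: W_def intro: finite_PiE)
  have "card W \<le> card (PiE {..<s} (\<lambda>_. {..D'}))"
    unfolding W_def by (rule card_image_le) (auto intro: finite_PiE)
  also have "\<dots> = (D' + 1) ^ s" by (simp add: card_PiE)
  also have "\<dots> \<le> (T * (N + 1)) ^ s"
    by (rule power_mono) (simp_all add: D'_def T_def algebra_simps)
  also have "\<dots> = N * (N + 1) ^ s" by (simp only: power_mult_distrib N_def)
  also have "\<dots> < (N + 1) ^ ?t" by simp
  also have "\<dots> = card I" by (simp add: I_def card_PiE)
  finally have card: "card W < card I" .
  have "u ` I \<subseteq> mpol.span W"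
  proof clarify
    fix m assume m: "m \<in> I"
    have "u m = (\<Prod>j<?t. rho {..<s} v z (x j) ^ m j)"
      by (simp add: u_def atLeast0LessThan)
    also have "\<dots> \<in> bounded_span s z D'"
      unfolding D'_def using m d
      by (intro bounded_span_prod bounded_span_power) (auto simp: I_def PiE_iff)
    finally show "u m \<in> mpol.span W" by (simp add: bounded_span_def W_def)
  qed
  then obtain c where c: "(\<Sum>m\<in>I. Const (c m) * u m) = 0" "\<exists>m\<in>I. c m \<noteq> 0"
    using mpol.dependent_family[OF finI finW card] by blast
  define M where "M = {m \<in> I. c m \<noteq> 0}"
  have "(\<Sum>m\<in>M. Const (c m) * u m) = (\<Sum>m\<in>I. Const (c m) * u m)"
    by (rule sum.mono_neutral_left) (use finI in \<open>auto simp: M_def\<close>)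
  then have "rho {..<s} v z (\<Sum>m\<in>M. Const (c m) * (\<Prod>j=0..<?t. x j ^ m j)) = 0"
    using c(1) by (simp add: u_def)
  then have rel: "(\<Sum>m\<in>M. Const (c m) * (\<Prod>j=0..<?t. x j ^ m j)) \<in> subspace_ideal Z"
    by (simp only: subspace_ideal_eq_kernel[OF D] mem_Collect_eq)
  show thesis
  proof (rule that[OF _ _ _ _ rel])
    show "finite M" using finI by (simp add: M_def)
    show "M \<noteq> {}" using c(2) by (auto simp: M_def)
    show "M \<subseteq> extensional {..<?t}" by (auto simp: M_def I_def PiE_def)
  qed (simp add: M_def)
qed

text \<open>A chain with \<open>s + 1\<close> strict steps supplies \<open>s + 1\<close> elements
  without polynomial relation modulo \<open>P 0\<close>, while any \<open>s + 1\<close> elements are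
  related modulo the smaller ideal of \<open>Z\<close>.\<close>

lemma prime_chain_length:
  assumes D: "dual_basis Z s v z" and prime: "\<And>i. i \<le> n \<Longrightarrow> is_prime (P i)"
    and strict: "\<And>i. i < n \<Longrightarrow> P i \<subset> P (Suc i)" and P0: "subspace_ideal Z \<subseteq> P 0"
  shows "n \<le> s"
proof (rule ccontr)
  assume "\<not> n \<le> s"
  then have n: "Suc s \<le> n" by simp
  then have "\<exists>y. y \<in> P (Suc i) - P i" if "i < Suc s" for i
    using strict[of i] that by auto
  then obtain x where x: "\<And>i. i < Suc s \<Longrightarrow> x i \<in> P (Suc i) - P i" by metis
  obtain M c where M: "finite M" "M \<noteq> {}" "\<And>m. m \<in> M \<Longrightarrow> c m \<noteq> 0" "M \<subseteq> extensional {..<Suc s}"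
    "(\<Sum>m\<in>M. Const (c m) * (\<Prod>j=0..<Suc s. x j ^ m j)) \<in> subspace_ideal Z"
    using algebraic_relation[OF D] by blast
  have "(\<Sum>m\<in>M. Const (c m) * (\<Prod>j=0..<Suc s. x j ^ m j)) \<notin> P 0"
  proof (rule chain_independent[where t = "Suc s" and P = P])
    fix m m' assume "m \<in> M" "m' \<in> M" and eq: "\<And>j. 0 \<le> j \<Longrightarrow> j < Suc s \<Longrightarrow> m j = m' j"
    then show "m = m'"
      using M(4) by (intro extensionalityI[of m "{..<Suc s}" m']) auto
  next
    fix i assume "i < Suc s"
    then show "P i \<subseteq> P (Suc i)" using strict[of i] n by auto
  qed (use M x prime strict n in auto)
  then show False using M(5) P0 by blast
qed

text \<open>The i-th prime is the kernel of the projection onto the span of v_i, ..., v_(s-1); the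
  form \<open>z i\<close> enters at step \<open>i + 1\<close>.\<close>

lemma prime_chain_exists:
  fixes v z :: "nat \<Rightarrow> 'k::field ^ 'n::{finite,linorder}"
  assumes D: "dual_basis Z s v z"
  obtains P where "\<And>i. i \<le> s \<Longrightarrow> is_prime (P i)" "\<And>i. i < s \<Longrightarrow> P i \<subset> P (Suc i)"
    "\<And>i. subspace_ideal Z \<subseteq> P i"
proof
  let ?P = "\<lambda>i. {f. rho {i..<s} v z f = 0}"
  have df: "dual_family s v z" using D by (simp add: dual_basis_def)
  show "is_prime (?P i)" for i by (rule is_prime_kernel[OF rhom_rho])
  have mono: "?P i \<subseteq> ?P j" if "i \<le> j" for i j
  proof clarify
    fix f assume "rho {i..<s} v z f = 0"
    then have "rho {j..<s} v z (rho {i..<s} v z f) = 0" by (simp add: rhom.zero[OF rhom_rho])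
    then show "rho {j..<s} v z f = 0"
      using that by (subst (asm) rho_rho[OF df]) auto
  qed
  show "?P i \<subset> ?P (Suc i)" if i: "i < s" for i
  proof
    show "?P i \<subseteq> ?P (Suc i)" by (rule mono) simp
    have "z i \<noteq> 0"
      using df i by (metis dual_family_def lin_eval_0(1) zero_neq_one)
    moreover have "{i..<s} \<subseteq> {..<s}" "{Suc i..<s} \<subseteq> {..<s}" by auto
    ultimately have "lin_form (z i) \<notin> ?P i" "lin_form (z i) \<in> ?P (Suc i)"
      using i rho_dual[OF df, of "{i..<s}" i] rho_dual[OF df, of "{Suc i..<s}" i] by auto
    then show "?P i \<noteq> ?P (Suc i)" by blast
  qed
  show "subspace_ideal Z \<subseteq> ?P i" for i
    using mono[of 0 i] by (simp add: subspace_ideal_eq_kernel[OF D] atLeast0LessThan)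
qed

section \<open>Transfer to quotient rings\<close>

lemma type_ring_simps [simp]:
  "carrier (ring_of_type_algebra :: 'a::comm_ring_1 ring) = UNIV"
  "x \<otimes>\<^bsub>ring_of_type_algebra\<^esub> y = x * (y :: 'a)"
  "x \<oplus>\<^bsub>ring_of_type_algebra\<^esub> y = x + (y :: 'a)"
  "\<zero>\<^bsub>ring_of_type_algebra\<^esub> = (0 :: 'a)"
  "\<one>\<^bsub>ring_of_type_algebra\<^esub> = (1 :: 'a)"
  by (simp_all add: ring_of_type_algebra_def)

lemma cring_type_ring: "cring (ring_of_type_algebra :: 'a::comm_ring_1 ring)"
  by (rule cring_from_type_algebra)

text \<open>A carrier-based ring presented as a quotient of a ring type, so that its ideals become
  ideals of the type containing \<open>ker\<close>. It serves both for the coordinate ring of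
  \<open>H\<close> and for the quotient of that ring by the residue ideal.\<close>

locale surjection = T: cring T for T :: "('t, 'm) ring_scheme" (structure) +
  fixes h :: "'a::comm_ring_1 \<Rightarrow> 't"
  assumes surj: "range h = carrier T"
    and add: "h (x + y) = h x \<oplus> h y" and mult: "h (x * y) = h x \<otimes> h y" and one: "h 1 = \<one>"
begin

lemma closed [simp]: "h x \<in> carrier T"
  using surj by blast

lemma carrierE: "r \<in> carrier T \<Longrightarrow> (\<And>x. r = h x \<Longrightarrow> thesis) \<Longrightarrow> thesis"
  using surj by blast

lemma zero: "h 0 = \<zero>"
proof -
  have "h 0 \<oplus> h 0 = h 0" using add[of 0 0] by simp
  then show ?thesis using T.add.l_cancel_one[of "h 0" "h 0"] by simp
qed

lemma uminus: "h (- x) = \<ominus> h x"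
  using add[of x "- x"] by (intro T.minus_equality[symmetric]) (simp_all add: zero T.a_comm)

lemma diff: "h (x - y) = h x \<ominus> h y"
  using add[of x "- y"] by (simp add: uminus T.minus_eq)

definition ker :: "'a set" where "ker = {x. h x = \<zero>}"

lemma eq_iff: "h x = h y \<longleftrightarrow> x - y \<in> ker"
  by (auto simp: ker_def diff T.r_right_minus_eq)

lemma image_mem_iff: "is_ideal I \<Longrightarrow> ker \<subseteq> I \<Longrightarrow> h x \<in> h ` I \<longleftrightarrow> x \<in> I"
  using eq_iff is_ideal_diff_mem by blast

lemma vimage_image: "is_ideal I \<Longrightarrow> ker \<subseteq> I \<Longrightarrow> {x. h x \<in> h ` I} = I"
  using image_mem_iff by blast

lemma image_subset_iff: "is_ideal I \<Longrightarrow> ker \<subseteq> I \<Longrightarrow> is_ideal I' \<Longrightarrow> ker \<subseteq> I' \<Longrightarrow> h ` I \<subseteq> h ` I' \<longleftrightarrow> I \<subseteq> I'"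
  using image_mem_iff by blast

lemma image_eq_iff: "is_ideal I \<Longrightarrow> ker \<subseteq> I \<Longrightarrow> is_ideal I' \<Longrightarrow> ker \<subseteq> I' \<Longrightarrow> h ` I = h ` I' \<longleftrightarrow> I = I'"
  using vimage_image by metis

lemma image_vimage:
  assumes "I' \<subseteq> carrier T"
  shows "h ` {x. h x \<in> I'} = I'"
proof
  show "I' \<subseteq> h ` {x. h x \<in> I'}"
  proof
    fix r assume r: "r \<in> I'"
    then obtain x where "r = h x" using assms by (blast elim: carrierE)
    then show "r \<in> h ` {x. h x \<in> I'}" using r by blast
  qed
qed auto

lemma ideal_image:
  assumes "is_ideal I"
  shows "ideal (h ` I) T"
proof (rule idealI)
  show "ring T" by (rule T.ring_axioms)
  show "subgroup (h ` I) (add_monoid T)"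
  proof (rule T.add.subgroupI)
    show "h ` I \<subseteq> carrier T" by auto
    show "h ` I \<noteq> {}" using assms by (auto simp: is_ideal_def)
    show "\<ominus> a \<in> h ` I" if "a \<in> h ` I" for a
      using that is_idealD(5)[OF assms] by (auto simp flip: uminus)
    show "a \<oplus> b \<in> h ` I" if "a \<in> h ` I" "b \<in> h ` I" for a b
      using that is_idealD(2)[OF assms] by (auto simp flip: add)
  qed
  show "x \<otimes> a \<in> h ` I" if "a \<in> h ` I" "x \<in> carrier T" for a x
    using that is_idealD(3)[OF assms] by (auto elim!: carrierE simp flip: mult)
  show "a \<otimes> x \<in> h ` I" if "a \<in> h ` I" "x \<in> carrier T" for a x
    using that is_idealD(4)[OF assms] by (auto elim!: carrierE simp flip: mult)
qed

lemma ideal_vimage: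
  assumes "ideal I' T"
  shows "is_ideal {x. h x \<in> I'}" and "ker \<subseteq> {x. h x \<in> I'}"
proof -
  interpret I: ideal I' T by fact
  show "is_ideal {x. h x \<in> I'}"
    by (auto simp: is_ideal_def zero add mult intro: I.I_l_closed)
  show "ker \<subseteq> {x. h x \<in> I'}" by (auto simp: ker_def)
qed

lemma primeideal_iff: "primeideal P' T \<longleftrightarrow> (\<exists>P. is_prime P \<and> ker \<subseteq> P \<and> P' = h ` P)"
proof
  assume "primeideal P' T"
  then interpret P: primeideal P' T .
  have I: "ideal P' T" by (rule P.is_ideal)
  have "1 \<notin> {x. h x \<in> P'}"
  proof
    assume "1 \<in> {x. h x \<in> P'}"
    then have "P' = carrier T" using P.one_imp_carrier one by simp
    then show False using P.I_notcarr by simp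
  qed
  moreover have "x \<in> {x. h x \<in> P'} \<or> y \<in> {x. h x \<in> P'}" if "x * y \<in> {x. h x \<in> P'}" for x y
    using that P.I_prime[of "h x" "h y"] by (simp add: mult)
  ultimately have "is_prime {x. h x \<in> P'}"
    using ideal_vimage(1)[OF I] by (simp add: is_prime_def)
  moreover have "P' = h ` {x. h x \<in> P'}" using image_vimage[OF P.a_subset] by simp
  ultimately show "\<exists>P. is_prime P \<and> ker \<subseteq> P \<and> P' = h ` P"
    using ideal_vimage(2)[OF I] by blast
next
  assume "\<exists>P. is_prime P \<and> ker \<subseteq> P \<and> P' = h ` P"
  then obtain P where P: "is_prime P" "ker \<subseteq> P" "P' = h ` P" by blast
  have I: "is_ideal P" using P(1) by (rule is_prime_ideal)
  show "primeideal P' T"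
  proof (rule primeidealI)
    show "ideal P' T" unfolding P(3) by (rule ideal_image[OF I])
    show "cring T" by (rule T.is_cring)
    have "h 1 \<notin> P'" using P image_mem_iff[OF I] by (simp add: is_prime_def)
    then show "carrier T \<noteq> P'" by auto
    show "a \<in> P' \<or> b \<in> P'" if "a \<in> carrier T" "b \<in> carrier T" "a \<otimes> b \<in> P'" for a b
    proof -
      obtain x y where "a = h x" "b = h y" using \<open>a \<in> carrier T\<close> \<open>b \<in> carrier T\<close> by (metis carrierE)
      then show ?thesis
        using that(3) P(1) image_mem_iff[OF I P(2)] by (auto simp: P(3) is_prime_def simp flip: mult)
    qed
  qed
qed

lemma quotient:
  assumes J: "is_ideal J"
  shows "surjection (T Quot (h ` J)) (\<lambda>x. (h ` J) +> h x)"
proof -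
  interpret J: ideal "h ` J" T by (rule ideal_image[OF J])
  interpret Q: cring "T Quot (h ` J)" by (rule J.quotient_is_cring[OF T.is_cring])
  have hom: "(+>) (h ` J) \<in> ring_hom T (T Quot (h ` J))" by (rule J.rcos_ring_hom)
  show ?thesis
  proof
    show "range (\<lambda>x. (h ` J) +> h x) = carrier (T Quot (h ` J))"
      using surj by (auto simp: FactRing_def A_RCOSETS_def' elim!: carrierE)
    show "(h ` J) +> h (x + y) = ((h ` J) +> h x) \<oplus>\<^bsub>T Quot (h ` J)\<^esub> ((h ` J) +> h y)" for x y
      using ring_hom_add[OF hom] by (simp add: add)
    show "(h ` J) +> h (x * y) = ((h ` J) +> h x) \<otimes>\<^bsub>T Quot (h ` J)\<^esub> ((h ` J) +> h y)" for x y
      using ring_hom_mult[OF hom] by (simp add: mult)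
    show "(h ` J) +> h 1 = \<one>\<^bsub>T Quot (h ` J)\<^esub>"
      using ring_hom_one[OF hom] by (simp add: one)
  qed
qed

lemma quotient_zero_iff:
  assumes J: "is_ideal J" "ker \<subseteq> J"
  shows "(h ` J) +> h x = \<zero>\<^bsub>T Quot (h ` J)\<^esub> \<longleftrightarrow> x \<in> J"
proof -
  interpret J: ideal "h ` J" T by (rule ideal_image[OF J(1)])
  have "(h ` J) +> h x = h ` J \<longleftrightarrow> h x \<in> h ` J"
    using J.a_rcos_const[of "h x"] J.a_rcos_self[of "h x"] by auto
  then show ?thesis
    using image_mem_iff[OF J] by (simp add: FactRing_def)
qed

lemma min_primes_image:
  assumes J: "is_ideal J" "ker \<subseteq> J"
  shows "min_primes T (h ` J) = (`) h ` {P. is_prime P \<and> J \<subseteq> P \<and> (\<forall>P'. is_prime P' \<and> J \<subseteq> P' \<and> P' \<subseteq> P \<longrightarrow> P' = P)}"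
    (is "?l = ?r")
proof
  show "?l \<subseteq> ?r"
  proof
    fix P assume P: "P \<in> ?l"
    then have "primeideal P T" by (simp add: min_primes_def)
    then obtain P0 where P0: "is_prime P0" "ker \<subseteq> P0" "P = h ` P0"
      by (auto simp: primeideal_iff)
    have I: "is_ideal P0" using P0(1) by (rule is_prime_ideal)
    have "J \<subseteq> P0"
      using P image_subset_iff[OF J I P0(2)] by (simp add: min_primes_def P0(3))
    moreover have "P' = P0" if P': "is_prime P'" "J \<subseteq> P'" "P' \<subseteq> P0" for P'
    proof -
      have k: "ker \<subseteq> P'" using P'(2) J(2) by blast
      then have "primeideal (h ` P') T" using P'(1) primeideal_iff by blast
      moreover have "h ` J \<subseteq> h ` P'" "h ` P' \<subseteq> P" using P' P0(3) by auto
      ultimately have "h ` P' = h ` P0" using P P0(3) by (simp add: min_primes_def)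
      then show ?thesis using image_eq_iff[OF is_prime_ideal[OF P'(1)] k I P0(2)] by simp
    qed
    ultimately show "P \<in> ?r" using P0 by blast
  qed
  show "?r \<subseteq> ?l"
  proof clarify
    fix P assume P: "is_prime P" "J \<subseteq> P" "\<forall>P'. is_prime P' \<and> J \<subseteq> P' \<and> P' \<subseteq> P \<longrightarrow> P' = P"
    have k: "ker \<subseteq> P" using P(2) J(2) by blast
    have I: "is_ideal P" using P(1) by (rule is_prime_ideal)
    have "primeideal (h ` P) T" using P(1) k primeideal_iff by blast
    moreover have "P' = h ` P" if P': "primeideal P' T" "h ` J \<subseteq> P'" "P' \<subseteq> h ` P" for P'
    proof -
      obtain P0 where P0: "is_prime P0" "ker \<subseteq> P0" "P' = h ` P0"
        using P'(1) by (auto simp: primeideal_iff)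
      have I0: "is_ideal P0" using P0(1) by (rule is_prime_ideal)
      have "J \<subseteq> P0" using P'(2) image_subset_iff[OF J I0 P0(2)] P0(3) by simp
      moreover have "P0 \<subseteq> P" using P'(3) image_subset_iff[OF I0 P0(2) I k] P0(3) by simp
      ultimately show ?thesis using P(3) P0 by blast
    qed
    ultimately show "h ` P \<in> ?l" using P(2) by (auto simp: min_primes_def)
  qed
qed

lemma ass_primes_image:
  assumes J: "is_ideal J" "ker \<subseteq> J" and P: "P \<in> ass_primes T (h ` J)"
  shows "\<exists>P0 g. is_prime P0 \<and> P0 = {f. f * g \<in> J} \<and> P = h ` P0"
proof -
  interpret q: surjection "T Quot (h ` J)" "\<lambda>x. (h ` J) +> h x" by (rule quotient[OF J(1)])
  obtain m where m: "primeideal P T" "m \<in> carrier (T Quot (h ` J))"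
    "P = {r \<in> carrier T. (h ` J +> r) \<otimes>\<^bsub>T Quot (h ` J)\<^esub> m = \<zero>\<^bsub>T Quot (h ` J)\<^esub>}"
    using P by (auto simp: ass_primes_def)
  obtain g where g: "m = (h ` J) +> h g" using m(2) by (rule q.carrierE)
  obtain P0 where P0: "is_prime P0" "ker \<subseteq> P0" "P = h ` P0" using m(1) by (auto simp: primeideal_iff)
  have "P0 = {f. f * g \<in> J}"
  proof -
    have "h f \<in> P \<longleftrightarrow> f * g \<in> J" for f
      unfolding m(3) g using q.mult[of f g] quotient_zero_iff[OF J, of "f * g"] by simp
    moreover have "h f \<in> P \<longleftrightarrow> f \<in> P0" for f
      unfolding P0(3) by (rule image_mem_iff[OF is_prime_ideal[OF P0(1)] P0(2)])
    ultimately show ?thesis by blast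
  qed
  then show ?thesis using P0 by blast
qed

lemma genideal_image:
  assumes J: "is_ideal J" "ker \<subseteq> J" and G: "G \<subseteq> J"
    and min: "\<And>I. is_ideal I \<Longrightarrow> ker \<subseteq> I \<Longrightarrow> G \<subseteq> I \<Longrightarrow> J \<subseteq> I"
  shows "Idl (h ` G) = h ` J"
proof
  show "Idl (h ` G) \<subseteq> h ` J"
    by (rule T.genideal_minimal[OF ideal_image[OF J(1)]]) (use G in auto)
  have I: "ideal (Idl (h ` G)) T" by (rule T.genideal_ideal) auto
  have "h ` G \<subseteq> Idl (h ` G)" by (rule T.genideal_self) auto
  then have "J \<subseteq> {x. h x \<in> Idl (h ` G)}"
    by (intro min ideal_vimage[OF I]) auto
  then show "h ` J \<subseteq> Idl (h ` G)" by blast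
qed

lemma krull_dim_eq:
  assumes chain: "\<And>i. i \<le> s \<Longrightarrow> is_prime (P i)" "\<And>i. i < s \<Longrightarrow> P i \<subset> P (Suc i)" "\<And>i. i \<le> s \<Longrightarrow> ker \<subseteq> P i"
    and bound: "\<And>n P. (\<And>i. i \<le> n \<Longrightarrow> is_prime (P i)) \<Longrightarrow> (\<And>i. i < n \<Longrightarrow> P i \<subset> P (Suc i)) \<Longrightarrow> ker \<subseteq> P 0 \<Longrightarrow> n \<le> s"
  shows "krull_dim T = ereal (real s)"
  unfolding krull_dim_def
proof (rule antisym)
  have less: "h ` I \<subset> h ` I' \<longleftrightarrow> I \<subset> I'" if "is_prime I" "ker \<subseteq> I" "is_prime I'" "ker \<subseteq> I'" for I I'
    using that image_subset_iff image_eq_iff is_prime_ideal by (metis psubset_eq)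
  have "\<exists>P. (\<forall>i\<le>s. primeideal (P i) T) \<and> (\<forall>i<s. P i \<subset> P (Suc i))"
  proof (intro exI[of _ "\<lambda>i. h ` P i"] conjI allI impI)
    show "primeideal (h ` P i) T" if "i \<le> s" for i
      using chain(1,3)[OF that] primeideal_iff by blast
    show "h ` P i \<subset> h ` P (Suc i)" if "i < s" for i
      by (subst less) (use that chain in auto)
  qed
  then show "ereal (real s) \<le> Sup {ereal (real n) | n.
     \<exists>P. (\<forall>i\<le>n. primeideal (P i) T) \<and> (\<forall>i<n. P i \<subset> P (Suc i))}"
    by (intro Sup_upper) blast
  show "Sup {ereal (real n) | n.
     \<exists>P. (\<forall>i\<le>n. primeideal (P i) T) \<and> (\<forall>i<n. P i \<subset> P (Suc i))} \<le> ereal (real s)"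
  proof (rule Sup_least, clarify)
    fix n P assume P: "\<forall>i\<le>n. primeideal (P i) T" "\<forall>i<n. P i \<subset> P (Suc i)"
    then have "\<forall>i. \<exists>P0. i \<le> n \<longrightarrow> is_prime P0 \<and> ker \<subseteq> P0 \<and> P i = h ` P0"
      by (auto simp: primeideal_iff)
    then obtain P0 where P0: "\<And>i. i \<le> n \<Longrightarrow> is_prime (P0 i) \<and> ker \<subseteq> P0 i \<and> P i = h ` P0 i"
      by metis
    have "n \<le> s"
    proof (rule bound)
      show "is_prime (P0 i)" if "i \<le> n" for i using P0[OF that] by simp
      show "ker \<subseteq> P0 0" using P0[of 0] by simp
      show "P0 i \<subset> P0 (Suc i)" if "i < n" for i
      proof -
        have i: "i \<le> n" "Suc i \<le> n" using that by auto
        have "h ` P0 i \<subset> h ` P0 (Suc i)" using P(2) that P0[OF i(1)] P0[OF i(2)] by metis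
        then show ?thesis using less[of "P0 i" "P0 (Suc i)"] P0[OF i(1)] P0[OF i(2)] by simp
      qed
    qed
    then show "ereal (real n) \<le> ereal (real s)" by simp
  qed
qed

end

lemma surjection_id: "surjection (ring_of_type_algebra :: 'a::comm_ring_1 ring) (\<lambda>x. x)"
proof -
  interpret cring "ring_of_type_algebra :: 'a ring" by (rule cring_type_ring)
  show ?thesis by unfold_locales simp_all
qed

lemma PIdl_type_ring: "PIdl\<^bsub>ring_of_type_algebra\<^esub> a = {x. a dvd (x :: 'a::comm_ring_1)}"
  by (auto simp: cgenideal_def dvd_def mult.commute)

lemma
  fixes a :: "'k::field ^ 'n::finite"
  shows surjection_bar: "surjection (Sbar a) (bar a)"
    and bar_kernel: "surjection.ker (Sbar a) (bar a) = {x. lin_form a dvd x}"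
proof -
  interpret i: surjection "ring_of_type_algebra :: ('k, 'n) mpol ring" "\<lambda>x. x" by (rule surjection_id)
  have k: "i.ker = {0}" by (simp add: i.ker_def)
  have id: "is_ideal {x. lin_form a dvd x}" by (rule is_ideal_dvd)
  have im: "(\<lambda>x. x) ` {x. lin_form a dvd x} = {x. lin_form a dvd x}" by simp
  show s: "surjection (Sbar a) (bar a)"
    using i.quotient[OF id] unfolding Sbar_def bar_def PIdl_type_ring im by simp
  show "surjection.ker (Sbar a) (bar a) = {x. lin_form a dvd x}"
    using i.quotient_zero_iff[OF id]
    unfolding surjection.ker_def[OF s] unfolding Sbar_def bar_def PIdl_type_ring im
    by (simp add: k)
qed

section \<open>The residue ideal\<close>

lemma dvd_diff_swap: "a dvd x - y \<Longrightarrow> a dvd y - (x :: 'a::comm_ring_1)"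
  using dvd_minus_iff[of a "x - y"] by simp

definition fcontract :: "(('k::field, 'n::{finite,linorder}) mpol fract, 'n) vec \<Rightarrow> ('k, 'n) vec \<Rightarrow> ('k, 'n) mpol fract" where
  "fcontract \<omega> v = (\<Sum>i\<in>UNIV. \<omega> $ i * Fract (Const (v $ i)) 1)"

lemma Fract_sum: "(\<Sum>i\<in>I. Fract (f i) q) = Fract (\<Sum>i\<in>I. f i) q" if "q \<noteq> 0"
proof (induction I rule: infinite_finite_induct)
  case (insert i I)
  then show ?case using that by (simp add: eq_fract algebra_simps)
qed (use that in \<open>simp_all add: Zero_fract_def eq_fract\<close>)

lemma fcontract_dform: "fcontract (fract_vec (dform b)) v = Fract (Const (lin_eval b v)) 1"
  by (simp add: fcontract_def fract_vec_def dform_def lin_eval_def Fract_sum flip: Const_def)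

lemma fcontract_sum: "fcontract (\<Sum>b\<in>B. f b *s \<zeta> b) v = (\<Sum>b\<in>B. f b * fcontract (\<zeta> b) v)"
  by (simp add: fcontract_def sum_distrib_left sum_distrib_right sum.swap[of _ B] mult_ac)

context arr
begin

definition to_form :: "(('k, 'n) mpol, 'n) vec \<Rightarrow> (('k, 'n) mpol fract, 'n) vec" where
  "to_form \<eta> = (\<chi> i. Fract (\<eta> $ i) Q)"

lemma fcontract_to_form: "fcontract (to_form \<eta>) v = Fract (contract \<eta> v) Q"
  by (simp add: fcontract_def to_form_def contract_def Fract_sum[OF Q_nonzero])

lemma dual_vector:
  assumes "vec.independent B" "\<alpha> H \<in> B"
  obtains \<theta> where "lin_eval (\<alpha> H) \<theta> = 1" "\<And>b. b \<in> B \<Longrightarrow> b \<noteq> \<alpha> H \<Longrightarrow> lin_eval b \<theta> = 0"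
proof -
  have "\<alpha> H \<notin> vec.span (B - {\<alpha> H})" using assms vec.dependent_def by blast
  then show thesis using that separating_form by (metis Diff_iff singletonD)
qed

text \<open>Contraction with the vector dual to \<open>\<alpha> H\<close> in the basis
  \<open>B\<close> kills all other basis forms and so picks out the coefficient of
  \<open>d\<alpha>_H\<close>.\<close>

lemma coefficient_eq_contract:
  assumes B: "vec.independent B" "\<alpha> H \<in> B"
    and \<omega>: "to_form \<eta> = (\<Sum>b\<in>B. f b *s fract_vec (dform b))"
    and \<theta>: "lin_eval (\<alpha> H) \<theta> = 1" "\<And>b. b \<in> B \<Longrightarrow> b \<noteq> \<alpha> H \<Longrightarrow> lin_eval b \<theta> = 0"
  shows "Fract Q 1 * f (\<alpha> H) = Fract (contract \<eta> \<theta>) 1"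
proof -
  have fin: "finite B" using B(1) by (rule vec.finiteI_independent)
  have "Fract (contract \<eta> \<theta>) Q = (\<Sum>b\<in>B. f b * Fract (Const (lin_eval b \<theta>)) 1)"
    using \<omega> by (simp add: fcontract_sum fcontract_dform flip: fcontract_to_form)
  also have "\<dots> = (\<Sum>b\<in>B. if b = \<alpha> H then f b else 0)"
    by (rule sum.cong) (use \<theta> in \<open>auto simp flip: One_fract_def Zero_fract_def\<close>)
  also have "\<dots> = f (\<alpha> H)" using fin B(2) by simp
  finally have "Fract Q 1 * f (\<alpha> H) = Fract Q 1 * Fract (contract \<eta> \<theta>) Q" by simp
  also have "\<dots> = Fract (contract \<eta> \<theta>) 1" using Q_nonzero by (simp add: eq_fract)
  finally show ?thesis .
qed

lemma form_basis_expansion: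
  fixes B :: "('k, 'n) vec set" and \<omega> :: "(('k, 'n) mpol fract, 'n) vec"
  assumes "finite B" "vec.span B = UNIV"
  shows "\<exists>f. \<omega> = (\<Sum>b\<in>B. f b *s fract_vec (dform b))"
proof -
  have "\<forall>i. \<exists>c. axis i 1 = (\<Sum>b\<in>B. c b *s b)"
    using assms vec.span_finite[OF assms(1)] by (metis (no_types, lifting) UNIV_I rangeE)
  then obtain c where c: "\<And>i :: 'n. axis i (1::'k) = (\<Sum>b\<in>B. c i b *s b)" by metis
  have "(\<Sum>b\<in>B. (\<Sum>i\<in>UNIV. \<omega> $ i * Fract (Const (c i b)) 1) *s fract_vec (dform b)) $ j = \<omega> $ j" for j
  proof -
    have "(\<Sum>b\<in>B. (\<Sum>i\<in>UNIV. \<omega> $ i * Fract (Const (c i b)) 1) *s fract_vec (dform b)) $ j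
        = (\<Sum>i\<in>UNIV. \<omega> $ i * (\<Sum>b\<in>B. Fract (Const (c i b * b $ j)) 1))"
      by (simp add: fract_vec_def dform_def sum_distrib_left sum_distrib_right mult.assoc
          sum.swap[of _ B] flip: Const_def)
    also have "\<dots> = (\<Sum>i\<in>UNIV. \<omega> $ i * Fract (Const ((\<Sum>b\<in>B. c i b *s b) $ j)) 1)"
      by (simp add: Fract_sum)
    also have "\<dots> = (\<Sum>i\<in>UNIV. if i = j then \<omega> $ i else 0)"
      unfolding c[symmetric]
      by (rule sum.cong) (auto simp: axis_def simp flip: One_fract_def Zero_fract_def)
    also have "\<dots> = \<omega> $ j" by simp
    finally show ?thesis .
  qed
  then have "\<omega> = (\<Sum>b\<in>B. (\<Sum>i\<in>UNIV. \<omega> $ i * Fract (Const (c i b)) 1) *s fract_vec (dform b))"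
    by (simp only: vec_eq_iff) simp
  then show ?thesis
    by (rule exI[of _ "\<lambda>b. \<Sum>i\<in>UNIV. \<omega> $ i * Fract (Const (c i b)) 1"])
qed

sublocale bar: surjection "Sbar (\<alpha> H)" "bar (\<alpha> H)"
  by (rule surjection_bar)

lemma ker_bar: "bar.ker = {x. aH dvd x}"
  by (rule bar_kernel)

lemma bar_eq_iff: "bar (\<alpha> H) x = bar (\<alpha> H) y \<longleftrightarrow> aH dvd x - y"
  by (simp add: bar.eq_iff ker_bar)

text \<open>One dual vector gives the coefficient, and \<open>contract_H\<close> recovers all other
  contractions from it modulo \<open>aH\<close>; hence the choice of \<open>B\<close> does not
  matter. Conversely, any basis extending \<open>\<alpha> H\<close> witnesses the residue.\<close>

lemma is_residue_iff:
  assumes \<eta>: "\<eta> \<in> N"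
  shows "is_residue \<alpha> \<beta> A H (to_form \<eta>) r \<longleftrightarrow> (\<exists>f. r = bar (\<alpha> H) f \<and> is_res \<eta> f)"
proof
  assume "is_residue \<alpha> \<beta> A H (to_form \<eta>) r"
  then obtain B f g where r: "r \<in> carrier (Sbar (\<alpha> H))" and B: "vec.independent B" "\<alpha> H \<in> B"
    and f: "to_form \<eta> = (\<Sum>b\<in>B. f b *s fract_vec (dform b))" "Fract Q 1 * f (\<alpha> H) = Fract g 1"
    and g: "bar (\<alpha> H) Qb \<otimes>\<^bsub>Sbar (\<alpha> H)\<^esub> r = bar (\<alpha> H) g"
    unfolding is_residue_def by blast
  obtain \<theta> where \<theta>: "lin_eval (\<alpha> H) \<theta> = 1" "\<And>b. b \<in> B \<Longrightarrow> b \<noteq> \<alpha> H \<Longrightarrow> lin_eval b \<theta> = 0"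
    using dual_vector[OF B] by blast
  have "Fract (contract \<eta> \<theta>) 1 = Fract g 1"
    using coefficient_eq_contract[OF B f(1) \<theta>] f(2) by simp
  then have "g = contract \<eta> \<theta>" by (simp add: eq_fract)
  moreover obtain x where x: "r = bar (\<alpha> H) x" using r by (rule bar.carrierE)
  ultimately have "bar (\<alpha> H) (Qb * x) = bar (\<alpha> H) (contract \<eta> \<theta>)"
    using g by (simp only: bar.mult)
  then have "aH dvd Qb * x - contract \<eta> \<theta>" by (simp only: bar_eq_iff)
  then have *: "aH dvd contract \<eta> \<theta> - Qb * x" by (rule dvd_diff_swap)
  have "is_res \<eta> x"
    unfolding is_res_def
  proof
    fix v
    have "aH dvd (contract \<eta> v - Const (lin_eval (\<alpha> H) v) * contract \<eta> \<theta>)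
        + Const (lin_eval (\<alpha> H) v) * (contract \<eta> \<theta> - Qb * x)"
      using contract_H[OF \<eta> \<theta>(1)] * by (intro dvd_add dvd_mult)
    then show "aH dvd contract \<eta> v - Const (lin_eval (\<alpha> H) v) * Qb * x"
      by (simp add: algebra_simps)
  qed
  then show "\<exists>f. r = bar (\<alpha> H) f \<and> is_res \<eta> f" using x by blast
next
  assume "\<exists>f. r = bar (\<alpha> H) f \<and> is_res \<eta> f"
  then obtain x where x: "r = bar (\<alpha> H) x" "is_res \<eta> x" by blast
  have ind: "vec.independent {\<alpha> H}" using alpha_nonzero[OF H_in] by simp
  obtain B where B: "{\<alpha> H} \<subseteq> B" "vec.independent B" "UNIV \<subseteq> vec.span B"
    by (rule vec.maximal_independent_subset_extend[OF subset_UNIV ind])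
  then have aB: "\<alpha> H \<in> B" and span: "vec.span B = UNIV" by auto
  have fin: "finite B" using B(2) by (rule vec.finiteI_independent)
  obtain f where f: "to_form \<eta> = (\<Sum>b\<in>B. f b *s fract_vec (dform b))"
    using form_basis_expansion[OF fin span] by blast
  obtain \<theta> where \<theta>: "lin_eval (\<alpha> H) \<theta> = 1" "\<And>b. b \<in> B \<Longrightarrow> b \<noteq> \<alpha> H \<Longrightarrow> lin_eval b \<theta> = 0"
    using dual_vector[OF B(2) aB] by blast
  have "aH dvd contract \<eta> \<theta> - Const 1 * Qb * x"
    using x(2) \<theta>(1) unfolding is_res_def by metis
  then have "aH dvd contract \<eta> \<theta> - Qb * x" by simp
  then have "aH dvd Qb * x - contract \<eta> \<theta>" by (rule dvd_diff_swap)
  then have "bar (\<alpha> H) Qb \<otimes>\<^bsub>Sbar (\<alpha> H)\<^esub> r = bar (\<alpha> H) (contract \<eta> \<theta>)"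
    unfolding x(1) bar.mult[symmetric] bar_eq_iff .
  then show "is_residue \<alpha> \<beta> A H (to_form \<eta>) r"
    unfolding is_residue_def
    using x(1) B(2) span aB f coefficient_eq_contract[OF B(2) aB f \<theta>] by auto
qed

lemma residue_ideal_eq: "residue_ideal \<alpha> \<beta> A H = bar (\<alpha> H) ` J"
proof -
  have res: "res \<alpha> \<beta> A H (to_form \<eta>) = bar (\<alpha> H) f" if \<eta>: "\<eta> \<in> N" "is_res \<eta> f" for \<eta> f
    unfolding res_def is_residue_iff[OF \<eta>(1)]
  proof (rule the_equality)
    show "\<exists>f'. bar (\<alpha> H) f = bar (\<alpha> H) f' \<and> is_res \<eta> f'" using \<eta>(2) by blast
    fix r assume "\<exists>f. r = bar (\<alpha> H) f \<and> is_res \<eta> f"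
    then show "r = bar (\<alpha> H) f" using is_res_unique[OF _ \<eta>(2)] bar_eq_iff by blast
  qed
  have lf: "log_forms \<alpha> A = to_form ` N"
    unfolding log_forms_eq to_form_def ..
  show ?thesis
  proof
    show "residue_ideal \<alpha> \<beta> A H \<subseteq> bar (\<alpha> H) ` J"
      unfolding residue_ideal_def lf using res is_res_exists J_eq by fastforce
    show "bar (\<alpha> H) ` J \<subseteq> residue_ideal \<alpha> \<beta> A H"
    proof clarify
      fix f assume "f \<in> J"
      then obtain \<eta> where \<eta>: "\<eta> \<in> N" "is_res \<eta> f" by (auto simp: J_eq)
      then show "bar (\<alpha> H) f \<in> residue_ideal \<alpha> \<beta> A H"
        unfolding residue_ideal_def lf using res[OF \<eta>] by (metis imageI)
    qed
  qed
qed

lemma ker_subset_J: "bar.ker \<subseteq> J"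
  using aH_in_J is_ideal_J by (auto simp: ker_bar dvd_def is_idealD)

lemma residue_ideal_eq_carrier_iff: "residue_ideal \<alpha> \<beta> A H = carrier (Sbar (\<alpha> H)) \<longleftrightarrow> 1 \<in> J"
proof -
  have "residue_ideal \<alpha> \<beta> A H = carrier (Sbar (\<alpha> H)) \<longleftrightarrow> J = UNIV"
    unfolding residue_ideal_eq bar.surj[symmetric]
    using bar.image_eq_iff[OF is_ideal_J ker_subset_J, of UNIV] by (simp add: is_ideal_def)
  then show ?thesis using is_ideal_eq_UNIV[OF is_ideal_J] by auto
qed

lemma flat_ideal_eq:
  assumes "Z \<subseteq> H"
  shows "flat_ideal (\<alpha> H) Z = bar (\<alpha> H) ` subspace_ideal Z"
proof -
  let ?X = "{lin_form c | c. \<forall>v\<in>Z. lin_eval c v = 0}"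
  have k: "bar.ker \<subseteq> subspace_ideal Z"
    using alpha_in_subspace_ideal_iff[OF H_in, of Z] assms is_idealD(4)[OF is_ideal_subspace_ideal] by (auto simp: ker_bar dvd_def)
  have "Idl\<^bsub>Sbar (\<alpha> H)\<^esub> (bar (\<alpha> H) ` ?X) = bar (\<alpha> H) ` subspace_ideal Z"
  proof (rule bar.genideal_image[OF is_ideal_subspace_ideal k])
    show "?X \<subseteq> subspace_ideal Z" by (auto intro: lin_form_in_subspace_ideal)
    show "subspace_ideal Z \<subseteq> I" if "is_ideal I" "bar.ker \<subseteq> I" "?X \<subseteq> I" for I
      using that by (intro subspace_ideal_minimal) auto
  qed
  moreover have "bar (\<alpha> H) ` ?X = {bar (\<alpha> H) (lin_form c) | c. \<forall>v\<in>Z. lin_eval c v = 0}" by blast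
  ultimately show ?thesis by (simp add: flat_ideal_def)
qed

lemma Xi_eq: "Xi \<alpha> \<beta> A H = Xi'"
proof -
  have "residue_ideal \<alpha> \<beta> (localization A Z) H \<noteq> carrier (Sbar (\<alpha> H)) \<longleftrightarrow>
      1 \<notin> residue_lift \<alpha> \<beta> (localization A Z) H" if "Z \<in> flats A H" for Z
  proof -
    interpret Z: arr "localization A Z" H \<alpha> \<beta>
      using flats_subset[OF that] by (rule arr_localization)
    show ?thesis using Z.residue_ideal_eq_carrier_iff by simp
  qed
  then show ?thesis by (auto simp: Xi_def Xi'_def)
qed

lemma flat_subspace:
  assumes "Z \<in> flats A H"
  shows "vec.subspace Z"
proof -
  have A: "vec.subspace L" if "L \<in> A" for L using arrangement that by (simp add: arrangement_def)
  obtain B where B: "Z = \<Inter>(insert H B)" "B \<subseteq> restriction A H" using assms by (auto simp: flats_def)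
  have "vec.subspace Y" if "Y \<in> restriction A H" for Y
    using that A H_in by (auto simp: restriction_def intro: vec.subspace_inter)
  then show ?thesis unfolding B(1) using A[OF H_in] B(2) by (intro vec.subspace_Inter) auto
qed

text \<open>A flat is a linear subspace, so a point outside it is separated from it by a linear
  form.\<close>

lemma subspace_ideal_subset_iff:
  assumes "Z \<in> flats A H"
  shows "subspace_ideal Z \<subseteq> subspace_ideal Y \<longleftrightarrow> Y \<subseteq> Z"
proof
  assume *: "subspace_ideal Z \<subseteq> subspace_ideal Y"
  show "Y \<subseteq> Z"
  proof
    fix y assume y: "y \<in> Y"
    show "y \<in> Z"
    proof (rule ccontr)
      assume "y \<notin> Z"
      then have "y \<notin> vec.span Z" using flat_subspace[OF assms] vec.span_eq_iff by blast
      then obtain c where c: "lin_eval y c = 1" "\<And>d. d \<in> Z \<Longrightarrow> lin_eval d c = 0"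
        by (rule separating_form) blast
      then have "lin_form c \<in> subspace_ideal Z" by (intro lin_form_in_subspace_ideal) (simp add: lin_eval_commute)
      then have "lin_eval c y = 0" using * y lin_form_in_subspace_ideal_iff by blast
      then show False using c(1) by (simp add: lin_eval_commute)
    qed
  qed
qed (rule subspace_ideal_antimono)

lemma Xi'_flat: "Z \<in> Xi' \<Longrightarrow> Z \<in> flats A H"
  by (simp add: Xi'_def)

section \<open>Minimal primes, associated primes and complete intersections\<close>

lemma J_subset_subspace_ideal: "Z \<in> Xi' \<Longrightarrow> J \<subseteq> subspace_ideal Z"
  using primes_over_J[OF is_prime_subspace_ideal] by blast

text \<open>Every prime over \<open>J\<close> contains the ideal of some flat in \<open>Xi'\<close>,
  and each such ideal is itself a prime over \<open>J\<close>; inclusion of ideals reverses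
  inclusion of flats.\<close>

lemma minimal_primes_J:
  "{P. is_prime P \<and> J \<subseteq> P \<and> (\<forall>P'. is_prime P' \<and> J \<subseteq> P' \<and> P' \<subseteq> P \<longrightarrow> P' = P)} = subspace_ideal ` Xi_max \<alpha> \<beta> A H"
  (is "?l = ?r")
proof
  show "?l \<subseteq> ?r"
  proof
    fix P assume P: "P \<in> ?l"
    then have "is_prime P" "J \<subseteq> P" by auto
    then obtain Z where Z: "Z \<in> Xi'" "subspace_ideal Z \<subseteq> P" using primes_over_J[of P] by auto
    have min: "P' = P" if "is_prime P'" "J \<subseteq> P'" "P' \<subseteq> P" for P' using P that by blast
    have PZ: "P = subspace_ideal Z" using min[OF is_prime_subspace_ideal J_subset_subspace_ideal[OF Z(1)] Z(2)] by simp
    have "Y = Z" if Y: "Y \<in> Xi'" "Z \<subseteq> Y" for Y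
    proof -
      have "subspace_ideal Y = P"
        using Y(2) PZ by (intro min is_prime_subspace_ideal J_subset_subspace_ideal[OF Y(1)]) (auto dest: subspace_ideal_antimono)
      then show ?thesis
        using Y(2) subspace_ideal_subset_iff[OF Xi'_flat[OF Z(1)], of Y] PZ by auto
    qed
    then show "P \<in> ?r" using PZ Z(1) by (auto simp: Xi_max_def Xi_eq)
  qed
  show "?r \<subseteq> ?l"
  proof clarify
    fix Z assume "Z \<in> Xi_max \<alpha> \<beta> A H"
    then have Z: "Z \<in> Xi'" "\<And>Y. Y \<in> Xi' \<Longrightarrow> Z \<subseteq> Y \<Longrightarrow> Y = Z" by (auto simp: Xi_max_def Xi_eq)
    have "P' = subspace_ideal Z" if P': "is_prime P'" "J \<subseteq> P'" "P' \<subseteq> subspace_ideal Z" for P'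
    proof -
      obtain Y where Y: "Y \<in> Xi'" "subspace_ideal Y \<subseteq> P'" using primes_over_J[OF P'(1)] P'(2) by auto
      then have "Z \<subseteq> Y" using subspace_ideal_subset_iff[OF Xi'_flat[OF Y(1)], of Z] P'(3) by blast
      then have "Y = Z" by (rule Z(2)[OF Y(1)])
      then show ?thesis using Y(2) P'(3) by blast
    qed
    then show "is_prime (subspace_ideal Z) \<and> J \<subseteq> subspace_ideal Z \<and> (\<forall>P'. is_prime P' \<and> J \<subseteq> P' \<and> P' \<subseteq> subspace_ideal Z \<longrightarrow> P' = subspace_ideal Z)"
      using is_prime_subspace_ideal J_subset_subspace_ideal[OF Z(1)] by blast
  qed
qed

theorem min_primes_residue_ideal:
  "min_primes (Sbar (\<alpha> H)) (residue_ideal \<alpha> \<beta> A H) = flat_ideal (\<alpha> H) ` Xi_max \<alpha> \<beta> A H"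
proof -
  have "flat_ideal (\<alpha> H) Z = bar (\<alpha> H) ` subspace_ideal Z" if "Z \<in> Xi_max \<alpha> \<beta> A H" for Z
    using that by (intro flat_ideal_eq flats_subset) (simp add: Xi_max_def Xi_def)
  then show ?thesis
    unfolding residue_ideal_eq bar.min_primes_image[OF is_ideal_J ker_subset_J] minimal_primes_J
    by (simp add: image_image cong: image_cong)
qed

theorem ass_primes_residue_ideal:
  "ass_primes (Sbar (\<alpha> H)) (residue_ideal \<alpha> \<beta> A H) \<subseteq> flat_ideal (\<alpha> H) ` Xi \<alpha> \<beta> A H"
proof
  fix P assume "P \<in> ass_primes (Sbar (\<alpha> H)) (residue_ideal \<alpha> \<beta> A H)"
  then obtain P0 g where P: "is_prime P0" "P0 = {f. f * g \<in> J}" "P = bar (\<alpha> H) ` P0"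
    using bar.ass_primes_image[OF is_ideal_J ker_subset_J] unfolding residue_ideal_eq by blast
  then obtain Z where Z: "Z \<in> Xi'" "P0 = subspace_ideal Z" using associated_primes_J[of P0 g] by auto
  have "P = flat_ideal (\<alpha> H) Z"
    unfolding P(3) Z(2) using flat_ideal_eq flats_subset[OF Xi'_flat[OF Z(1)]] by simp
  then show "P \<in> flat_ideal (\<alpha> H) ` Xi \<alpha> \<beta> A H" using Z(1) by (simp add: Xi_eq)
qed

text \<open>The form \<open>d\<alpha>_H/\<alpha>_H\<close> has residue 1. Consequently a
  localization with proper residue ideal contains a hyperplane other than \<open>H\<close>.\<close>

lemma singleton_residue:
  assumes "A = {H}"
  shows "1 \<in> J"
proof -
  have "dform (\<alpha> H) \<in> N" unfolding assms log_numerators_def dform_def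
    by (simp add: mult.commute flip: Const_def)
  moreover have "restriction A H = {}" by (auto simp: assms restriction_def)
  then have "is_res (dform (\<alpha> H)) 1" by (simp add: is_res_def contract_dform arr_poly_def)
  ultimately show ?thesis using J_eq by blast
qed

text \<open>Localizing further at a flat containing \<open>Z\<close> agrees with localizing
  \<open>A\<close> there, so by maximality \<open>Z\<close> is the only flat of the localization
  whose residue ideal is proper.\<close>

lemma primes_over_maximal_localization:
  assumes Z: "Z \<in> Xi_max \<alpha> \<beta> A H" and P: "is_prime P"
  shows "residue_lift \<alpha> \<beta> (localization A Z) H \<subseteq> P \<longleftrightarrow> subspace_ideal Z \<subseteq> P"
proof -
  have ZX: "Z \<in> Xi'" and max: "\<And>Y. Y \<in> Xi' \<Longrightarrow> Z \<subseteq> Y \<Longrightarrow> Y = Z"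
    using Z by (auto simp: Xi_max_def Xi_eq)
  have ZH: "Z \<subseteq> H" using flats_subset Xi'_flat[OF ZX] by blast
  interpret Z: arr "localization A Z" H \<alpha> \<beta> using ZH by (rule arr_localization)
  have loc: "localization (localization A Z) Y = localization A Y" if "Z \<subseteq> Y" for Y
    using that by (auto simp: localization_def)
  have Zs: "Y \<in> Xi' \<and> Z \<subseteq> Y" if Y: "Y \<in> Z.Xi'" for Y
  proof -
    obtain B where B: "Y = H \<inter> \<Inter>B" "B \<subseteq> restriction (localization A Z) H"
      using Y by (auto simp: Z.Xi'_def flats_def)
    then have "Z \<subseteq> Y" "B \<subseteq> restriction A H" using ZH by (auto simp: restriction_localization)
    then show ?thesis using Y B(1) loc[of Y] by (auto simp: Z.Xi'_def Xi'_def flats_def)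
  qed
  have "Z \<in> Z.Xi'"
  proof -
    have "Z \<in> flats A H" by (rule Xi'_flat[OF ZX])
    then obtain B where B: "Z = H \<inter> \<Inter>B" "B \<subseteq> restriction A H" by (auto simp: flats_def)
    then have "B \<subseteq> restriction (localization A Z) H" using ZH by (auto simp: restriction_localization)
    then have "Z \<in> flats (localization A Z) H" using B(1) by (auto simp: flats_def)
    then show ?thesis using ZX loc[of Z] by (simp add: Z.Xi'_def Xi'_def)
  qed
  then have "Z.Xi' = {Z}" using Zs max by blast
  then show ?thesis using Z.primes_over_J[OF P] by simp
qed

theorem complete_intersection_residue_ideal:
  assumes Z: "Z \<in> Xi_max \<alpha> \<beta> A H" and free: "free_arrangement \<alpha> (localization A Z)"
  shows "complete_intersection (Sbar (\<alpha> H)) (CARD('n) - 1) (residue_ideal \<alpha> \<beta> (localization A Z) H)"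
proof -
  have ZX: "Z \<in> Xi'" using Z by (simp add: Xi_max_def Xi_eq)
  have ZH: "Z \<subseteq> H" using flats_subset Xi'_flat[OF ZX] by blast
  interpret Z: arr "localization A Z" H \<alpha> \<beta> using ZH by (rule arr_localization)
  have "localization A Z \<noteq> {H}" using Z.singleton_residue ZX by (auto simp: Xi'_def)
  then obtain L where L: "L \<in> localization A Z" "L \<noteq> H" using Z.H_in by blast
  obtain s v z where D: "dual_basis Z s v z" by (rule dual_basis_exists)
  obtain G where G: "finite G" "card G + s + 1 \<le> CARD('n)" "G \<subseteq> Z.J"
    "\<And>I. is_ideal I \<Longrightarrow> aH \<in> I \<Longrightarrow> G \<subseteq> I \<Longrightarrow> Z.J \<subseteq> I"
    using Z.free_residue_generators[OF D localization_subset_Inter L free] by blast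
  define k where "k = CARD('n) - 1 - s"
  obtain e where e: "bij_betw e {..<card G} G"
    using ex_bij_betw_nat_finite[OF G(1)] by (auto simp: atLeast0LessThan)
  \<comment> \<open>Zeros pad the generators from \<open>card G\<close> to \<open>k\<close>, the
    number that the dimension \<open>s\<close> of the quotient demands.\<close>
  define g where "g i = (if i < card G then e i else 0)" for i
  have gG: "G \<subseteq> g ` {..<k}" "g ` {..<k} \<subseteq> insert 0 G"
  proof -
    have "G = g ` {..<card G}" using e by (auto simp: bij_betw_def g_def)
    also have "\<dots> \<subseteq> g ` {..<k}" using G(2) by (intro image_mono) (auto simp: k_def)
    finally show "G \<subseteq> g ` {..<k}" .
    show "g ` {..<k} \<subseteq> insert 0 G" using e by (auto simp: bij_betw_def g_def)
  qed
  have k: "bar.ker \<subseteq> Z.J" by (rule Z.ker_subset_J)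
  have "Idl\<^bsub>Sbar (\<alpha> H)\<^esub> (bar (\<alpha> H) ` (g ` {..<k})) = bar (\<alpha> H) ` Z.J"
  proof (rule bar.genideal_image[OF Z.is_ideal_J k])
    have "insert 0 G \<subseteq> Z.J" using G(3) is_idealD(1)[OF Z.is_ideal_J] by simp
    then show "g ` {..<k} \<subseteq> Z.J" by (rule order_trans[OF gG(2)])
    show "Z.J \<subseteq> I" if I: "is_ideal I" "bar.ker \<subseteq> I" "g ` {..<k} \<subseteq> I" for I
    proof (rule G(4)[OF I(1)])
      show "aH \<in> I" using I(2) by (auto simp: ker_bar)
      show "G \<subseteq> I" by (rule order_trans[OF gG(1) I(3)])
    qed
  qed
  moreover have "krull_dim (Sbar (\<alpha> H) Quot (bar (\<alpha> H) ` Z.J)) = ereal (real s)"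
  proof -
    interpret q: surjection "Sbar (\<alpha> H) Quot (bar (\<alpha> H) ` Z.J)"
      "\<lambda>x. (bar (\<alpha> H) ` Z.J) +>\<^bsub>Sbar (\<alpha> H)\<^esub> bar (\<alpha> H) x"
      by (rule bar.quotient[OF Z.is_ideal_J])
    have ker: "q.ker = Z.J"
      unfolding q.ker_def using bar.quotient_zero_iff[OF Z.is_ideal_J k] by simp
    note over = primes_over_maximal_localization[OF Z]
    obtain P where P: "\<And>i. i \<le> s \<Longrightarrow> is_prime (P i)" "\<And>i. i < s \<Longrightarrow> P i \<subset> P (Suc i)" "\<And>i. subspace_ideal Z \<subseteq> P i"
      using prime_chain_exists[OF D] by metis
    show ?thesis
    proof (rule q.krull_dim_eq[of s P])
      show "q.ker \<subseteq> P i" if "i \<le> s" for i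
        unfolding ker using over[OF P(1)[OF that]] P(3) by simp
      fix n P' assume P': "\<And>i. i \<le> n \<Longrightarrow> is_prime (P' i)" "\<And>i. i < n \<Longrightarrow> P' i \<subset> P' (Suc i)" "q.ker \<subseteq> P' 0"
      have "is_prime (P' 0)" using P'(1) by simp
      then have "subspace_ideal Z \<subseteq> P' 0" using over[of "P' 0"] ker P'(3) by simp
      then show "n \<le> s" by (intro prime_chain_length[where P = P', OF D]) (use P' in auto)
    qed (use P in auto)
  qed
  moreover have "real s = real (CARD('n) - 1) - real k" using G(2) by (simp add: k_def)
  ultimately show ?thesis
    unfolding complete_intersection_def Z.residue_ideal_eq
    by (intro exI[of _ k] exI[of _ "\<lambda>i. bar (\<alpha> H) (g i)"]) (auto simp: image_image)
qed

end

theorem lemma5p1: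
  fixes A :: "('k::field, 'n::{finite,linorder}) vec set set"
    and H :: "('k, 'n) vec set"
    and \<alpha> \<beta> :: "('k, 'n) vec set \<Rightarrow> ('k, 'n) vec"
  assumes "arrangement A" and "H \<in> A"
    and "defining_forms \<alpha> A" and "restricted_forms \<beta> A H"
  shows "min_primes (Sbar (\<alpha> H)) (residue_ideal \<alpha> \<beta> A H)
           = flat_ideal (\<alpha> H) ` Xi_max \<alpha> \<beta> A H
       \<and> ass_primes (Sbar (\<alpha> H)) (residue_ideal \<alpha> \<beta> A H)
           \<subseteq> flat_ideal (\<alpha> H) ` Xi \<alpha> \<beta> A H
       \<and> (\<forall>Z \<in> Xi_max \<alpha> \<beta> A H. free_arrangement \<alpha> (localization A Z) \<longrightarrow>
            complete_intersection (Sbar (\<alpha> H)) (CARD('n) - 1)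
              (residue_ideal \<alpha> \<beta> (localization A Z) H))"
proof -
  interpret arr A H \<alpha> \<beta> using assms by unfold_locales
  show ?thesis
    using min_primes_residue_ideal ass_primes_residue_ideal complete_intersection_residue_ideal by blast
qed

end
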